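(* Let $(E,d)$ be a locally compact, complete separable metric space, let $\lambda:E\to[0,\infty)$ be bounded, and let $\mu$ be a transition function from $E$ to $E$ (with $x\mapsto\mu(x,\cdot)$ continuous from $E$ to $\mathcal{P}(E)$ with the weak topology). Let $X$ be the Markov jump process on $E$ with initial law $\mathbb{P}_0$ and generator $$Af(x)=\lambda(x)\int[f(y)-f(x)]\,\mu(x,dy),$$ assumed to be a Feller process, i.e. its transition semigroup is strongly continuous on $C_0(E)$ with generator $A:C_0(E)\to C_0(E)$. Put $D=C_0(E)$ with $\tau_D$ the sup norm topology. Let $I$ be the good rate function of the large deviation principle on $D_{\mathcal{P}(E)}(\mathbb{R}^+)$ for $L_n=\{\frac1n\sum_{i=1}^n\delta_{X^i(t)}\}_{t\ge0}$, with $X^1,X^2,\dots$ independent copies of $X$, namely $$I(\nu)=\begin{cases} H(\nu(0)\,|\,\mathbb{P}_0)+\sup_{0=t_0<\dots<t_k}\sum_{i=1}^k I_{t_i-t_{i-1}}(\nu(t_i)\,|\,\nu(t_{i-1})) & \text{if }\nu\in C_{\mathcal{P}(E)}(\mathbb{R}^+),\\ \infty&\text{otherwise,}\end{cases}$$ where $I_t(\nu_2|\nu_1)=\sup_{f\in C_b(E)}\{\langle f,\nu_2\rangle-\langle V(t)f,\nu_1\rangle\}$ and $V(t)f(x)=\log\mathbb{E}[e^{f(X(t))}|X(0)=x]$. Then $$I(\nu)=\begin{cases}H(\nu(0)\,|\,\mathbb{P}_0)+\int_0^\infty\mathcal{L}(\nu(s),\dot\nu(s))\,ds&\text{if }\nu\in\mathcal{AC},\\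 \infty&\text{otherwise,}\end{cases}$$ where $\mathcal{L}(\rho,u)=\sup_{f\in D}\{\langle f,u\rangle-\langle Hf,\rho\rangle\}$ for $\rho\in\mathcal{P}(E)$, $u\in D'$.
   Context: $\mathbb{R}^+=[0,\infty)$; $C_0(E)$ is the space of continuous functions vanishing at infinity ($C(E)$ if $E$ is compact) with sup norm. $\mathcal{P}(E)$ carries the weak topology; $D_{\mathcal{P}(E)}(\mathbb{R}^+)$ is the Skorokhod space of càdlàg $\mathcal{P}(E)$-valued paths and $C_{\mathcal{P}(E)}(\mathbb{R}^+)$ its subspace of continuous paths. $\langle f,\rho\rangle=\int f\,d\rho$. $H(\cdot|\cdot)$ (two arguments) is relative entropy. A rate function is good if its level sets are compact. For $f\in D$, $Hf=e^{-f}Ae^f$, where $A$ is extended by $A\mathbf{1}=0$, i.e. $Hf=e^{-f}A(e^f-1)$; explicitly $Hf(x)=\lambda(x)\int[e^{f(y)-f(x)}-1]\,\mu(x,dy)$. $D'$ is the continuous dual of $D$ (here the dual of the Banach space $C_0(E)$) with the weak* topology. $\mathcal{AC}$ is the set of $\nu\in C_{\mathcal{P}(E)}(\mathbb{R}^+)$ for which there is a weak*-measurable curve $s\mapsto u(s)\in D'$ with $\int_0^t|\langle f,u(s)\rangle|ds<\infty$ and $\langle f,\nu(t)\rangle-\langle f,\nu(0)\rangle=\int_0^t\langle f,u(s)\rangle ds$ for all $f\in D$, $t\ge0$; then $\dot\nu(s):=u(s)$. *)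

theory Defs
  imports "HOL-Probability.Probability"
begin

section \<open>Function spaces and the weak topology\<close>

text \<open>The space of bounded continuous functions is the library set \<open>bcontfun\<close>. Its subset \<open>C0\<close> is
  kept as a set of plain functions; convergence in sup norm is \<open>uniform_limit UNIV\<close>.\<close>

definition C0 :: "('a::topological_space \<Rightarrow> real) set" where
  "C0 = {f \<in> bcontfun. \<forall>e>0. \<exists>K. compact K \<and> (\<forall>x. x \<notin> K \<longrightarrow> \<bar>f x\<bar> < e)}"

definition C0_dual :: "(('a::topological_space \<Rightarrow> real) \<Rightarrow> real) set" where
  "C0_dual = {u.
     (\<forall>f\<in>C0. \<forall>g\<in>C0. u (\<lambda>x. f x + g x) = u f + u g) \<and>
     (\<forall>c. \<forall>f\<in>C0. u (\<lambda>x. c * f x) = c * u f) \<and>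
     (\<exists>B. \<forall>f\<in>C0. \<bar>u f\<bar> \<le> B * (SUP x. \<bar>f x\<bar>))}"

abbreviation probs :: "'a::topological_space measure set" where
  "probs \<equiv> space (prob_algebra borel)"

text \<open>The coarsest topology on the Borel probability measures that makes \<open>\<rho> \<mapsto> \<integral>f d\<rho>\<close> continuous for
  every bounded continuous \<open>f\<close>: the pullback of the product topology under
  \<open>\<rho> \<mapsto> (\<integral>f d\<rho>)\<^sub>f\<close>.\<close>

definition weak_topology :: "'a::topological_space measure topology" where
  "weak_topology =
     pullback_topology probs (\<lambda>\<rho> (f::'a \<Rightarrow>\<^sub>C real). \<integral>x. apply_bcontfun f x \<partial>\<rho>) euclidean"

section \<open>Paths\<close>

text \<open>Paths are functions on all of \<open>real\<close> of which only the restriction to \<open>{0..}\<close> matters.\<close>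

definition cadlag_paths :: "'b topology \<Rightarrow> (real \<Rightarrow> 'b) set" where
  "cadlag_paths T = {p.
     (\<forall>t\<ge>0. limitin T p (p t) (at_right t)) \<and>
     (\<forall>t>0. \<exists>l. limitin T p l (at_left t))}"

definition continuous_paths :: "'b topology \<Rightarrow> (real \<Rightarrow> 'b) set" where
  "continuous_paths T = {p. continuous_map (top_of_set {0..}) T p}"

section \<open>Feller processes\<close>

definition transition_function :: "('a::topological_space \<Rightarrow> 'a measure) \<Rightarrow> bool" where
  "transition_function \<kappa> \<longleftrightarrow> \<kappa> \<in> borel \<rightarrow>\<^sub>M prob_algebra borel"

definition semigroup_op ::
    "(real \<Rightarrow> 'a \<Rightarrow> 'a measure) \<Rightarrow> real \<Rightarrow> ('a \<Rightarrow> real) \<Rightarrow> 'a \<Rightarrow> real" where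
  "semigroup_op P t f x = (\<integral>y. f y \<partial>P t x)"

text \<open>The graph of the generator, with its full domain, on \<open>C0\<close>.\<close>

definition C0_generator ::
    "(real \<Rightarrow> 'a::topological_space \<Rightarrow> 'a measure) \<Rightarrow> (('a \<Rightarrow> real) \<times> ('a \<Rightarrow> real)) set" where
  "C0_generator P = {(f, g). f \<in> C0 \<and> g \<in> C0 \<and>
     uniform_limit UNIV (\<lambda>t x. (semigroup_op P t f x - f x) / t) g (at_right 0)}"

definition feller_transition_functions ::
    "(real \<Rightarrow> 'a::topological_space \<Rightarrow> 'a measure) \<Rightarrow> bool" where
  "feller_transition_functions P \<longleftrightarrow>
     (\<forall>t\<ge>0. transition_function (P t)) \<and>
     (\<forall>x. P 0 x = return borel x) \<and>
     (\<forall>s\<ge>0. \<forall>t\<ge>0. \<forall>x. P (s + t) x = P s x \<bind> P t) \<and>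
     (\<forall>t\<ge>0. \<forall>f\<in>C0. semigroup_op P t f \<in> C0) \<and>
     (\<forall>f\<in>C0. uniform_limit UNIV (\<lambda>t. semigroup_op P t f) f (at_right 0))"

definition past :: "'w measure \<Rightarrow> (real \<Rightarrow> 'w \<Rightarrow> 'a::topological_space) \<Rightarrow> real \<Rightarrow> 'w measure" where
  "past M X s = sigma (space M) {X r -` B \<inter> space M | r B. 0 \<le> r \<and> r \<le> s \<and> B \<in> sets borel}"

definition markov_process ::
    "'w measure \<Rightarrow> (real \<Rightarrow> 'w \<Rightarrow> 'a::topological_space) \<Rightarrow> 'a measure
     \<Rightarrow> (real \<Rightarrow> 'a \<Rightarrow> 'a measure) \<Rightarrow> bool" where
  "markov_process M X P0 P \<longleftrightarrow>
     prob_space M \<and>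
     (\<forall>t\<ge>0. X t \<in> M \<rightarrow>\<^sub>M borel) \<and>
     (\<forall>\<omega>\<in>space M. (\<lambda>t. X t \<omega>) \<in> cadlag_paths euclidean) \<and>
     distr M borel (X 0) = P0 \<and>
     (\<forall>s\<ge>0. \<forall>t\<ge>0. \<forall>B\<in>sets borel.
        AE \<omega> in M. real_cond_exp M (past M X s) (\<lambda>\<omega>. indicator B (X (s + t) \<omega>)) \<omega>
                   = measure (P t (X s \<omega>)) B)"

definition jump_generator ::
    "('a \<Rightarrow> real) \<Rightarrow> ('a \<Rightarrow> 'a measure) \<Rightarrow> ('a \<Rightarrow> real) \<Rightarrow> 'a \<Rightarrow> real" where
  "jump_generator lam \<mu> f x = lam x * (\<integral>y. f y - f x \<partial>\<mu> x)"

section \<open>The rate function\<close>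

text \<open>The library's \<open>KL_divergence\<close> is real-valued and is only meaningful under absolute continuity
  and integrability of the log-density. The negative part of the log-density is always
  integrable, so non-integrability means that the relative entropy is infinite. The reference
  measure is the second argument here, but the first one of \<open>KL_divergence\<close>.\<close>

definition relative_entropy :: "'a measure \<Rightarrow> 'a measure \<Rightarrow> ereal" where
  "relative_entropy \<nu> \<rho> =
     (if absolutely_continuous \<rho> \<nu> \<and> integrable \<nu> (entropy_density (exp 1) \<rho> \<nu>)
      then ereal (KL_divergence (exp 1) \<rho> \<nu>) else \<infinity>)"

definition log_semigroup ::
    "(real \<Rightarrow> 'a \<Rightarrow> 'a measure) \<Rightarrow> real \<Rightarrow> ('a \<Rightarrow> real) \<Rightarrow> 'a \<Rightarrow> real" where
  "log_semigroup P t f x = ln (semigroup_op P t (\<lambda>y. exp (f y)) x)"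

definition cond_rate ::
    "(real \<Rightarrow> 'a::topological_space \<Rightarrow> 'a measure) \<Rightarrow> real \<Rightarrow> 'a measure \<Rightarrow> 'a measure \<Rightarrow> ereal" where
  "cond_rate P t \<nu>\<^sub>2 \<nu>\<^sub>1 =
     (SUP f\<in>bcontfun. ereal ((\<integral>x. f x \<partial>\<nu>\<^sub>2) - (\<integral>x. log_semigroup P t f x \<partial>\<nu>\<^sub>1)))"

definition path_rate ::
    "'a::topological_space measure \<Rightarrow> (real \<Rightarrow> 'a \<Rightarrow> 'a measure) \<Rightarrow> (real \<Rightarrow> 'a measure) \<Rightarrow> ereal" where
  "path_rate P0 P \<nu> =
     (if \<nu> \<in> continuous_paths weak_topology
      then relative_entropy (\<nu> 0) P0 +
           (SUP (k, t) \<in> {(k::nat, t::nat \<Rightarrow> real). t 0 = 0 \<and> (\<forall>i<k. t i < t (Suc i))}.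
              \<Sum>i=1..k. cond_rate P (t i - t (i - 1)) (\<nu> (t i)) (\<nu> (t (i - 1))))
      else \<infinity>)"

section \<open>Hamiltonian, Lagrangian and absolutely continuous paths\<close>

text \<open>Here \<open>A\<close> acts on \<open>e\<^sup>f - 1 \<in> C0\<close>, following the extension of \<open>A\<close> by \<open>A 1 = 0\<close>.\<close>

definition hamiltonian ::
    "(('a \<Rightarrow> real) \<Rightarrow> 'a \<Rightarrow> real) \<Rightarrow> ('a \<Rightarrow> real) \<Rightarrow> 'a \<Rightarrow> real" where
  "hamiltonian A f x = exp (- f x) * A (\<lambda>y. exp (f y) - 1) x"

definition lagrangian ::
    "(('a::topological_space \<Rightarrow> real) \<Rightarrow> 'a \<Rightarrow> real) \<Rightarrow> 'a measure \<Rightarrow> (('a \<Rightarrow> real) \<Rightarrow> real) \<Rightarrow> ereal" where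
  "lagrangian A \<rho> u = (SUP f\<in>C0. ereal (u f - (\<integral>x. hamiltonian A f x \<partial>\<rho>)))"

text \<open>\<open>is_velocity \<nu> u\<close> says that the weak*-measurable curve \<open>u\<close> in the dual of \<open>C0\<close> is a derivative
  of \<open>\<nu>\<close>. Such a \<open>u\<close> is determined only up to a Lebesgue null set of times.\<close>

definition is_velocity ::
    "(real \<Rightarrow> 'a::topological_space measure) \<Rightarrow> (real \<Rightarrow> ('a \<Rightarrow> real) \<Rightarrow> real) \<Rightarrow> bool" where
  "is_velocity \<nu> u \<longleftrightarrow>
     (\<forall>s\<ge>0. u s \<in> C0_dual) \<and>
     (\<forall>f\<in>C0. set_borel_measurable borel {0..} (\<lambda>s. u s f)) \<and>
     (\<forall>f\<in>C0. \<forall>t\<ge>0. set_integrable lborel {0..t} (\<lambda>s. u s f) \<and>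
        (\<integral>x. f x \<partial>\<nu> t) - (\<integral>x. f x \<partial>\<nu> 0) = (LINT s:{0..t}|lborel. u s f))"

definition AC_paths :: "(real \<Rightarrow> 'a::topological_space measure) set" where
  "AC_paths = {\<nu> \<in> continuous_paths weak_topology. \<exists>u. is_velocity \<nu> u}"

definition action ::
    "(('a::topological_space \<Rightarrow> real) \<Rightarrow> 'a \<Rightarrow> real) \<Rightarrow> (real \<Rightarrow> 'a measure)
     \<Rightarrow> (real \<Rightarrow> ('a \<Rightarrow> real) \<Rightarrow> real) \<Rightarrow> ereal" where
  "action A \<nu> u = enn2ereal (\<integral>\<^sup>+s\<in>{0..}. e2ennreal (lagrangian A (\<nu> s) (u s)) \<partial>lborel)"

end

theory Submission
  imports Defs
begin

text \<open>Let \<open>V(t)\<close> be the logarithmic semigroup and \<open>H\<close> the Hamiltonian. Since the jump rates are bounded,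
  \<open>V(t)f = f + t Hf + O(t\<^sup>2)\<close> uniformly on bounded subsets of \<open>C\<^sub>0\<close>. Write \<open>J\<close> for the supremum over
  partitions in the rate function.

  \<open>J \<le> \<integral>L\<close>: along \<open>g(s) = V(b - s)f\<close> the function \<open>s \<mapsto> \<langle>g(s), \<nu>(s)\<rangle>\<close> grows on a short interval by at most
  the integral of \<open>\<langle>g, u\<rangle> - \<langle>Hg, \<nu>\<rangle> \<le> L(\<nu>, u)\<close> plus a negligible error, which bounds every summand
  \<open>I\<^bsub>b-a\<^esub>(\<nu>(b) | \<nu>(a))\<close>.

  \<open>\<integral>L \<le> J\<close>: if \<open>J < \<infinity>\<close>, the partial suprema form a bounded increasing function \<open>m\<close> with
  \<open>I\<^bsub>b-a\<^esub>(\<nu>(b) | \<nu>(a)) \<le> m(b) - m(a)\<close>. Short partitions give \<open>\<integral>\<^sub>a\<^sup>b(\<langle>f, u\<rangle> - \<langle>Hf, \<nu>\<rangle>)ds \<le> m(b) - m(a)\<close> for every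
  \<open>f\<close>; this passes to the Stieltjes measure of \<open>m\<close> on Borel sets, where one may take the supremum over a
  countable dense set of \<open>f\<close>.

  Existence of the velocity if \<open>J < \<infinity>\<close>: testing with \<open>n f\<close>, \<open>|f| \<le> 1\<close>, gives
  \<open>n(\<langle>f, \<nu>(b)\<rangle> - \<langle>f, \<nu>(a)\<rangle>) \<le> m(b) - m(a) + C\<^sub>n(b - a)\<close> for all \<open>n\<close>. Letting \<open>n \<rightarrow> \<infinity>\<close> on Lebesgue null sets
  shows that the singular part of \<open>m\<close> does not contribute, so all \<open>t \<mapsto> \<langle>f, \<nu>(t)\<rangle>\<close> have densities with a common
  integrable majorant, and these are assembled to a functional on \<open>C\<^sub>0\<close> at almost every time.\<close>

section \<open>Measures on the real line determined by half-open intervals\<close>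

text \<open>Testing with \<open>n f\<close> costs a constant of order exp(4n), the price of the
  exponential in V. On an interval this is hopeless for large n; but the constant multiplies
  Lebesgue measure, so on a null set n is free. Inequalities between increments must therefore
  become inequalities between measures on all Borel sets. Measures cannot be subtracted, so a signed
  function is moved to the other side or first made increasing by adding a larger increasing
  function.

  \<open>interval_measure\<close> lives on the whole line, time on [0,\<infinity>): densities are
  continued by 0 and paths by their value at time 0, written \<open>max 0 t\<close>.

  Two mismatches have to be bridged. The supremum in \<open>cond_rate\<close> runs over bounded
  continuous functions while a velocity acts on \<open>C0\<close>; cutoffs and dominated convergence
  settle this. And the linearity of a velocity is known only up to null sets that depend on the
  functions involved; separability of \<open>C0\<close> reduces it to countably many relations, and
  the common majorant bounds the functional outside a single null set.\<close>

definition add_measure :: "'a measure \<Rightarrow> 'a measure \<Rightarrow> 'a measure" where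
  "add_measure M N = measure_of (space M) (sets M) (\<lambda>A. emeasure M A + emeasure N A)"

lemma sets_add_measure [simp]: "sets (add_measure M N) = sets M"
  by (simp add: add_measure_def)

lemma emeasure_add_measure:
  assumes "sets N = sets M" and "A \<in> sets M"
  shows "emeasure (add_measure M N) A = emeasure M A + emeasure N A"
  unfolding add_measure_def
proof (rule emeasure_measure_of_sigma)
  show "countably_additive (sets M) (\<lambda>A. emeasure M A + emeasure N A)"
  proof (rule countably_additiveI)
    fix B :: "nat \<Rightarrow> 'a set"
    assume B: "range B \<subseteq> sets M" "disjoint_family B" "\<Union> (range B) \<in> sets M"
    have "(\<Sum>i. emeasure M (B i) + emeasure N (B i)) = (\<Sum>i. emeasure M (B i)) + (\<Sum>i. emeasure N (B i))"
      by (rule suminf_add[symmetric]) auto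
    also have "\<dots> = emeasure M (\<Union> (range B)) + emeasure N (\<Union> (range B))"
      using B assms(1) by (simp add: suminf_emeasure)
    finally show "(\<Sum>i. emeasure M (B i) + emeasure N (B i)) = emeasure M (\<Union> (range B)) + emeasure N (\<Union> (range B))" .
  qed
qed (auto simp: positive_def assms sets.sigma_algebra_axioms)

text \<open>Half-open intervals are stable under intersection and generate the Borel sets;
  finiteness on a countable exhaustion makes the uniqueness theorem for measures applicable.\<close>

lemma borel_measures_eqI_Ioc:
  fixes M N :: "real measure"
  assumes "sets M = sets borel" "sets N = sets borel"
    and eq: "\<And>a b. a < b \<Longrightarrow> emeasure M {a<..b} = emeasure N {a<..b}"
    and fin: "\<And>a b. a < b \<Longrightarrow> emeasure M {a<..b} < \<infinity>"
  shows "M = N"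
proof (rule measure_eqI_generator_eq)
  let ?E = "range (\<lambda>(a, b). {a<..b::real})"
  have "{a<..b} \<inter> {c<..d} = {max a c<..min b d}" for a b c d :: real
    by auto
  then show "Int_stable ?E"
    by (auto simp: Int_stable_def)
  show "sets M = sigma_sets UNIV ?E" "sets N = sigma_sets UNIV ?E"
    using assms(1,2) by (simp_all add: borel_sigma_sets_Ioc)
  show "emeasure M X = emeasure N X" if X: "X \<in> ?E" for X
  proof -
    obtain p where "X = (case p of (a, b) \<Rightarrow> {a<..b})" using X by blast
    then obtain a b where "X = {a<..b}" by (cases p) simp
    then show ?thesis using eq[of a b] by (cases "a < b") auto
  qed
  \<comment> \<open>The extra 1 keeps the interval nonempty at n = 0, so that \<open>fin\<close>
    applies.\<close>
  show "range (\<lambda>n::nat. {- real n - 1<..real n}) \<subseteq> ?E" by auto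
  have "\<exists>n::nat. - real n - 1 < x \<and> x \<le> real n" for x :: real
  proof -
    obtain n :: nat where "\<bar>x\<bar> < real n" using reals_Archimedean2 by blast
    then show ?thesis by (intro exI[of _ n]) auto
  qed
  then show "(\<Union>n::nat. {- real n - 1<..real n}) = UNIV" by auto
  show "emeasure M {- real n - 1<..real n} \<noteq> \<infinity>" for n
    using fin[of "- real n - 1" "real n"] by simp
qed simp

text \<open>Distribution functions: monotonicity and right-continuity are what
  \<open>interval_measure\<close> requires in order to give {a<..b} the mass F b - F a.\<close>

definition stieltjes :: "(real \<Rightarrow> real) \<Rightarrow> bool" where
  "stieltjes F \<longleftrightarrow> (\<forall>x y. x \<le> y \<longrightarrow> F x \<le> F y) \<and> (\<forall>x. continuous (at_right x) F)"

lemma stieltjes_add: "stieltjes F \<Longrightarrow> stieltjes G \<Longrightarrow> stieltjes (\<lambda>t. F t + G t)"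
  by (auto simp: stieltjes_def intro!: continuous_intros add_mono)

lemma stieltjes_cmult: "stieltjes F \<Longrightarrow> 0 \<le> c \<Longrightarrow> stieltjes (\<lambda>t. c * F t)"
  by (auto simp: stieltjes_def intro!: continuous_intros mult_left_mono)

lemma emeasure_stieltjes_Ioc:
  "stieltjes F \<Longrightarrow> a < b \<Longrightarrow> emeasure (interval_measure F) {a<..b} = ennreal (F b - F a)"
  by (intro emeasure_interval_measure_Ioc) (auto simp: stieltjes_def)

text \<open>Both sides give the same mass to half-open intervals. Through this lemma an identity
  between sums of increasing functions becomes an identity between sums of measures.\<close>

lemma emeasure_stieltjes_add:
  assumes FG: "stieltjes F" "stieltjes G" and B: "B \<in> sets borel"
  shows "emeasure (interval_measure (\<lambda>t. F t + G t)) B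
    = emeasure (interval_measure F) B + emeasure (interval_measure G) B"
proof -
  have "add_measure (interval_measure F) (interval_measure G) = interval_measure (\<lambda>t. F t + G t)"
  proof (rule borel_measures_eqI_Ioc)
    fix a b :: real assume ab: "a < b"
    then have "F a \<le> F b" "G a \<le> G b" using FG by (auto simp: stieltjes_def)
    then show "emeasure (add_measure (interval_measure F) (interval_measure G)) {a<..b}
        = emeasure (interval_measure (\<lambda>t. F t + G t)) {a<..b}"
      using ab FG
      by (simp add: emeasure_add_measure emeasure_stieltjes_Ioc stieltjes_add ennreal_plus[symmetric] del: ennreal_plus)
    show "emeasure (add_measure (interval_measure F) (interval_measure G)) {a<..b} < \<infinity>"
      using ab FG by (simp add: emeasure_add_measure emeasure_stieltjes_Ioc)
  qed simp_all
  then show ?thesis using B emeasure_add_measure[of "interval_measure G" "interval_measure F" B] by simp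
qed

lemma emeasure_stieltjes_cmult:
  assumes F: "stieltjes F" and c: "0 \<le> c"
  shows "emeasure (interval_measure (\<lambda>t. c * F t)) B = ennreal c * emeasure (interval_measure F) B"
proof -
  have "interval_measure (\<lambda>t. c * F t) = scale_measure (ennreal c) (interval_measure F)"
  proof (rule borel_measures_eqI_Ioc)
    fix a b :: real assume ab: "a < b"
    then have "F a \<le> F b" using F by (auto simp: stieltjes_def)
    then show "emeasure (interval_measure (\<lambda>t. c * F t)) {a<..b} = emeasure (scale_measure (ennreal c) (interval_measure F)) {a<..b}"
      using ab F c by (simp add: emeasure_stieltjes_Ioc stieltjes_cmult ennreal_mult[symmetric] right_diff_distrib)
    show "emeasure (interval_measure (\<lambda>t. c * F t)) {a<..b} < \<infinity>"
      using ab F c by (simp add: emeasure_stieltjes_Ioc stieltjes_cmult)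
  qed simp_all
  then show ?thesis by simp
qed

lemma stieltjes_id: "stieltjes (\<lambda>t. t)"
  by (auto simp: stieltjes_def intro!: continuous_intros)

lemma interval_measure_le_of_increments:
  fixes F :: "real \<Rightarrow> real"
  assumes F: "stieltjes F" and bd: "\<And>x. 0 \<le> F x" "\<And>x. F x \<le> J"
  shows "emeasure (interval_measure F) UNIV \<le> ennreal J"
proof -
  have U: "UNIV = (\<Union>n::nat. {- real n<..real n})"
  proof -
    have "\<exists>n::nat. - real n < x \<and> x \<le> real n" for x :: real
    proof -
      obtain n :: nat where "\<bar>x\<bar> < real n" using reals_Archimedean2 by blast
      then show ?thesis by (intro exI[of _ n]) auto
    qed
    then show ?thesis by auto
  qed
  have "emeasure (interval_measure F) UNIV = (SUP n. emeasure (interval_measure F) {- real n<..real n})"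
    unfolding U by (rule SUP_emeasure_incseq[symmetric]) (auto simp: incseq_def)
  also have "\<dots> \<le> ennreal J"
  proof (rule SUP_least)
    fix n :: nat
    have "emeasure (interval_measure F) {- real n<..real n} = ennreal (F (real n) - F (- real n))"
      using emeasure_stieltjes_Ioc[OF F, of "- real n" "real n"] by (cases "n = 0") auto
    also have "\<dots> \<le> ennreal J"
      using bd(1)[of "- real n"] bd(2)[of "real n"] by (intro ennreal_leI) linarith
    finally show "emeasure (interval_measure F) {- real n<..real n} \<le> ennreal J" .
  qed
  finally show ?thesis .
qed

section \<open>Primitives of locally integrable functions\<close>

lemma set_integrable_Ioc:
  fixes \<phi> :: "real \<Rightarrow> real"
  assumes "\<And>a b. set_integrable lborel {a..b} \<phi>"
  shows "set_integrable lborel {a<..b} \<phi>"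
  using assms[of a b] by (rule set_integrable_subset) auto

lemma set_integral_Ioc_const: "x \<le> y \<Longrightarrow> (LBINT s:{x<..y}. (c::real)) = c * (y - x)"
  by (simp add: set_lebesgue_integral_def mult.commute)

lemma set_integral_Ioc_le_const:
  fixes g :: "real \<Rightarrow> real"
  assumes "x \<le> y" "set_integrable lborel {x<..y} g" "\<And>s. x < s \<Longrightarrow> s \<le> y \<Longrightarrow> g s \<le> c"
  shows "(LBINT s:{x<..y}. g s) \<le> c * (y - x)"
proof -
  have "(LBINT s:{x<..y}. g s) \<le> (LBINT s:{x<..y}. c)"
    using assms by (intro set_integral_mono) (auto simp: set_integrable_def)
  then show ?thesis using set_integral_Ioc_const[OF assms(1)] by simp
qed

lemma set_integral_Ioc_ge_const:
  fixes g :: "real \<Rightarrow> real"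
  assumes "x \<le> y" "set_integrable lborel {x<..y} g" "\<And>s. x < s \<Longrightarrow> s \<le> y \<Longrightarrow> c \<le> g s"
  shows "c * (y - x) \<le> (LBINT s:{x<..y}. g s)"
proof -
  have "(LBINT s:{x<..y}. c) \<le> (LBINT s:{x<..y}. g s)"
    using assms by (intro set_integral_mono) (auto simp: set_integrable_def)
  then show ?thesis using set_integral_Ioc_const[OF assms(1)] by simp
qed

text \<open>With g continued by 0 the integral over {0..t} vanishes for t < 0, so a single formula
  serves the whole line: for a < 0 the part of {a<..b} before time 0 contributes nothing.\<close>

lemma indefinite_integral_increment:
  fixes g :: "real \<Rightarrow> real"
  assumes int: "\<And>a b. set_integrable lborel {a..b} g" and neg: "\<And>s. s < 0 \<Longrightarrow> g s = 0" and "a \<le> b"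
  shows "(LBINT s:{0..b}. g s) - (LBINT s:{0..a}. g s) = (LBINT s:{a<..b}. g s)"
proof (cases "0 \<le> a")
  case True
  have "(LINT s:{0..a} \<union> {a<..b}|lborel. g s) = (LBINT s:{0..a}. g s) + (LBINT s:{a<..b}. g s)"
    by (intro set_integral_Un int set_integrable_Ioc) auto
  moreover have "{0..a} \<union> {a<..b} = {0..b}" using True assms by auto
  ultimately show ?thesis by simp
next
  case False
  have "(LBINT s:{a<..b}. g s) = (LBINT s:{0..b}. g s)"
    unfolding set_lebesgue_integral_def
    by (intro Bochner_Integration.integral_cong) (use False neg in \<open>auto simp: indicator_def not_le\<close>)
  moreover have "{0..a} = {}" using False by auto
  ultimately show ?thesis by (simp add: set_lebesgue_integral_def)
qed

lemma indefinite_integral_right_continuous: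
  fixes g :: "real \<Rightarrow> real"
  assumes int: "\<And>a b. set_integrable lborel {a..b} g" and neg: "\<And>s. s < 0 \<Longrightarrow> g s = 0"
  shows "continuous (at_right x) (\<lambda>t. LBINT s:{0..t}. g s)"
proof -
  let ?\<Phi> = "\<lambda>t. LBINT s:{0..t}. g s"
  have eq: "integral {x..t} g + ?\<Phi> x = ?\<Phi> t" if "t \<in> {x..x + 1}" for t
  proof -
    have "integral {x..t} g = (LBINT s:{x..t}. g s)"
      using int[of x t] by (simp add: set_borel_integral_eq_integral)
    also have "\<dots> = (LBINT s:{x<..t}. g s)"
      unfolding set_lebesgue_integral_def
    proof (rule integral_cong_AE)
      have m: "(\<lambda>s. indicator {x..t} s *\<^sub>R g s) \<in> borel_measurable lborel"
        using int[of x t] by (simp add: set_integrable_def)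
      then show "(\<lambda>s. indicator {x..t} s *\<^sub>R g s) \<in> borel_measurable lborel" .
      have m2: "(\<lambda>s. indicator {x<..t} s *\<^sub>R g s) \<in> borel_measurable lborel"
        using set_integrable_Ioc[OF int, of x t] by (simp add: set_integrable_def)
      then show "(\<lambda>s. indicator {x<..t} s *\<^sub>R g s) \<in> borel_measurable lborel" .
      show "AE s in lborel. indicator {x..t} s *\<^sub>R g s = indicator {x<..t} s *\<^sub>R g s"
        by (rule AE_mp[OF AE_lborel_singleton[of x]]) (auto simp: indicator_def)
    qed
    also have "\<dots> = ?\<Phi> t - ?\<Phi> x"
      using indefinite_integral_increment[OF int neg, of x t] that by simp
    finally show ?thesis by simp
  qed
  have "continuous_on {x..x + 1} (\<lambda>t. integral {x..t} g)"
    using set_borel_integral_eq_integral(1)[OF int[of x "x + 1"]] by (rule indefinite_integral_continuous_1)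
  then have "continuous_on {x..x + 1} (\<lambda>t. integral {x..t} g + ?\<Phi> x)"
    by (intro continuous_intros)
  then have "continuous_on {x..x + 1} ?\<Phi>"
    using eq by (subst (asm) continuous_on_cong[OF refl, of _ _ ?\<Phi>]) auto
  then have "continuous (at x within {x..x + 1}) ?\<Phi>"
    by (simp add: continuous_on_eq_continuous_within)
  then show ?thesis by (simp add: at_within_Icc_at_right)
qed

lemma density_Ioc:
  fixes h :: "real \<Rightarrow> real"
  assumes [measurable]: "h \<in> borel_measurable borel" and int: "set_integrable lborel {a<..b} h" and "\<And>s. 0 \<le> h s"
  shows "emeasure (density lborel (\<lambda>s. ennreal (h s))) {a<..b} = ennreal (LBINT s:{a<..b}. h s)"
proof -
  have "emeasure (density lborel (\<lambda>s. ennreal (h s))) {a<..b} = (\<integral>\<^sup>+s. ennreal (indicator {a<..b} s * h s) \<partial>lborel)"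
    by (subst emeasure_density) (auto intro!: nn_integral_cong simp: indicator_def)
  also have "\<dots> = ennreal (LBINT s:{a<..b}. h s)"
    using int assms(3) by (subst nn_integral_eq_integral) (auto simp: set_integrable_def set_lebesgue_integral_def)
  finally show ?thesis .
qed

lemma interval_measure_indefinite_integral:
  fixes h :: "real \<Rightarrow> real"
  assumes "h \<in> borel_measurable borel" and h0: "\<And>s. 0 \<le> h s"
    and int: "\<And>a b. set_integrable lborel {a..b} h" and neg: "\<And>s. s < 0 \<Longrightarrow> h s = 0"
  defines "\<Psi> \<equiv> \<lambda>t. LBINT s:{0..t}. h s"
  shows "stieltjes \<Psi>" and "interval_measure \<Psi> = density lborel (\<lambda>s. ennreal (h s))"
proof -
  have incr: "\<Psi> b - \<Psi> a = (LBINT s:{a<..b}. h s)" if "a \<le> b" for a b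
    unfolding \<Psi>_def by (rule indefinite_integral_increment[OF int neg that])
  have "0 \<le> (LBINT s:{a<..b}. h s)" for a b
    unfolding set_lebesgue_integral_def using h0 by (intro integral_nonneg_AE) auto
  then have "\<Psi> a \<le> \<Psi> b" if "a \<le> b" for a b
    using incr[OF that] by (metis diff_ge_0_iff_ge)
  then show \<Psi>: "stieltjes \<Psi>"
    using indefinite_integral_right_continuous[OF int neg] unfolding stieltjes_def \<Psi>_def by blast
  show "interval_measure \<Psi> = density lborel (\<lambda>s. ennreal (h s))"
    by (rule borel_measures_eqI_Ioc)
       (use incr assms(1) set_integrable_Ioc[OF int] in \<open>auto simp: emeasure_stieltjes_Ioc[OF \<Psi>] density_Ioc h0\<close>)
qed

text \<open>An estimate on intervals says nothing directly about the positive part of \<phi>. But F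
  minus the primitive of \<phi> is increasing and so has a measure, whence \<phi>^+ ds \<le> dF +
  \<phi>^- ds on Borel sets. Restriction to the set where \<phi> is positive removes the last
  term.\<close>

lemma nn_integral_le_interval_measure:
  fixes \<phi> F :: "real \<Rightarrow> real"
  assumes [measurable]: "\<phi> \<in> borel_measurable borel"
    and int: "\<And>a b. set_integrable lborel {a..b} \<phi>" and neg: "\<And>s. s < 0 \<Longrightarrow> \<phi> s = 0"
    and F: "stieltjes F"
    and le: "\<And>a b. a < b \<Longrightarrow> (LBINT s:{a<..b}. \<phi> s) \<le> F b - F a"
    and A: "A \<in> sets borel"
  shows "(\<integral>\<^sup>+s\<in>A. ennreal (\<phi> s) \<partial>lborel) \<le> emeasure (interval_measure F) A"
proof -
  define p n where "p s = max 0 (\<phi> s)" and "n s = max 0 (- \<phi> s)" for s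
  have pm[measurable]: "p \<in> borel_measurable borel" and nm[measurable]: "n \<in> borel_measurable borel"
    unfolding p_def[abs_def] n_def[abs_def] by measurable
  have pint: "set_integrable lborel {a..b} p" and nint: "set_integrable lborel {a..b} n" for a b
    unfolding set_integrable_def
    by (rule Bochner_Integration.integrable_bound[OF int[of a b, unfolded set_integrable_def]];
        simp add: p_def n_def indicator_def)+
  have pn0: "\<And>s. 0 \<le> p s" "\<And>s. 0 \<le> n s" "\<And>s. s < 0 \<Longrightarrow> p s = 0" "\<And>s. s < 0 \<Longrightarrow> n s = 0"
    using neg by (auto simp: p_def n_def)
  let ?p = "\<lambda>t. LBINT s:{0..t}. p s" and ?n = "\<lambda>t. LBINT s:{0..t}. n s"
  note P = interval_measure_indefinite_integral[OF pm pn0(1) pint pn0(3)]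
  note N = interval_measure_indefinite_integral[OF nm pn0(2) nint pn0(4)]
  \<comment> \<open>Adding \<open>?p\<close> to \<open>?G\<close> gives \<open>F + ?n\<close>: an
    identity between increasing functions, hence between measures.\<close>
  let ?G = "\<lambda>t. F t - ?p t + ?n t"
  have G: "stieltjes ?G"
    unfolding stieltjes_def
  proof (intro conjI allI impI)
    fix a b :: real assume ab: "a \<le> b"
    have "(?p b - ?p a) - (?n b - ?n a) = (LBINT s:{a<..b}. p s - n s)"
      using indefinite_integral_increment[OF pint pn0(3) ab] indefinite_integral_increment[OF nint pn0(4) ab]
        set_integral_diff(2)[OF set_integrable_Ioc[OF pint, of a b] set_integrable_Ioc[OF nint, of a b]] by simp
    also have "\<dots> = (LBINT s:{a<..b}. \<phi> s)"
      by (intro set_lebesgue_integral_cong) (auto simp: p_def n_def max_def)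
    also have "\<dots> \<le> F b - F a" using le[of a b] ab by (cases "a = b") (auto simp: set_lebesgue_integral_def)
    finally show "?G a \<le> ?G b" by linarith
  qed (use P(1) N(1) F in \<open>intro continuous_intros; simp add: stieltjes_def\<close>)
  let ?P = "density lborel (\<lambda>s. ennreal (p s))" and ?N = "density lborel (\<lambda>s. ennreal (n s))"
  have eq: "emeasure (interval_measure ?G) B + emeasure ?P B = emeasure (interval_measure F) B + emeasure ?N B"
    if B: "B \<in> sets borel" for B
  proof -
    have "emeasure (interval_measure (\<lambda>t. ?G t + ?p t)) B = emeasure (interval_measure (\<lambda>t. F t + ?n t)) B"
      by simp
    then show ?thesis
      by (simp only: emeasure_stieltjes_add[OF G P(1) B] emeasure_stieltjes_add[OF F N(1) B] P(2) N(2))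
  qed
  let ?B = "A \<inter> {s. 0 < \<phi> s}"
  have B: "?B \<in> sets borel" using A by measurable
  have "(\<integral>\<^sup>+s\<in>A. ennreal (\<phi> s) \<partial>lborel) = emeasure ?P ?B"
    using B by (subst emeasure_density)
      (auto intro!: nn_integral_cong simp: p_def indicator_def ennreal_neg not_less)
  also have "\<dots> \<le> emeasure (interval_measure F) ?B + emeasure ?N ?B"
    unfolding eq[OF B, symmetric] by simp
  also have "emeasure ?N ?B = 0"
  proof -
    have "emeasure ?N ?B = (\<integral>\<^sup>+s. ennreal (n s) * indicator ?B s \<partial>lborel)"
      using B by (intro emeasure_density) auto
    also have "\<dots> = (\<integral>\<^sup>+s. 0 \<partial>(lborel::real measure))"
      by (rule nn_integral_cong) (auto simp: n_def indicator_def ennreal_neg)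
    finally show ?thesis by simp
  qed
  also have "emeasure (interval_measure F) ?B + 0 \<le> emeasure (interval_measure F) A"
    using A by (simp add: emeasure_mono)
  finally show ?thesis .
qed

text \<open>Domination on every Borel set, not just on intervals, permits cutting A along the
  comparison of g and h and using on each piece the bound for the larger one.\<close>

lemma nn_integral_max_le:
  fixes g h :: "real \<Rightarrow> ennreal" and N :: "real measure"
  assumes [measurable]: "g \<in> borel_measurable borel" "h \<in> borel_measurable borel"
    and N[simp]: "sets N = sets borel"
    and g: "\<And>A. A \<in> sets borel \<Longrightarrow> (\<integral>\<^sup>+s\<in>A. g s \<partial>lborel) \<le> emeasure N A"
    and h: "\<And>A. A \<in> sets borel \<Longrightarrow> (\<integral>\<^sup>+s\<in>A. h s \<partial>lborel) \<le> emeasure N A"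
    and A[measurable]: "A \<in> sets borel"
  shows "(\<integral>\<^sup>+s\<in>A. max (g s) (h s) \<partial>lborel) \<le> emeasure N A"
proof -
  let ?B = "A \<inter> {s. g s \<le> h s}" and ?C = "A \<inter> {s. h s < g s}"
  have B: "?B \<in> sets borel" and C: "?C \<in> sets borel" by measurable
  have [measurable]: "?B \<in> sets borel" "?C \<in> sets borel" by (fact B, fact C)
  have "(\<integral>\<^sup>+s\<in>A. max (g s) (h s) \<partial>lborel) = (\<integral>\<^sup>+s. h s * indicator ?B s + g s * indicator ?C s \<partial>lborel)"
    by (intro nn_integral_cong) (auto simp: indicator_def max_def)
  also have "\<dots> = (\<integral>\<^sup>+s\<in>?B. h s \<partial>lborel) + (\<integral>\<^sup>+s\<in>?C. g s \<partial>lborel)"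
    by (rule nn_integral_add) measurable
  also have "\<dots> \<le> emeasure N ?B + emeasure N ?C"
    by (intro add_mono g h B C)
  also have "\<dots> = emeasure N (?B \<union> ?C)"
    using B C by (intro plus_emeasure) auto
  also have "?B \<union> ?C = A" by auto
  finally show ?thesis .
qed

text \<open>Running maxima form an increasing sequence with the same supremum, so monotone
  convergence extends the bound for finite maxima.\<close>

lemma nn_integral_SUP_le:
  fixes g :: "nat \<Rightarrow> real \<Rightarrow> ennreal" and N :: "real measure"
  assumes [measurable]: "\<And>n. g n \<in> borel_measurable borel" and N: "sets N = sets borel"
    and g: "\<And>n A. A \<in> sets borel \<Longrightarrow> (\<integral>\<^sup>+s\<in>A. g n s \<partial>lborel) \<le> emeasure N A"
  shows "(\<integral>\<^sup>+s. (SUP n. g n s) \<partial>lborel) \<le> emeasure N UNIV"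
proof -
  define G where "G n s = Max ((\<lambda>k. g k s) ` {..n})" for n s
  have G_Suc: "G (Suc n) = (\<lambda>s. max (G n s) (g (Suc n) s))" for n
    by (rule ext) (simp add: G_def atMost_Suc max.commute)
  have Gm[measurable]: "G n \<in> borel_measurable borel" for n
    by (induction n) (simp_all add: G_Suc, simp add: G_def)
  have GN: "(\<integral>\<^sup>+s\<in>A. G n s \<partial>lborel) \<le> emeasure N A" if "A \<in> sets borel" for A n
    using that
  proof (induction n arbitrary: A)
    case 0 then show ?case using g[of A 0] by (simp add: G_def)
  next
    case (Suc n) then show ?case
      unfolding G_Suc by (intro nn_integral_max_le Suc g) (auto simp: N)
  qed
  have SUP: "(SUP n. g n s) = (SUP n. G n s)" for s
  proof (rule antisym)
    show "(SUP n. g n s) \<le> (SUP n. G n s)"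
      by (rule SUP_mono) (auto simp: G_def intro!: Max_ge)
    show "(SUP n. G n s) \<le> (SUP n. g n s)"
      by (rule SUP_least) (auto simp: G_def intro!: SUP_upper)
  qed
  have "(\<integral>\<^sup>+s. (SUP n. g n s) \<partial>lborel) = (\<integral>\<^sup>+s. (SUP n. G n s) \<partial>lborel)"
    unfolding SUP ..
  also have "\<dots> = (SUP n. \<integral>\<^sup>+s. G n s \<partial>lborel)"
    by (rule nn_integral_monotone_convergence_SUP)
       (auto simp: G_Suc le_fun_def intro!: incseq_SucI)
  also have "\<dots> \<le> emeasure N UNIV"
    using GN[of UNIV] by (intro SUP_least) simp
  finally show ?thesis .
qed

section \<open>Increments\<close>

text \<open>Takes the place of a differential inequality: with C an arbitrary \<eta> > 0, a function
  whose short increments are at most \<eta>(y - x) grows by at most \<eta>(b - a), and no derivative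
  has to be formed. What makes it work is that \<delta> does not depend on the position.\<close>

lemma increment_le_if_locally:
  fixes \<phi> :: "real \<Rightarrow> real"
  assumes "0 < \<delta>" "a \<le> b"
    and loc: "\<And>x y. a \<le> x \<Longrightarrow> x < y \<Longrightarrow> y \<le> b \<Longrightarrow> y - x < \<delta> \<Longrightarrow> \<phi> y - \<phi> x \<le> C * (y - x)"
  shows "\<phi> b - \<phi> a \<le> C * (b - a)"
proof (cases "a = b")
  case False
  then have ab: "a < b" using assms by simp
  obtain n :: nat where n: "(b - a) / \<delta> < real n" using reals_Archimedean2 by blast
  moreover have "0 < (b - a) / \<delta>" using ab \<open>0 < \<delta>\<close> by simp
  ultimately have n0: "0 < real n" by linarith
  define h where "h = (b - a) / real n"
  have h: "0 < h" "h < \<delta>" "real n * h = b - a"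
    using n n0 ab \<open>0 < \<delta>\<close> by (auto simp: h_def field_simps)
  define t where "t k = a + real k * h" for k
  have t_le: "t k \<le> b" if "k \<le> n" for k
  proof -
    have "real k * h \<le> real n * h" using that h by (intro mult_right_mono) auto
    then show ?thesis using h by (simp add: t_def)
  qed
  have "\<phi> b - \<phi> a = \<phi> (t n) - \<phi> (t 0)" using h by (simp add: t_def)
  also have "\<dots> = (\<Sum>k<n. \<phi> (t (Suc k)) - \<phi> (t k))" using sum_lessThan_telescope[of "\<lambda>k. \<phi> (t k)" n] by simp
  also have "\<dots> \<le> (\<Sum>k<n. C * h)"
  proof (rule sum_mono)
    fix k assume "k \<in> {..<n}"
    then have "\<phi> (t (Suc k)) - \<phi> (t k) \<le> C * (t (Suc k) - t k)"
      using h t_le[of "Suc k"] by (intro loc) (auto simp: t_def algebra_simps)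
    also have "t (Suc k) - t k = h" by (simp add: t_def algebra_simps)
    finally show "\<phi> (t (Suc k)) - \<phi> (t k) \<le> C * h" .
  qed
  also have "\<dots> = C * (b - a)" by (simp add: h(3)[symmetric])
  finally show ?thesis .
qed simp

text \<open>A supremum over partitions may jump, whereas \<open>interval_measure\<close> requires
  right-continuity. The right limit w of m serves: shifting a and b by t > 0 and letting t tend to 0
  carries the increments of m to those of w and those of a right-continuous \<Phi> back to
  themselves.\<close>

lemma right_continuous_version:
  fixes m :: "real \<Rightarrow> real"
  assumes "mono m" and bd: "\<And>x. 0 \<le> m x" "\<And>x. m x \<le> J"
  obtains w where "stieltjes w" "\<And>x. 0 \<le> w x" "\<And>x. w x \<le> J"
    "\<And>\<Phi> a b. \<lbrakk>\<And>x. continuous (at_right x) \<Phi>; \<And>a b. a < b \<Longrightarrow> \<Phi> b - \<Phi> a \<le> m b - m a; a < b\<rbrakk>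
      \<Longrightarrow> \<Phi> b - \<Phi> a \<le> w b - w a"
proof -
  define w where "w x = Inf (m ` {x<..})" for x
  have bdd: "bdd_below (m ` S)" for S by (rule bdd_belowI2[of _ 0]) (rule bd)
  have w_le: "w x \<le> m y" if "x < y" for x y
    unfolding w_def using that by (intro cInf_lower bdd) auto
  have w_ge: "m x \<le> w x" for x
    unfolding w_def by (rule cInf_greatest) (auto intro!: monoD[OF \<open>mono m\<close>])
  have w_less: "\<exists>y>x. m y < u" if "w x < u" for x u
    using that cInf_less_iff[of "m ` {x<..}" u] bdd[of "{x<..}"] by (auto simp: w_def)
  have mw: "mono w"
    unfolding w_def by (intro monoI cInf_superset_mono) (auto intro: bdd)
  have cw: "continuous (at_right x) w" for x
    unfolding continuous_within
  proof (rule order_tendstoI)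
    fix l assume l: "l < w x"
    show "eventually (\<lambda>y. l < w y) (at_right x)"
    proof (rule eventually_at_rightI[of x "x + 1"])
      show "l < w y" if "y \<in> {x<..<x + 1}" for y
        using l monoD[OF mw, of x y] that by simp
    qed simp
  next
    fix u assume "w x < u"
    then obtain z where z: "x < z" "m z < u" using w_less by blast
    show "eventually (\<lambda>y. w y < u) (at_right x)"
    proof (rule eventually_at_rightI[of x z])
      show "w y < u" if "y \<in> {x<..<z}" for y
        using z w_le[of y z] that by simp
    qed (rule z)
  qed
  have w0: "0 \<le> w x" for x using order_trans[OF bd(1) w_ge] .
  have wJ: "w x \<le> J" for x using order_trans[OF w_le bd(2), of x "x + 1"] by simp
  have lim: "(m \<longlongrightarrow> w x) (at_right x)" for x
  proof (rule order_tendstoI)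
    fix l assume l: "l < w x"
    show "eventually (\<lambda>y. l < m y) (at_right x)"
    proof (rule eventually_at_rightI[of x "x + 1"])
      show "l < m y" if "y \<in> {x<..<x + 1}" for y
        using l w_le[of x y] that by simp
    qed simp
  next
    fix u assume "w x < u"
    then obtain z where z: "x < z" "m z < u" using w_less by blast
    show "eventually (\<lambda>y. m y < u) (at_right x)"
    proof (rule eventually_at_rightI[of x z])
      show "m y < u" if "y \<in> {x<..<z}" for y
        using z monoD[OF \<open>mono m\<close>, of y z] that by simp
    qed (rule z)
  qed
  have w\<Phi>: "\<Phi> b - \<Phi> a \<le> w b - w a"
    if \<Phi>: "\<And>x. continuous (at_right x) \<Phi>" and le: "\<And>a b. a < b \<Longrightarrow> \<Phi> b - \<Phi> a \<le> m b - m a" and "a < b" for \<Phi> a b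
  proof (rule tendsto_le[of "at_right (0::real)"])
    have shift: "((\<lambda>t. f (t + c)) \<longlongrightarrow> y) (at_right 0)" if "(f \<longlongrightarrow> y) (at_right c)" for f :: "real \<Rightarrow> real" and y c
      using that filterlim_at_right_to_0[of f "nhds y" c] by blast
    show "((\<lambda>t. m (t + b) - m (t + a)) \<longlongrightarrow> w b - w a) (at_right 0)"
      by (intro tendsto_diff shift lim)
    show "((\<lambda>t. \<Phi> (t + b) - \<Phi> (t + a)) \<longlongrightarrow> \<Phi> b - \<Phi> a) (at_right 0)"
      using \<Phi>[of a] \<Phi>[of b] unfolding continuous_within
      by (intro tendsto_diff shift)
    show "\<forall>\<^sub>F t in at_right 0. \<Phi> (t + b) - \<Phi> (t + a) \<le> m (t + b) - m (t + a)"
      using le \<open>a < b\<close> by (auto intro!: always_eventually)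
  qed simp
  have "stieltjes w" unfolding stieltjes_def using mw cw by (blast dest: monoD)
  then show ?thesis by (rule that[OF _ w0 wJ w\<Phi>])
qed

text \<open>Let \<open>M x\<close> be the supremum over partitions ending no later than x. Extending
  a partition first to a, which cannot lower the sum as \<phi> \<ge> 0, and then to b shows M a +
  \<phi> a b \<le> M b.\<close>

lemma partition_sup_majorant:
  fixes \<phi> :: "real \<Rightarrow> real \<Rightarrow> ereal"
  defines "J \<equiv> SUP (k, t) \<in> {(k::nat, t::nat \<Rightarrow> real). t 0 = 0 \<and> (\<forall>i<k. t i < t (Suc i))}.
              \<Sum>i=1..k. \<phi> (t (i - 1)) (t i)"
  assumes nonneg: "\<And>a b. 0 \<le> a \<Longrightarrow> a < b \<Longrightarrow> 0 \<le> \<phi> a b" and fin: "J < \<infinity>"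
  obtains m where "mono m" "\<And>x. 0 \<le> m x" "\<And>x. ereal (m x) \<le> J"
    "\<And>a b. 0 \<le> a \<Longrightarrow> a < b \<Longrightarrow> \<phi> a b \<le> ereal (m b - m a)"
proof
  let ?T = "{(k::nat, t::nat \<Rightarrow> real). t 0 = 0 \<and> (\<forall>i<k. t i < t (Suc i))}"
  let ?S = "\<lambda>(k, t). \<Sum>i=1..k. \<phi> (t (i - 1)) (t i)"
  define Q where "Q x = {(k, t). (k, t) \<in> ?T \<and> t k \<le> x}" for x :: real
  define M where "M x = (SUP p\<in>Q x. ?S p)" for x
  define m where "m x = (if x < 0 then 0 else real_of_ereal (M x))" for x
  have Q0: "(0, \<lambda>_. 0) \<in> Q x" if "0 \<le> x" for x using that by (simp add: Q_def)
  have M0: "0 \<le> M x" if "0 \<le> x" for x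
    unfolding M_def using SUP_upper[OF Q0[OF that], of ?S] by simp
  have MJ: "M x \<le> J" for x
    unfolding M_def J_def by (rule SUP_subset_mono) (auto simp: Q_def)
  have M_mono: "M x \<le> M y" if "x \<le> y" for x y
    unfolding M_def by (rule SUP_subset_mono) (use that in \<open>auto simp: Q_def\<close>)
  have M_fin: "ereal (m x) = M x" if "0 \<le> x" for x
    using M0[OF that] MJ[of x] fin that by (cases "M x") (auto simp: m_def)
  have J0: "0 \<le> J" using M0[of 0] MJ[of 0] by simp
  show m0: "0 \<le> m x" for x using M0[of x] by (auto simp: m_def intro!: real_of_ereal_pos)
  show "ereal (m x) \<le> J" for x
    using M_fin[of x] MJ[of x] J0 by (cases "x < 0") (auto simp: m_def zero_ereal_def[symmetric])
  show "mono m"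
  proof (rule monoI)
    fix x y :: real assume xy: "x \<le> y"
    show "m x \<le> m y"
    proof (cases "x < 0")
      case True then show ?thesis using m0[of y] by (simp add: m_def)
    next
      case False
      then have "ereal (m x) \<le> ereal (m y)" using M_mono[OF xy] M_fin[of x] M_fin[of y] xy by simp
      then show ?thesis by simp
    qed
  qed
  have t0: "0 \<le> t k" if "(k, t) \<in> ?T" for k and t :: "nat \<Rightarrow> real"
  proof -
    have *: "t 0 = 0" "\<And>i. i < k \<Longrightarrow> t i < t (Suc i)" using that by auto
    have "j \<le> k \<Longrightarrow> 0 \<le> t j" for j
    proof (induction j)
      case (Suc j)
      then have "0 \<le> t j" "t j < t (Suc j)" using *(2)[of j] by auto
      then show ?case by simp
    qed (simp add: *(1))
    then show ?thesis by simp
  qed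
  have append: "?S (k, t) + \<phi> (t k) b \<le> M b \<and>
      ?S (Suc k, t(Suc k := b)) = ?S (k, t) + \<phi> (t k) b \<and> (Suc k, t(Suc k := b)) \<in> Q b"
    if "(k, t) \<in> ?T" "t k < b" for k t b
  proof -
    have Qb: "(Suc k, t(Suc k := b)) \<in> Q b"
      using that by (auto simp: Q_def less_Suc_eq)
    have "(\<Sum>i=1..k. \<phi> ((t(Suc k := b)) (i - 1)) ((t(Suc k := b)) i)) = (\<Sum>i=1..k. \<phi> (t (i - 1)) (t i))"
      by (rule sum.cong) auto
    then have S: "?S (Suc k, t(Suc k := b)) = ?S (k, t) + \<phi> (t k) b" by simp
    have "?S (Suc k, t(Suc k := b)) \<le> M b" unfolding M_def by (rule SUP_upper[OF Qb])
    then show ?thesis unfolding S using Qb by simp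
  qed
  have app: "?S (k, t) + \<phi> a b \<le> M b" if kt: "(k, t) \<in> ?T" "t k \<le> a" and "a < b" for k t a b
  proof (cases "t k = a")
    case True then show ?thesis using append[of k t b] that by simp
  next
    case False
    then have ka: "t k < a" using that by simp
    let ?t = "t(Suc k := a)"
    have 1: "?S (Suc k, ?t) = ?S (k, t) + \<phi> (t k) a" "(Suc k, ?t) \<in> ?T"
      using append[OF kt(1) ka] by (auto simp: Q_def)
    have "?S (k, t) \<le> ?S (Suc k, ?t)"
      unfolding 1(1) using nonneg[OF t0[OF kt(1)] ka] by (rule ereal_le_add_self)
    then have "?S (k, t) + \<phi> a b \<le> ?S (Suc k, ?t) + \<phi> a b" by (intro add_right_mono)
    moreover have "?S (Suc k, ?t) + \<phi> a b \<le> M b"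
      using append[OF 1(2), of b] \<open>a < b\<close> by simp
    ultimately show ?thesis by (rule order_trans)
  qed
  show "\<phi> a b \<le> ereal (m b - m a)" if ab: "0 \<le> a" "a < b" for a b
  proof -
    have "\<phi> a b \<le> M b" using app[of 0 "\<lambda>_. 0" a b] that by simp
    \<comment> \<open>Finiteness allows \<phi> a b to be subtracted, so that the supremum over
      partitions can be taken on the other side.\<close>
    then have "\<phi> a b \<noteq> \<infinity>" using MJ[of b] fin by auto
    then obtain p where p: "\<phi> a b = ereal p" using nonneg[OF ab] by (cases "\<phi> a b") auto
    have "M a \<le> M b - \<phi> a b"
      unfolding M_def[of a]
    proof (rule SUP_least)
      fix x assume "x \<in> Q a"
      then obtain k t where x: "x = (k, t)" "(k, t) \<in> ?T" "t k \<le> a" by (auto simp: Q_def)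
      show "?S x \<le> M b - \<phi> a b"
        using app[OF x(2,3) ab(2)] unfolding p x(1) by (simp add: ereal_le_minus_iff)
    qed
    moreover have "ereal (m a) = M a" "ereal (m b) = M b" using ab by (auto intro!: M_fin)
    ultimately have "ereal (m a) \<le> ereal (m b - p)" unfolding p by (metis ereal_minus(1))
    then show ?thesis unfolding p by simp
  qed
qed

section \<open>Continuous functions vanishing at infinity\<close>

lemma C0_bcontfun: "f \<in> C0 \<Longrightarrow> f \<in> bcontfun"
  by (simp add: C0_def)

lemma bcontfun_continuous: "f \<in> bcontfun \<Longrightarrow> continuous_on S f"
  by (auto simp: bcontfun_def intro: continuous_on_subset)

lemma bcontfun_measurable: "f \<in> bcontfun \<Longrightarrow> f \<in> borel_measurable borel"
  by (intro borel_measurable_continuous_onI bcontfun_continuous)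

lemma bcontfun_bound:
  fixes f :: "'a::topological_space \<Rightarrow> real"
  assumes "f \<in> bcontfun" obtains B where "0 \<le> B" "\<And>x. \<bar>f x\<bar> \<le> B"
proof -
  obtain b where "0 < b" "\<forall>x\<in>range f. norm x \<le> b"
    using assms unfolding bcontfun_def bounded_pos by blast
  then show ?thesis by (intro that[of b]) auto
qed

lemma C0_E:
  assumes "f \<in> C0" "0 < e"
  obtains K where "compact K" "\<And>x. x \<notin> K \<Longrightarrow> \<bar>f x\<bar> < e"
  using assms by (force simp: C0_def)

lemma C0_add:
  assumes f: "f \<in> C0" and g: "g \<in> C0" shows "(\<lambda>x. f x + g x) \<in> C0"
  unfolding C0_def
proof (intro CollectI conjI allI impI)
  show "(\<lambda>x. f x + g x) \<in> bcontfun" using assms by (intro plus_cont C0_bcontfun)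
  fix e :: real assume "0 < e"
  obtain K where K: "compact K" "\<And>x. x \<notin> K \<Longrightarrow> \<bar>f x\<bar> < e / 2"
    using C0_E[OF f, of "e / 2"] \<open>0 < e\<close> by auto
  obtain K' where K': "compact K'" "\<And>x. x \<notin> K' \<Longrightarrow> \<bar>g x\<bar> < e / 2"
    using C0_E[OF g, of "e / 2"] \<open>0 < e\<close> by auto
  have "\<bar>f x + g x\<bar> < e" if "x \<notin> K \<union> K'" for x
  proof -
    have "\<bar>f x\<bar> < e / 2" "\<bar>g x\<bar> < e / 2" using K(2) K'(2) that by auto
    then show ?thesis by linarith
  qed
  then show "\<exists>K. compact K \<and> (\<forall>x. x \<notin> K \<longrightarrow> \<bar>f x + g x\<bar> < e)"
    using K(1) K'(1) by (intro exI[of _ "K \<union> K'"]) auto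
qed

text \<open>As f is bounded, k has to be continuous only on a compact set containing its range; this
  covers ln(1 + y) on an interval bounded away from -1. The condition k 0 = 0 preserves decay at
  infinity.\<close>

lemma C0_compose:
  fixes f :: "'a::topological_space \<Rightarrow> real"
  assumes f: "f \<in> C0" and S: "compact S" "range f \<subseteq> S" "0 \<in> S" and k: "continuous_on S k" "k 0 = 0"
  shows "(\<lambda>x. k (f x) :: real) \<in> C0"
  unfolding C0_def
proof (intro CollectI conjI allI impI)
  have "continuous_on UNIV (\<lambda>x. k (f x))"
    using continuous_on_compose2[OF k(1) bcontfun_continuous[OF C0_bcontfun[OF f]] S(2)] .
  moreover have "bounded (range (\<lambda>x. k (f x)))"
    using compact_imp_bounded[OF compact_continuous_image[OF k(1) S(1)]] S(2)
    by (rule_tac bounded_subset[of "k ` S"]) auto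
  ultimately show "(\<lambda>x. k (f x)) \<in> bcontfun" by (simp add: bcontfun_def)
  fix e :: real assume "0 < e"
  obtain d where d: "0 < d" "\<And>y. y \<in> S \<Longrightarrow> \<bar>y\<bar> < d \<Longrightarrow> \<bar>k y\<bar> < e"
    using k S(3) \<open>0 < e\<close> unfolding continuous_on_iff by (fastforce simp: dist_real_def)
  obtain K where K: "compact K" "\<And>x. x \<notin> K \<Longrightarrow> \<bar>f x\<bar> < d"
    using C0_E[OF f d(1)] by blast
  then show "\<exists>K. compact K \<and> (\<forall>x. x \<notin> K \<longrightarrow> \<bar>k (f x)\<bar> < e)"
    using d(2) S(2) by (intro exI[of _ K]) blast
qed

lemma C0_mult_bcontfun:
  fixes f g :: "'a::topological_space \<Rightarrow> real"
  assumes f: "f \<in> C0" and g: "g \<in> bcontfun"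
  shows "(\<lambda>x. g x * f x) \<in> C0"
  unfolding C0_def
proof (intro CollectI conjI allI impI)
  obtain B where B: "\<And>x. \<bar>f x\<bar> \<le> B" "0 \<le> B" using bcontfun_bound[OF C0_bcontfun[OF f]] by metis
  obtain B' where B': "\<And>x. \<bar>g x\<bar> \<le> B'" "0 \<le> B'" using bcontfun_bound[OF g] by metis
  show "(\<lambda>x. g x * f x) \<in> bcontfun"
  proof (rule bcontfun_normI)
    show "norm (g x * f x) \<le> B' * B" for x
      using B B' by (auto simp: abs_mult intro!: mult_mono)
  qed (intro continuous_intros bcontfun_continuous g C0_bcontfun f)
  fix e :: real assume "0 < e"
  then obtain K where K: "compact K" "\<And>x. x \<notin> K \<Longrightarrow> \<bar>f x\<bar> < e / (B' + 1)"
    using C0_E[OF f, of "e / (B' + 1)"] B'(2) by auto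
  have "\<bar>g x * f x\<bar> < e" if "x \<notin> K" for x
  proof -
    have "\<bar>g x * f x\<bar> \<le> (B' + 1) * \<bar>f x\<bar>"
      unfolding abs_mult using B'(1)[of x] by (intro mult_right_mono) auto
    also have "\<dots> < e" using K(2)[OF that] B'(2) by (simp add: field_simps)
    finally show ?thesis .
  qed
  then show "\<exists>K. compact K \<and> (\<forall>x. x \<notin> K \<longrightarrow> \<bar>g x * f x\<bar> < e)" using K(1) by blast
qed

lemma C0_cmult: "f \<in> C0 \<Longrightarrow> (\<lambda>x. c * f x :: real) \<in> C0"
  using C0_mult_bcontfun[of f "\<lambda>_. c"] by (simp add: const_bcontfun)

lemma C0_zero [simp]: "(\<lambda>_. 0) \<in> C0"
  by (auto simp: C0_def const_bcontfun intro!: exI[of _ "{}"])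

lemma C0_uminus: "f \<in> C0 \<Longrightarrow> (\<lambda>x. - f x :: real) \<in> C0"
  using C0_cmult[of f "-1"] by simp

lemma C0_diff: "f \<in> C0 \<Longrightarrow> g \<in> C0 \<Longrightarrow> (\<lambda>x. f x - g x :: real) \<in> C0"
  using C0_add[OF _ C0_uminus, of f g] by simp

lemma C0_max_0:
  assumes "f \<in> C0" shows "(\<lambda>x. max 0 (f x)) \<in> C0"
proof -
  obtain B where B: "\<And>x. \<bar>f x\<bar> \<le> B" "0 \<le> B" using bcontfun_bound[OF C0_bcontfun[OF assms]] by metis
  have "range f \<subseteq> {-B..B}"
  proof
    fix y assume "y \<in> range f"
    then obtain x where "y = f x" by auto
    then show "y \<in> {-B..B}" using B(1)[of x] by auto
  qed
  then show ?thesis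
    using B(2) by (intro C0_compose[OF assms, of "{-B..B}"]) (auto intro!: continuous_intros)
qed

text \<open>Two functions that admit the same list \<open>Ls\<close> of finite unions of basic open sets differ by at most
  \<open>2 \<epsilon>\<close>; as there are countably many such lists, \<open>C0\<close> is separable.\<close>

lemma C0_finite_code:
  fixes g :: "'a::second_countable_topology \<Rightarrow> real" and \<B> :: "'a set set"
  assumes \<B>: "topological_basis \<B>" and g: "g \<in> C0" and \<epsilon>: "0 < \<epsilon>"
  obtains Ls where "Ls \<in> lists ((\<Union>) ` {F. finite F \<and> F \<subseteq> \<B>})" "\<And>x. g x < (real (length Ls) + 1) * \<epsilon>"
    "\<And>k x. k < length Ls \<Longrightarrow> (real k + 1) * \<epsilon> \<le> g x \<Longrightarrow> x \<in> Ls ! k"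
    "\<And>k x. k < length Ls \<Longrightarrow> x \<in> Ls ! k \<Longrightarrow> real k * \<epsilon> < g x"
proof -
  have cont: "continuous_on UNIV g" using g by (intro bcontfun_continuous C0_bcontfun)
  \<comment> \<open>The superlevel set at the positive height (k + 1)\<epsilon> is compact and lies
    in the open set where g > k \<epsilon>, so a finite union of basic open sets fits between the
    two.\<close>
  have "\<exists>F. finite F \<and> F \<subseteq> \<B> \<and> {x. (real k + 1) * \<epsilon> \<le> g x} \<subseteq> \<Union>F \<and> \<Union>F \<subseteq> {x. real k * \<epsilon> < g x}" for k
  proof -
    have pos: "0 < (real k + 1) * \<epsilon>" using \<epsilon> by simp
    obtain K where K: "compact K" "\<And>x. x \<notin> K \<Longrightarrow> \<bar>g x\<bar> < (real k + 1) * \<epsilon>"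
      using C0_E[OF g pos] by blast
    have "closed {x. (real k + 1) * \<epsilon> \<le> g x}"
      by (intro closed_Collect_le continuous_on_const cont)
    moreover have sub: "{x. (real k + 1) * \<epsilon> \<le> g x} \<subseteq> K" using K(2) by fastforce
    ultimately have "compact (K \<inter> {x. (real k + 1) * \<epsilon> \<le> g x})" by (intro compact_Int_closed K)
    then have comp: "compact {x. (real k + 1) * \<epsilon> \<le> g x}" using sub by (simp add: Int_absorb1)
    have "open {x. real k * \<epsilon> < g x}" by (intro open_Collect_less continuous_on_const cont)
    then obtain \<C> where \<C>: "\<C> \<subseteq> \<B>" "\<Union>\<C> = {x. real k * \<epsilon> < g x}"
      using \<B> unfolding topological_basis_def by blast
    have op: "\<And>U. U \<in> \<C> \<Longrightarrow> open U" using \<C>(1) \<B> topological_basis_open by blast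
    have cov: "{x. (real k + 1) * \<epsilon> \<le> g x} \<subseteq> \<Union>\<C>"
      unfolding \<C>(2) using \<epsilon> by (auto simp: algebra_simps)
    obtain F where "F \<subseteq> \<C>" "finite F" "{x. (real k + 1) * \<epsilon> \<le> g x} \<subseteq> \<Union>F"
      using compactE[OF comp cov op] by blast
    moreover have "\<Union>F \<subseteq> \<Union>\<C>" using \<open>F \<subseteq> \<C>\<close> by (rule Union_mono)
    ultimately show ?thesis using \<C> by (intro exI[of _ F]) auto
  qed
  then obtain F where F: "\<And>k::nat. finite (F k)" "\<And>k. F k \<subseteq> \<B>"
    "\<And>k. {x. (real k + 1) * \<epsilon> \<le> g x} \<subseteq> \<Union>(F k)" "\<And>k. \<Union>(F k) \<subseteq> {x. real k * \<epsilon> < g x}" by metis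
  obtain B where B: "\<And>x. \<bar>g x\<bar> \<le> B" using bcontfun_bound[OF C0_bcontfun[OF g]] by metis
  obtain N :: nat where N: "B / \<epsilon> < real N" using reals_Archimedean2 by blast
  show ?thesis
  proof
    let ?Ls = "map (\<lambda>k. \<Union>(F k)) [0..<N]"
    show "?Ls \<in> lists ((\<Union>) ` {F. finite F \<and> F \<subseteq> \<B>})" using F(1,2) by auto
    show "g x < (real (length ?Ls) + 1) * \<epsilon>" for x
    proof -
      have "g x \<le> B" using B[of x] by simp
      also have "B < real N * \<epsilon>" using N \<epsilon> by (simp add: field_simps)
      also have "\<dots> \<le> (real N + 1) * \<epsilon>" using \<epsilon> by (simp add: algebra_simps)
      finally show ?thesis by simp
    qed
    show "x \<in> ?Ls ! k" if "k < length ?Ls" "(real k + 1) * \<epsilon> \<le> g x" for k x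
      using that F(3)[of k] by auto
    show "real k * \<epsilon> < g x" if "k < length ?Ls" "x \<in> ?Ls ! k" for k x
      using that F(4)[of k] by auto
  qed
qed

text \<open>A code bounds g from below only through its levels, so two functions with the same code
  are close when both are nonnegative; hence the passage through positive and negative parts.
  \<open>D1\<close> holds one chosen representative for each code that occurs at mesh 1/(n +
  1).\<close>

lemma C0_separable:
  "\<exists>D::nat \<Rightarrow> 'a::second_countable_topology \<Rightarrow> real.
     (\<forall>n. D n \<in> C0) \<and> (\<forall>f\<in>C0. \<forall>\<epsilon>>0. \<exists>n. \<forall>x. \<bar>f x - D n x\<bar> \<le> \<epsilon>)"
proof -
  obtain \<B> :: "'a set set" where \<B>: "countable \<B>" "topological_basis \<B>"
    using ex_countable_basis by blast
  define T where "T = lists ((\<Union>) ` {F. finite F \<and> F \<subseteq> \<B>})"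
  have T: "countable T"
    unfolding T_def using \<B>(1) by (intro countable_lists countable_image countable_Collect_finite_subset)
  define P where "P \<epsilon> Ls g \<longleftrightarrow> g \<in> C0 \<and> (\<forall>x. 0 \<le> g x \<and> g x < (real (length Ls) + 1) * \<epsilon>) \<and>
    (\<forall>k<length Ls. \<forall>x. ((real k + 1) * \<epsilon> \<le> g x \<longrightarrow> x \<in> Ls ! k) \<and> (x \<in> Ls ! k \<longrightarrow> real k * \<epsilon> < g x))"
    for \<epsilon> Ls and g :: "'a \<Rightarrow> real"
  have close: "g x - g' x \<le> 2 * \<epsilon>" if "P \<epsilon> Ls g" "P \<epsilon> Ls g'" "0 < \<epsilon>" for \<epsilon> Ls g g' x
  proof -
    \<comment> \<open>k is the level of g x. For k = j + 1 the code contains x at position j, which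
      forces g' x > j \<epsilon>, while g x < (j + 2) \<epsilon>.\<close>
    define k where "k = nat \<lfloor>g x / \<epsilon>\<rfloor>"
    have "0 \<le> g x / \<epsilon>" using that by (simp add: P_def)
    then have "real k \<le> g x / \<epsilon>" "g x / \<epsilon> < real k + 1" unfolding k_def by linarith+
    then have k: "real k * \<epsilon> \<le> g x" "g x < (real k + 1) * \<epsilon>" using \<open>0 < \<epsilon>\<close> by (auto simp: field_simps)
    have g'0: "0 \<le> g' x" using that by (simp add: P_def)
    show ?thesis
    proof (cases k)
      case 0 then show ?thesis using k g'0 \<open>0 < \<epsilon>\<close> by simp
    next
      case (Suc j)
      have "g x < (real (length Ls) + 1) * \<epsilon>" using that by (simp add: P_def)
      then have "real k * \<epsilon> < (real (length Ls) + 1) * \<epsilon>" using k by linarith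
      then have "real k < real (length Ls) + 1" using \<open>0 < \<epsilon>\<close> by simp
      then have j: "j < length Ls" using Suc by linarith
      have "(real j + 1) * \<epsilon> \<le> g x" using k(1) Suc by (simp add: algebra_simps)
      then have "x \<in> Ls ! j" using that(1) j by (simp add: P_def)
      then have "real j * \<epsilon> < g' x" using that(2) j by (simp add: P_def)
      then show ?thesis using k(2) Suc by (simp add: algebra_simps)
    qed
  qed
  define G where "G \<epsilon> Ls = (SOME g. P \<epsilon> Ls g)" for \<epsilon> Ls
  define D1 where "D1 = (\<lambda>(n, Ls). G (inverse (real (Suc n))) Ls) `
     {(n::nat, Ls). Ls \<in> T \<and> (\<exists>g. P (inverse (real (Suc n))) Ls g)}"
  have "countable D1"
    unfolding D1_def
    by (intro countable_image countable_subset[OF _ countable_SIGMA[OF countableI_type[of UNIV], of "\<lambda>_. T"]] T) auto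
  have D1_C0: "g \<in> C0" if g: "g \<in> D1" for g
  proof -
    obtain p where p: "g = (case p of (n, Ls) \<Rightarrow> G (inverse (real (Suc n))) Ls)"
        "p \<in> {(n::nat, Ls). Ls \<in> T \<and> (\<exists>g. P (inverse (real (Suc n))) Ls g)}"
      using g unfolding D1_def by (rule imageE)
    obtain n Ls where "g = G (inverse (real (Suc n))) Ls" "\<exists>g. P (inverse (real (Suc n))) Ls g"
      using p by (cases p) auto
    then have "P (inverse (real (Suc n))) Ls g"
      using someI_ex[of "P (inverse (real (Suc n))) Ls"] unfolding G_def by simp
    then show ?thesis by (simp add: P_def)
  qed
  have D1_dense: "\<exists>d\<in>D1. \<forall>x. \<bar>g x - d x\<bar> \<le> \<epsilon>" if g: "g \<in> C0" "\<And>x. 0 \<le> g x" and \<epsilon>: "0 < \<epsilon>" for g \<epsilon>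
  proof -
    obtain n where n: "inverse (real (Suc n)) < \<epsilon> / 2" using reals_Archimedean[of "\<epsilon> / 2"] \<epsilon> by auto
    define \<eta> where "\<eta> = inverse (real (Suc n))"
    have \<eta>: "0 < \<eta>" by (simp add: \<eta>_def)
    obtain Ls where Ls: "Ls \<in> T" "P \<eta> Ls g"
    proof (rule C0_finite_code[OF \<B>(2) g(1) \<eta>])
      fix Ls assume Ls: "Ls \<in> lists ((\<Union>) ` {F. finite F \<and> F \<subseteq> \<B>})" "\<And>x. g x < (real (length Ls) + 1) * \<eta>"
        "\<And>k x. k < length Ls \<Longrightarrow> (real k + 1) * \<eta> \<le> g x \<Longrightarrow> x \<in> Ls ! k"
        "\<And>k x. k < length Ls \<Longrightarrow> x \<in> Ls ! k \<Longrightarrow> real k * \<eta> < g x"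
      show thesis
        by (rule that) (use Ls g in \<open>auto simp: P_def T_def\<close>)
    qed
    have PG: "P \<eta> Ls (G \<eta> Ls)" unfolding G_def using someI[of "P \<eta> Ls" g, OF Ls(2)] .
    have "\<bar>g x - G \<eta> Ls x\<bar> \<le> \<epsilon>" for x
      using close[OF PG Ls(2) \<eta>, of x] close[OF Ls(2) PG \<eta>, of x] n by (simp add: \<eta>_def abs_le_iff)
    moreover have "G \<eta> Ls \<in> D1" unfolding D1_def using Ls by (force simp: \<eta>_def)
    ultimately show ?thesis by blast
  qed
  define D2 where "D2 = (\<lambda>(g, h) x. g x - h x) ` (D1 \<times> D1)"
  have "countable D2" unfolding D2_def using \<open>countable D1\<close> by auto
  have D2: "D2 \<subseteq> C0" unfolding D2_def using D1_C0 by (auto intro: C0_diff)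
  have D2_dense: "\<exists>d\<in>D2. \<forall>x. \<bar>f x - d x\<bar> \<le> \<epsilon>" if f: "f \<in> C0" and \<epsilon>: "0 < \<epsilon>" for f :: "'a \<Rightarrow> real" and \<epsilon>
  proof -
    obtain g where g: "g \<in> D1" "\<And>x. \<bar>max 0 (f x) - g x\<bar> \<le> \<epsilon> / 2"
      using D1_dense[OF C0_max_0[OF f], of "\<epsilon> / 2"] \<epsilon> by auto
    obtain h where h: "h \<in> D1" "\<And>x. \<bar>max 0 (- f x) - h x\<bar> \<le> \<epsilon> / 2"
      using D1_dense[OF C0_max_0[OF C0_uminus[OF f]], of "\<epsilon> / 2"] \<epsilon> by auto
    have "\<bar>f x - (g x - h x)\<bar> \<le> \<epsilon>" for x
    proof -
      have "max 0 (f x) - max 0 (- f x) = f x" by (simp add: max_def)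
      then show ?thesis using g(2)[of x] h(2)[of x] by linarith
    qed
    moreover have "(\<lambda>x. g x - h x) \<in> D2" unfolding D2_def using g h by force
    ultimately show ?thesis by (intro bexI[of _ "\<lambda>x. g x - h x"]) auto
  qed
  have "D2 \<noteq> {}" using D2_dense[of "\<lambda>_. 0" 1] by auto
  then have "range (from_nat_into D2) = D2" using \<open>countable D2\<close> by (rule range_from_nat_into)
  moreover have "\<exists>n. \<forall>x. \<bar>f x - from_nat_into D2 n x\<bar> \<le> \<epsilon>" if f: "f \<in> C0" and \<epsilon>: "0 < \<epsilon>" for f :: "'a \<Rightarrow> real" and \<epsilon>
  proof -
    obtain d where "d \<in> D2" "\<forall>x. \<bar>f x - d x\<bar> \<le> \<epsilon>" using D2_dense[OF f \<epsilon>] by blast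
    moreover obtain n where "d = from_nat_into D2 n"
      using \<open>d \<in> D2\<close> \<open>range (from_nat_into D2) = D2\<close> by blast
    ultimately show ?thesis by blast
  qed
  ultimately show ?thesis
    using D2 by (intro exI[of _ "from_nat_into D2"]) blast
qed

text \<open>By Lindelof, countably many balls, each inside a compact set, cover the space. The sum
  of the tent functions on the first n balls vanishes off a compact set; multiplied by n and capped
  at 1, it equals 1 at any given point from some n on.\<close>

lemma C0_cutoffs:
  assumes lc: "locally_compact_space (euclidean :: 'a::{metric_space, second_countable_topology} topology)"
  obtains cut :: "nat \<Rightarrow> 'a::{metric_space, second_countable_topology} \<Rightarrow> real" where "\<And>n. cut n \<in> C0" "\<And>n x. 0 \<le> cut n x" "\<And>n x. cut n x \<le> 1"
    "\<And>x. (\<lambda>n. cut n x) \<longlonglongrightarrow> 1"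
proof -
  define \<F> where "\<F> = {U :: 'a set. \<exists>c r K. U = ball c r \<and> 0 < r \<and> compact K \<and> ball c r \<subseteq> K}"
  have "\<Union>\<F> = UNIV"
  proof -
    have "\<exists>U\<in>\<F>. x \<in> U" for x
    proof -
      have "x \<in> topspace euclidean" by simp
      then obtain U K where "openin euclidean U" "compactin euclidean K" and UK: "x \<in> U" "U \<subseteq> K"
        using lc unfolding locally_compact_space_def by blast
      then have "open U" "compact K" by simp_all
      then obtain r where "0 < r" "ball x r \<subseteq> U" using openE UK(1) by blast
      then have "ball x r \<in> \<F>" unfolding \<F>_def using UK \<open>0 < r\<close> \<open>compact K\<close> by blast
      then show ?thesis using \<open>0 < r\<close> by (intro bexI[of _ "ball x r"]) auto
    qed
    then show ?thesis by auto
  qed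
  obtain \<F>' where \<F>': "\<F>' \<subseteq> \<F>" "countable \<F>'" "\<Union>\<F>' = \<Union>\<F>"
    using Lindelof[of \<F>] unfolding \<F>_def by (auto simp: \<F>_def)
  have "\<F>' \<noteq> {}" using \<F>' \<open>\<Union>\<F> = UNIV\<close> by auto
  define V where "V = from_nat_into \<F>'"
  have V: "range V = \<F>'" unfolding V_def using \<open>\<F>' \<noteq> {}\<close> \<F>'(2) by (rule range_from_nat_into)
  have "\<exists>c r K. V i = ball c r \<and> 0 < r \<and> compact K \<and> ball c r \<subseteq> K" for i
    using V \<F>'(1) unfolding \<F>_def by blast
  then obtain c r K where V': "\<And>i. V i = ball (c i) (r i)" "\<And>i. 0 < r i" "\<And>i. compact (K i)"
    "\<And>i. ball (c i) (r i) \<subseteq> K i" by metis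
  define s where "s n x = (\<Sum>i<n. max 0 (1 - dist x (c i) / r i))" for n x
  have s0: "0 \<le> s n x" for n x by (simp add: s_def sum_nonneg)
  show ?thesis
  proof
    let ?cut = "\<lambda>n x. min 1 (real n * s n x)"
    show "0 \<le> ?cut n x" "?cut n x \<le> 1" for n x using s0 by auto
    show "?cut n \<in> C0" for n
      unfolding C0_def
    proof (intro CollectI conjI allI impI)
      show "?cut n \<in> bcontfun"
        by (rule bcontfun_normI[of _ 1]) (use s0 V'(2)[THEN less_imp_neq] in \<open>auto simp: s_def intro!: continuous_intros\<close>)
      fix e :: real assume "0 < e"
      have "\<bar>?cut n x\<bar> < e" if "x \<notin> (\<Union>i<n. K i)" for x
      proof -
        have "max 0 (1 - dist x (c i) / r i) = 0" if "i < n" for i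
        proof -
          have "x \<notin> ball (c i) (r i)" using \<open>x \<notin> (\<Union>i<n. K i)\<close> that V'(4)[of i] by auto
          then show ?thesis using V'(2)[of i] by (simp add: dist_commute field_simps)
        qed
        then have "s n x = 0" by (simp add: s_def)
        then show ?thesis using \<open>0 < e\<close> by simp
      qed
      then show "\<exists>K. compact K \<and> (\<forall>x. x \<notin> K \<longrightarrow> \<bar>?cut n x\<bar> < e)"
        using V'(3) by (intro exI[of _ "\<Union>i<n. K i"]) auto
    qed
    show "(\<lambda>n. ?cut n x) \<longlonglongrightarrow> 1" for x
    proof -
      have "x \<in> \<Union>(range V)" using \<F>'(3) \<open>\<Union>\<F> = UNIV\<close> V by simp
      then obtain i where i: "dist x (c i) < r i" using V'(1) by (auto simp: dist_commute)
      define p where "p = 1 - dist x (c i) / r i"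
      have p: "0 < p" using i V'(2)[of i] by (simp add: p_def)
      have sp: "p \<le> s n x" if "i < n" for n
      proof -
        have "p \<le> max 0 (1 - dist x (c i) / r i)" by (simp add: p_def)
        also have "\<dots> \<le> s n x" unfolding s_def by (rule member_le_sum) (use that in auto)
        finally show ?thesis .
      qed
      obtain N :: nat where N: "1 / p < real N" using reals_Archimedean2 by blast
      have "?cut n x = 1" if "max N (Suc i) \<le> n" for n
      proof -
        have "1 \<le> real N * p" using N p by (simp add: field_simps)
        also have "\<dots> \<le> real n * s n x" using sp[of n] that p by (intro mult_mono) auto
        finally show ?thesis by simp
      qed
      then have "eventually (\<lambda>n. ?cut n x = 1) sequentially" by (intro eventually_sequentiallyI[of "max N (Suc i)"])
      then show ?thesis by (rule tendsto_eventually)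
    qed
  qed
qed

section \<open>Weakly continuous paths\<close>

lemma probsD:
  assumes "\<rho> \<in> probs" shows "prob_space \<rho>" "sets \<rho> = sets borel" "space \<rho> = UNIV"
  using assms by (auto simp: space_prob_algebra dest: sets_eq_imp_space_eq)

lemma integrable_bcontfun:
  fixes f :: "'a::topological_space \<Rightarrow> real"
  assumes "\<rho> \<in> probs" "f \<in> bcontfun" shows "integrable \<rho> f"
proof -
  interpret prob_space \<rho> using probsD(1)[OF assms(1)] .
  obtain B where "\<And>x. \<bar>f x\<bar> \<le> B" using bcontfun_bound[OF assms(2)] by metis
  moreover have "f \<in> borel_measurable \<rho>"
    using bcontfun_measurable[OF assms(2)] measurable_cong_sets[OF probsD(2)[OF assms(1)] refl] by blast
  ultimately show ?thesis by (intro integrable_const_bound[of _ B]) auto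
qed

lemma integral_probs_le:
  fixes f :: "'a::topological_space \<Rightarrow> real"
  assumes \<rho>: "\<rho> \<in> probs" and "integrable \<rho> f" "\<And>x. f x \<le> c" shows "(\<integral>x. f x \<partial>\<rho>) \<le> c"
proof -
  interpret prob_space \<rho> using probsD(1)[OF \<rho>] .
  have "(\<integral>x. f x \<partial>\<rho>) \<le> (\<integral>x. c \<partial>\<rho>)" using assms by (intro integral_mono) auto
  then show ?thesis by (simp add: prob_space)
qed

lemma integral_probs_abs_le:
  fixes f :: "'a::topological_space \<Rightarrow> real"
  assumes \<rho>: "\<rho> \<in> probs" and f: "integrable \<rho> f" "\<And>x. \<bar>f x\<bar> \<le> c" shows "\<bar>\<integral>x. f x \<partial>\<rho>\<bar> \<le> c"
proof -
  have "f x \<le> c" "- f x \<le> c" for x using f(2)[of x] by (auto simp: abs_le_iff)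
  then show ?thesis
    using integral_probs_le[OF \<rho> f(1), of c] integral_probs_le[OF \<rho>, of "\<lambda>x. - f x" c] f(1)
    by (simp add: abs_le_iff)
qed

lemma integral_probs_diff_abs_le:
  fixes f g :: "'a::topological_space \<Rightarrow> real"
  assumes \<rho>: "\<rho> \<in> probs" and f: "integrable \<rho> f" "integrable \<rho> g" "\<And>x. \<bar>f x - g x\<bar> \<le> c"
  shows "\<bar>(\<integral>x. f x \<partial>\<rho>) - (\<integral>x. g x \<partial>\<rho>)\<bar> \<le> c"
  using integral_probs_abs_le[OF \<rho>, of "\<lambda>x. f x - g x" c] f by simp

lemma continuous_paths_weak_topologyD:
  fixes f :: "'a::topological_space \<Rightarrow> real"
  assumes \<nu>: "\<nu> \<in> continuous_paths (weak_topology :: 'a measure topology)"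
  shows "0 \<le> t \<Longrightarrow> \<nu> t \<in> probs"
    and "f \<in> bcontfun \<Longrightarrow> continuous_on {0..} (\<lambda>t. \<integral>x. f x \<partial>\<nu> t)"
proof -
  have cm: "continuous_map (top_of_set {0..}) weak_topology \<nu>"
    using \<nu> by (simp add: continuous_paths_def)
  show "\<nu> t \<in> probs" if "0 \<le> t"
    using continuous_map_image_subset_topspace[OF cm] that
    unfolding weak_topology_def topspace_pullback_topology by auto
  assume f: "f \<in> bcontfun"
  obtain g where g: "f = apply_bcontfun g" using bcontfunE[OF f] by blast
  have "continuous_map (weak_topology :: 'a measure topology) euclidean
     (id \<circ> (\<lambda>\<rho> (f::'a \<Rightarrow>\<^sub>C real). \<integral>x. apply_bcontfun f x \<partial>\<rho>))"
    unfolding weak_topology_def by (rule continuous_map_pullback) auto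
  from continuous_map_compose[OF cm this]
  have "continuous_on {0..} (\<lambda>t (f::'a \<Rightarrow>\<^sub>C real). \<integral>x. apply_bcontfun f x \<partial>\<nu> t)"
    by (simp add: comp_def)
  from continuous_on_product_then_coordinatewise[OF this, of g]
  show "continuous_on {0..} (\<lambda>t. \<integral>x. f x \<partial>\<nu> t)"
    unfolding g .
qed

section \<open>Jump semigroups with bounded rates\<close>

lemma exp_diff_le:
  assumes "p \<le> c" "q \<le> (c::real)" shows "\<bar>exp p - exp q\<bar> \<le> exp c * \<bar>p - q\<bar>"
proof -
  have 1: "exp p - exp q \<le> exp c * \<bar>p - q\<bar>" if "p \<le> c" for p q
  proof -
    have "1 + (q - p) \<le> exp (q - p)" by (rule exp_ge_add_one_self)
    then have "exp p * (1 + (q - p)) \<le> exp p * exp (q - p)" by (intro mult_left_mono) auto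
    then have "exp p - exp q \<le> exp p * (p - q)" by (simp add: exp_add[symmetric] algebra_simps)
    also have "\<dots> \<le> exp p * \<bar>p - q\<bar>" by (intro mult_left_mono) auto
    also have "\<dots> \<le> exp c * \<bar>p - q\<bar>" using that by (intro mult_right_mono) auto
    finally show ?thesis .
  qed
  show ?thesis using 1[of p q] 1[of q p] assms by (simp add: abs_le_iff abs_minus_commute)
qed

text \<open>The identity \<open>gen\<close> contains the statement that all of \<open>C0\<close> is
  the domain of the generator. The bound \<Lambda> on the jump rates gives the generator norm at
  most 2 \<Lambda>, from which the factors 2 \<Lambda> below come.\<close>

locale jump_semigroup =
  fixes lam :: "'a::{metric_space, second_countable_topology} \<Rightarrow> real" and \<mu> :: "'a \<Rightarrow> 'a measure"
    and P :: "real \<Rightarrow> 'a \<Rightarrow> 'a measure" and \<Lambda> :: real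
  assumes lam: "\<And>x. 0 \<le> lam x" "\<And>x. lam x \<le> \<Lambda>"
    and mu: "transition_function \<mu>"
    and feller: "feller_transition_functions P"
    and gen: "C0_generator P = {(f, jump_generator lam \<mu> f) | f. f \<in> C0}"
begin

abbreviation "S \<equiv> semigroup_op P"
abbreviation "A \<equiv> jump_generator lam \<mu>"
abbreviation "H \<equiv> hamiltonian A"
abbreviation "V \<equiv> log_semigroup P"

lemma Lam0: "0 \<le> \<Lambda>"
  using lam[of undefined] by linarith

lemma mu_probs: "\<mu> x \<in> probs"
  using mu unfolding transition_function_def by (auto dest: measurable_space)

lemma P_measurable: "0 \<le> t \<Longrightarrow> P t \<in> borel \<rightarrow>\<^sub>M prob_algebra borel"
  using feller unfolding feller_transition_functions_def transition_function_def by auto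

lemma P_probs: "0 \<le> t \<Longrightarrow> P t x \<in> probs"
  using measurable_space[OF P_measurable] by simp

lemma S_C0: "0 \<le> t \<Longrightarrow> f \<in> C0 \<Longrightarrow> S t f \<in> C0"
  using feller unfolding feller_transition_functions_def by auto

lemma S_0: "f \<in> bcontfun \<Longrightarrow> S 0 f x = f x"
  using feller bcontfun_measurable[of f]
  unfolding feller_transition_functions_def semigroup_op_def by (simp add: integral_return)

lemma S_measurable: "0 \<le> t \<Longrightarrow> f \<in> bcontfun \<Longrightarrow> S t f \<in> borel_measurable borel"
  unfolding semigroup_op_def
  by (rule measurable_compose[OF measurable_prob_algebraD[OF P_measurable] integral_measurable_subprob_algebra])
     (auto intro: bcontfun_measurable)

lemma S_S:
  assumes "0 \<le> s" "0 \<le> t" and f: "f \<in> bcontfun"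
  shows "S (s + t) f x = S s (S t f) x"
proof -
  obtain B where B: "\<And>x. \<bar>f x\<bar> \<le> B" using bcontfun_bound[OF f] by metis
  have P: "P (s + t) x = P s x \<bind> P t"
    using feller assms unfolding feller_transition_functions_def by auto
  interpret s: prob_space "P s x" using probsD(1)[OF P_probs[OF assms(1)]] .
  have sets: "sets (P s x) = sets borel" "space (P s x) = UNIV"
    using probsD[OF P_probs[OF assms(1)]] by auto
  have Pt: "P t \<in> borel \<rightarrow>\<^sub>M subprob_algebra borel" by (rule measurable_prob_algebraD[OF P_measurable[OF assms(2)]])
  then have Pt': "P t \<in> P s x \<rightarrow>\<^sub>M subprob_algebra borel" using measurable_cong_sets[OF sets(1) refl] by blast
  have fm: "f \<in> borel_measurable borel" by (rule bcontfun_measurable[OF f])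
  let ?D = "distr (P s x) (subprob_algebra borel) (P t)"
  have "S (s + t) f x = integral\<^sup>L (join ?D) f"
    unfolding semigroup_op_def P by (subst bind_nonempty''[OF Pt']) (auto simp: sets)
  also have "\<dots> = (\<integral>M'. integral\<^sup>L M' f \<partial>?D)"
  proof (rule integral_join[OF fm B])
    interpret D: prob_space ?D by (rule s.prob_space_distr[OF Pt'])
    show "finite_measure ?D" by unfold_locales
    show "AE M' in ?D. emeasure M' (space M') \<le> ennreal 1"
      by (rule AE_I2) (auto simp: space_subprob_algebra intro: subprob_space.emeasure_space_le_1)
  qed simp
  also have "\<dots> = (\<integral>y. integral\<^sup>L (P t y) f \<partial>P s x)"
    using Pt' fm by (intro integral_distr integral_measurable_subprob_algebra)
  finally show ?thesis by (simp add: semigroup_op_def[abs_def])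
qed

lemma S_diff:
  "0 \<le> t \<Longrightarrow> f \<in> bcontfun \<Longrightarrow> g \<in> bcontfun \<Longrightarrow> S t (\<lambda>x. f x - g x) x = S t f x - S t g x"
  unfolding semigroup_op_def by (intro Bochner_Integration.integral_diff integrable_bcontfun P_probs)

lemma S_cmult: "S t (\<lambda>x. c * f x) x = c * S t f x"
  unfolding semigroup_op_def by simp

lemma S_const: "0 \<le> t \<Longrightarrow> S t (\<lambda>x. c) x = c"
  unfolding semigroup_op_def
  using prob_space.prob_space[OF probsD(1)[OF P_probs, of t x]] probsD(3)[OF P_probs, of t x] by simp

lemma S_le: "0 \<le> t \<Longrightarrow> f \<in> bcontfun \<Longrightarrow> (\<And>x. f x \<le> c) \<Longrightarrow> S t f x \<le> c"
  unfolding semigroup_op_def by (intro integral_probs_le integrable_bcontfun P_probs)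

lemma S_ge: "0 \<le> t \<Longrightarrow> f \<in> bcontfun \<Longrightarrow> (\<And>x. c \<le> f x) \<Longrightarrow> c \<le> S t f x"
  using S_le[of t "\<lambda>x. -1 * f x" "-c" x] S_cmult[of t "-1" f x] scaleR_cont[of f "-1"] by simp

lemma A_C0: "f \<in> C0 \<Longrightarrow> A f \<in> C0"
proof -
  assume "f \<in> C0"
  then have "(f, A f) \<in> C0_generator P" unfolding gen by blast
  then show ?thesis by (simp add: C0_generator_def)
qed

lemma A_lim:
  assumes "f \<in> C0" "0 < e"
  obtains \<delta> where "0 < \<delta>" "\<And>t x. 0 < t \<Longrightarrow> t < \<delta> \<Longrightarrow> \<bar>S t f x - f x - t * A f x\<bar> \<le> e * t"
proof -
  have "(f, A f) \<in> C0_generator P" unfolding gen using assms by blast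
  then have "uniform_limit UNIV (\<lambda>t x. (S t f x - f x) / t) (A f) (at_right 0)"
    by (simp add: C0_generator_def)
  then have "\<forall>\<^sub>F t in at_right 0. \<forall>x. dist ((S t f x - f x) / t) (A f x) < e"
    using \<open>0 < e\<close> unfolding uniform_limit_iff by simp
  then obtain \<delta> where \<delta>: "0 < \<delta>" "\<And>t x. 0 < t \<Longrightarrow> t < \<delta> \<Longrightarrow> dist ((S t f x - f x) / t) (A f x) < e"
    unfolding eventually_at_right_field by auto
  have "\<bar>S t f x - f x - t * A f x\<bar> \<le> e * t" if "0 < t" "t < \<delta>" for t x
  proof -
    have "\<bar>S t f x - f x - t * A f x\<bar> = t * \<bar>(S t f x - f x) / t - A f x\<bar>"
      using that(1) by (simp add: abs_mult[symmetric, of t, simplified] field_simps abs_if)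
    also have "\<dots> \<le> t * e"
      using \<delta>(2)[OF that, of x] that(1) by (intro mult_left_mono) (auto simp: dist_real_def)
    finally show ?thesis by (simp add: mult.commute)
  qed
  then show ?thesis using \<delta>(1) that by blast
qed

lemma A_bound:
  assumes f: "f \<in> bcontfun" and B: "\<And>x. \<bar>f x\<bar> \<le> B"
  shows "\<bar>A f x\<bar> \<le> 2 * \<Lambda> * B"
proof -
  have "\<bar>\<integral>y. f y - f x \<partial>\<mu> x\<bar> \<le> 2 * B"
  proof (rule integral_probs_abs_le[OF mu_probs])
    show "integrable (\<mu> x) (\<lambda>y. f y - f x)"
      by (intro integrable_bcontfun[OF mu_probs] minus_cont f const_bcontfun)
    show "\<bar>f y - f x\<bar> \<le> 2 * B" for y using B[of y] B[of x] by linarith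
  qed
  then have "lam x * \<bar>\<integral>y. f y - f x \<partial>\<mu> x\<bar> \<le> \<Lambda> * (2 * B)"
    using lam[of x] Lam0 by (intro mult_mono) auto
  then show ?thesis using lam(1)[of x] by (simp add: jump_generator_def abs_mult algebra_simps)
qed

text \<open>The generator limit at time 0 is uniform in space, so the semigroup property and
  monotonicity of \<open>S r\<close> carry it to every time r with the same \<delta>. Summing short
  increments gives the bound.\<close>

lemma S_increment_le:
  assumes f: "f \<in> C0" and B: "\<And>x. \<bar>f x\<bar> \<le> B" and t: "0 \<le> t"
  shows "S t f x - f x \<le> 2 * \<Lambda> * B * t"
proof (rule field_le_epsilon)
  fix e :: real assume e: "0 < e"
  \<comment> \<open>Adding 1 avoids a zero denominator; the accumulated error \<eta> t does not
    exceed e.\<close>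
  define \<eta> where "\<eta> = e / (t + 1)"
  have \<eta>: "0 < \<eta>" "\<eta> * t \<le> e" using e t by (auto simp: \<eta>_def field_simps)
  have fb: "f \<in> bcontfun" by (rule C0_bcontfun[OF f])
  obtain \<delta> where \<delta>: "0 < \<delta>" "\<And>t x. 0 < t \<Longrightarrow> t < \<delta> \<Longrightarrow> \<bar>S t f x - f x - t * A f x\<bar> \<le> \<eta> * t"
    using A_lim[OF f \<eta>(1)] by blast
  have "S t f x - S 0 f x \<le> (2 * \<Lambda> * B + \<eta>) * (t - 0)"
  proof (rule increment_le_if_locally[OF \<delta>(1) t])
    fix r s assume rs: "0 \<le> r" "r < s" "s \<le> t" "s - r < \<delta>"
    define h where "h = s - r"
    have h: "0 < h" "h < \<delta>" "s = r + h" using rs by (auto simp: h_def)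
    have "S s f x - S r f x = S r (\<lambda>y. S h f y - f y) x"
      using rs h S_S[of r h f x] fb by (subst S_diff) (auto intro!: C0_bcontfun[OF S_C0] f)
    also have "\<dots> \<le> (2 * \<Lambda> * B + \<eta>) * h"
    proof (rule S_le[OF rs(1)])
      show "(\<lambda>y. S h f y - f y) \<in> bcontfun" using h by (intro minus_cont fb C0_bcontfun[OF S_C0] f) auto
      show "S h f y - f y \<le> (2 * \<Lambda> * B + \<eta>) * h" for y
      proof -
        have "h * A f y \<le> h * (2 * \<Lambda> * B)"
          using A_bound[OF fb B, of y] h by (intro mult_left_mono) (auto simp: abs_le_iff)
        moreover have "S h f y - f y - h * A f y \<le> \<eta> * h" using \<delta>(2)[OF h(1,2), of y] by (simp add: abs_le_iff)
        ultimately show ?thesis by (simp add: algebra_simps)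
      qed
    qed
    finally show "S s f x - S r f x \<le> (2 * \<Lambda> * B + \<eta>) * (s - r)" by (simp add: h_def)
  qed
  then show "S t f x - f x \<le> 2 * \<Lambda> * B * t + e"
    using \<eta>(2) by (simp add: S_0[OF fb] algebra_simps)
qed

lemma S_increment_abs_le:
  assumes f: "f \<in> C0" and B: "\<And>x. \<bar>f x\<bar> \<le> B" and t: "0 \<le> t"
  shows "\<bar>S t f x - f x\<bar> \<le> 2 * \<Lambda> * B * t"
  using S_increment_le[OF f B t, of x] S_increment_le[OF C0_uminus[OF f], of B t x] B t
    S_cmult[of t "-1" f x] by (simp add: abs_le_iff)

text \<open>Over a step h the function \<open>S t f - t * A f\<close> moves by h (S r (A f) - A f)
  up to \<eta> h, and the first-order bound for \<open>A f\<close> makes this at most (2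
  \<Lambda>)^2 B t h. Replacing r by t there gives away the Taylor factor 1/2.\<close>

lemma S_second_order_le:
  assumes f: "f \<in> C0" and B: "\<And>x. \<bar>f x\<bar> \<le> B" and t: "0 \<le> t"
  shows "S t f x - f x - t * A f x \<le> (2 * \<Lambda> * t)\<^sup>2 * B"
proof (rule field_le_epsilon)
  fix e :: real assume e: "0 < e"
  define \<eta> where "\<eta> = e / (t + 1)"
  have \<eta>: "0 < \<eta>" "\<eta> * t \<le> e" using e t by (auto simp: \<eta>_def field_simps)
  have fb: "f \<in> bcontfun" and Ab: "A f \<in> bcontfun" by (intro C0_bcontfun f A_C0)+
  obtain \<delta> where \<delta>: "0 < \<delta>" "\<And>t x. 0 < t \<Longrightarrow> t < \<delta> \<Longrightarrow> \<bar>S t f x - f x - t * A f x\<bar> \<le> \<eta> * t"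
    using A_lim[OF f \<eta>(1)] by blast
  let ?C = "2 * \<Lambda> * (2 * \<Lambda> * B) * t + \<eta>"
  have "(S t f x - t * A f x) - (S 0 f x - 0 * A f x) \<le> ?C * (t - 0)"
  proof (rule increment_le_if_locally[OF \<delta>(1) t])
    fix r s assume rs: "0 \<le> r" "r < s" "s \<le> t" "s - r < \<delta>"
    define h where "h = s - r"
    have h: "0 < h" "h < \<delta>" "s = r + h" using rs by (auto simp: h_def)
    have Sb: "S h f \<in> bcontfun" using h by (intro C0_bcontfun[OF S_C0] f) auto
    have hA: "(\<lambda>y. h * A f y) \<in> bcontfun" by (intro C0_bcontfun C0_cmult A_C0 f)
    have "(S s f x - s * A f x) - (S r f x - r * A f x)
        = S r (\<lambda>y. S h f y - f y - h * A f y) x + h * (S r (A f) x - A f x)"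
    proof -
      have "S r (\<lambda>y. S h f y - f y - h * A f y) x = S s f x - S r f x - h * S r (A f) x"
        using rs h S_S[of r h f x] fb Sb hA by (simp add: S_diff minus_cont S_cmult)
      then show ?thesis by (simp add: h(3) algebra_simps)
    qed
    also have "\<dots> \<le> \<eta> * h + h * (2 * \<Lambda> * (2 * \<Lambda> * B) * t)"
    proof (intro add_mono mult_left_mono)
      show "S r (\<lambda>y. S h f y - f y - h * A f y) x \<le> \<eta> * h"
        using \<delta>(2)[OF h(1,2)] by (intro S_le rs minus_cont fb Sb hA) (auto simp: abs_le_iff)
      have "S r (A f) x - A f x \<le> 2 * \<Lambda> * (2 * \<Lambda> * B) * r"
        by (rule S_increment_le[OF A_C0[OF f] A_bound[OF fb B] rs(1)])
      also have "0 \<le> 2 * \<Lambda> * (2 * \<Lambda> * B)"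
        using Lam0 B[of x] by (intro mult_nonneg_nonneg) auto
      then have "2 * \<Lambda> * (2 * \<Lambda> * B) * r \<le> 2 * \<Lambda> * (2 * \<Lambda> * B) * t"
        using rs by (intro mult_left_mono) auto
      finally show "S r (A f) x - A f x \<le> 2 * \<Lambda> * (2 * \<Lambda> * B) * t" .
    qed (use h in auto)
    finally show "(S s f x - s * A f x) - (S r f x - r * A f x) \<le> ?C * (s - r)"
      by (simp add: h_def algebra_simps)
  qed
  then show "S t f x - f x - t * A f x \<le> (2 * \<Lambda> * t)\<^sup>2 * B + e"
    using \<eta>(2) by (simp add: S_0[OF fb] algebra_simps power2_eq_square)
qed

lemma A_cmult: "A (\<lambda>x. c * f x) x = c * A f x"
  unfolding jump_generator_def by (simp add: right_diff_distrib[symmetric])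

lemma S_second_order_abs_le:
  assumes f: "f \<in> C0" and B: "\<And>x. \<bar>f x\<bar> \<le> B" and t: "0 \<le> t"
  shows "\<bar>S t f x - f x - t * A f x\<bar> \<le> (2 * \<Lambda> * t)\<^sup>2 * B"
  using S_second_order_le[OF f B t, of x] S_second_order_le[OF C0_uminus[OF f], of B t x] B t
    S_cmult[of t "-1" f x] A_cmult[of "-1" f x] by (simp add: abs_le_iff)

section \<open>The logarithmic semigroup\<close>

lemma expm1_C0:
  assumes f: "f \<in> C0" shows "(\<lambda>x. exp (f x) - 1) \<in> C0"
proof -
  obtain B where B: "\<And>x. \<bar>f x\<bar> \<le> B" "0 \<le> B" using bcontfun_bound[OF C0_bcontfun[OF f]] by metis
  have "range f \<subseteq> {-B..B}" using B(1) by (auto simp: abs_le_iff minus_le_iff)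
  then show ?thesis
    using B(2) by (intro C0_compose[OF f, of "{-B..B}"]) (auto intro!: continuous_intros)
qed

lemma exp_bcontfun:
  assumes f: "f \<in> bcontfun" shows "(\<lambda>x. exp (f x) :: real) \<in> bcontfun"
proof -
  obtain B where B: "\<And>x. \<bar>f x\<bar> \<le> B" using bcontfun_bound[OF f] by metis
  show ?thesis
  proof (rule bcontfun_normI)
    show "continuous_on UNIV (\<lambda>x. exp (f x))" by (intro continuous_intros bcontfun_continuous f)
    show "norm (exp (f x)) \<le> exp B" for x using B[of x] by simp
  qed
qed

lemma expm1_bound: "\<bar>y\<bar> \<le> B \<Longrightarrow> \<bar>exp y - 1 :: real\<bar> \<le> exp B"
proof -
  assume B: "\<bar>y\<bar> \<le> B"
  then have "exp y \<le> exp B" "1 \<le> exp B" by auto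
  then show ?thesis using exp_gt_zero[of y] unfolding abs_le_iff by linarith
qed

text \<open>exp f does not vanish at infinity in general; splitting off the constant 1 brings the
  estimates for \<open>C0\<close> to bear.\<close>

lemma S_exp:
  assumes "f \<in> C0" "0 \<le> t" shows "S t (\<lambda>y. exp (f y)) x = 1 + S t (\<lambda>y. exp (f y) - 1) x"
  using assms by (simp add: S_diff S_const exp_bcontfun C0_bcontfun const_bcontfun)

lemma S_exp_bounds:
  assumes f: "f \<in> bcontfun" and B: "\<And>x. \<bar>f x\<bar> \<le> B" and t: "0 \<le> t"
  shows "exp (- B) \<le> S t (\<lambda>y. exp (f y)) x" "S t (\<lambda>y. exp (f y)) x \<le> exp B"
proof -
  have "- B \<le> f x" "f x \<le> B" for x using B[of x] by (auto simp: abs_le_iff)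
  then show "exp (- B) \<le> S t (\<lambda>y. exp (f y)) x" "S t (\<lambda>y. exp (f y)) x \<le> exp B"
    by (auto intro!: S_ge S_le t exp_bcontfun f)
qed

lemma V_bound:
  assumes f: "f \<in> bcontfun" and B: "\<And>x. \<bar>f x\<bar> \<le> B" and t: "0 \<le> t"
  shows "\<bar>V t f x\<bar> \<le> B"
proof -
  have "0 < exp (- B)" by simp
  then have "0 < S t (\<lambda>y. exp (f y)) x" using S_exp_bounds(1)[OF f B t, of x] by linarith
  then show ?thesis
    using S_exp_bounds[OF f B t, of x] unfolding log_semigroup_def abs_le_iff
    by (metis ln_ge_iff ln_exp ln_le_cancel_iff exp_gt_zero minus_le_iff)
qed

lemma exp_V:
  assumes f: "f \<in> bcontfun" and t: "0 \<le> t" shows "exp (V t f x) = S t (\<lambda>y. exp (f y)) x"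
proof -
  obtain B where B: "\<And>x. \<bar>f x\<bar> \<le> B" using bcontfun_bound[OF f] by metis
  have "0 < exp (- B)" by simp
  then have "0 < S t (\<lambda>y. exp (f y)) x" using S_exp_bounds(1)[OF f B t, of x] by linarith
  then show ?thesis by (simp add: log_semigroup_def)
qed

lemma V_0: "f \<in> bcontfun \<Longrightarrow> V 0 f x = f x"
  by (simp add: log_semigroup_def S_0 exp_bcontfun)

lemma V_zero: "0 \<le> t \<Longrightarrow> V t (\<lambda>_. 0) x = 0"
  by (simp add: log_semigroup_def S_const)

text \<open>The lower bound exp(-B) for S t (exp f) keeps the argument of the logarithm in a compact
  part of (0,\<infinity>).\<close>

lemma V_C0:
  assumes f: "f \<in> C0" and t: "0 \<le> t" shows "V t f \<in> C0"
proof -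
  obtain B where B: "\<And>x. \<bar>f x\<bar> \<le> B" "0 \<le> B" using bcontfun_bound[OF C0_bcontfun[OF f]] by metis
  let ?g = "S t (\<lambda>y. exp (f y) - 1)"
  have "exp (- B) - 1 \<le> ?g x" "?g x \<le> exp B - 1" for x
    using S_exp_bounds[OF C0_bcontfun[OF f] B(1) t, of x] S_exp[OF f t, of x] by auto
  then have "(\<lambda>x. ln (1 + ?g x)) \<in> C0"
    using B(2) exp_gt_zero[of "-B"]
    by (intro C0_compose[OF S_C0[OF t expm1_C0[OF f]], of "{exp (- B) - 1..exp B - 1}"])
       (auto intro!: continuous_intros simp del: exp_gt_zero)
  then show ?thesis unfolding log_semigroup_def[abs_def] S_exp[OF f t] .
qed

lemma V_V:
  assumes f: "f \<in> C0" and st: "0 \<le> s" "0 \<le> t" shows "V (s + t) f x = V s (V t f) x"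
  unfolding log_semigroup_def[of P s] exp_V[OF C0_bcontfun[OF f] st(2)]
  unfolding log_semigroup_def[of P "s + t"]
  using S_S[OF st exp_bcontfun[OF C0_bcontfun[OF f]], of x] by (simp add: semigroup_op_def)

text \<open>Here 1 + z is exp(V t f - f), so V t f - f = ln(1 + z) lies between z/(1 + z) = z -
  z^2/(1 + z) and z. In the bounds on z, exp(-f) and exp f - 1 cost exp B each; the exp(2B) in front
  of z^2 and |z| bounds 1/(1 + z) = exp(f - V t f).\<close>

lemma V_estimate_aux:
  assumes f: "f \<in> C0" and B: "\<And>x. \<bar>f x\<bar> \<le> B" and t: "0 \<le> t"
  defines "z \<equiv> \<lambda>x. exp (- f x) * (S t (\<lambda>y. exp (f y) - 1) x - (exp (f x) - 1))"
  shows "\<bar>z x\<bar> \<le> exp (2 * B) * (2 * \<Lambda>) * t"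
    and "\<bar>z x - t * H f x\<bar> \<le> exp (2 * B) * (2 * \<Lambda>)\<^sup>2 * t\<^sup>2"
    and "V t f x - f x \<le> z x"
    and "z x - exp (2 * B) * (z x)\<^sup>2 \<le> V t f x - f x"
    and "- (exp (2 * B) * \<bar>z x\<bar>) \<le> V t f x - f x"
proof -
  let ?E = "\<lambda>y. exp (f y) - 1"
  have E: "?E \<in> C0" "\<And>x. \<bar>?E x\<bar> \<le> exp B" using expm1_C0[OF f] expm1_bound[OF B] by auto
  have ef: "exp (- f x) \<le> exp B" using B[of x] by (simp add: abs_le_iff)
  have e2: "exp (2 * B) = exp B * exp B" by (simp add: exp_add[symmetric])
  show "\<bar>z x\<bar> \<le> exp (2 * B) * (2 * \<Lambda>) * t"
  proof -
    have "\<bar>z x\<bar> \<le> exp B * (2 * \<Lambda> * exp B * t)"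
      unfolding z_def abs_mult using ef S_increment_abs_le[OF E t, of x] by (intro mult_mono) auto
    also have "\<dots> = exp B * exp B * (2 * \<Lambda>) * t" by (simp only: mult_ac)
    finally show ?thesis unfolding e2 .
  qed
  show "\<bar>z x - t * H f x\<bar> \<le> exp (2 * B) * (2 * \<Lambda>)\<^sup>2 * t\<^sup>2"
  proof -
    have "z x - t * H f x = exp (- f x) * (S t ?E x - ?E x - t * A ?E x)"
      by (simp add: z_def hamiltonian_def algebra_simps)
    also have "\<bar>\<dots>\<bar> \<le> exp B * ((2 * \<Lambda> * t)\<^sup>2 * exp B)"
      unfolding abs_mult using ef S_second_order_abs_le[OF E t, of x] by (intro mult_mono) auto
    also have "\<dots> = exp B * exp B * (2 * \<Lambda>)\<^sup>2 * t\<^sup>2" by (simp only: mult_ac power_mult_distrib)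
    finally show ?thesis unfolding e2 .
  qed
  let ?p = "exp (V t f x - f x)"
  have p: "?p = 1 + z x"
  proof -
    have "?p = exp (- f x) * (1 + S t ?E x)"
      by (simp add: exp_diff exp_V[OF C0_bcontfun[OF f] t] S_exp[OF f t] exp_minus field_simps)
    also have "\<dots> = 1 + z x" by (simp add: z_def algebra_simps exp_minus)
    finally show ?thesis .
  qed
  have VB: "- (2 * B) \<le> V t f x - f x"
    using V_bound[OF C0_bcontfun[OF f] B t, of x] B[of x] by (auto simp: abs_le_iff)
  show up: "V t f x - f x \<le> z x"
    using exp_ge_add_one_self[of "V t f x - f x"] p by linarith
  define w where "w = exp (- (V t f x - f x))"
  have w: "0 < w" "w \<le> exp (2 * B)" "w * (1 + z x) = 1"
    using VB by (auto simp: w_def p[symmetric] exp_add[symmetric])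
  have "1 - (V t f x - f x) \<le> w"
    unfolding w_def using exp_ge_add_one_self[of "- (V t f x - f x)"] by linarith
  then have lo: "z x * w \<le> V t f x - f x" using w(3) by (simp add: algebra_simps)
  have "z x * w = z x - w * (z x)\<^sup>2"
  proof -
    have "z x = z x * (w * (1 + z x))" by (simp add: w(3))
    then show ?thesis by (simp add: algebra_simps power2_eq_square)
  qed
  moreover have "w * (z x)\<^sup>2 \<le> exp (2 * B) * (z x)\<^sup>2" using w by (intro mult_right_mono) auto
  ultimately show "z x - exp (2 * B) * (z x)\<^sup>2 \<le> V t f x - f x" using lo by linarith
  have "- (\<bar>z x\<bar> * w) \<le> z x * w" 
  proof -
    have "- \<bar>z x\<bar> * w \<le> z x * w" using w(1) by (intro mult_right_mono) auto
    then show ?thesis by simp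
  qed
  moreover have "w * \<bar>z x\<bar> \<le> exp (2 * B) * \<bar>z x\<bar>" using w by (intro mult_right_mono) auto
  ultimately show "- (exp (2 * B) * \<bar>z x\<bar>) \<le> V t f x - f x" using lo by (simp add: mult.commute)
qed

text \<open>exp(4B) arises from the lower bound: exp(2B) for 1/(1 + z) times exp(2B) in the bound on
  |z|.\<close>

lemma V_increment_abs_le:
  assumes f: "f \<in> C0" and B: "\<And>x. \<bar>f x\<bar> \<le> B" and t: "0 \<le> t"
  shows "\<bar>V t f x - f x\<bar> \<le> exp (4 * B) * (2 * \<Lambda>) * t"
proof -
  define z where "z = exp (- f x) * (S t (\<lambda>y. exp (f y) - 1) x - (exp (f x) - 1))"
  note z = V_estimate_aux[OF f B t, of x, folded z_def]
  have B0: "0 \<le> B" using B[of x] by linarith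
  have "exp (2 * B) * \<bar>z\<bar> \<le> exp (2 * B) * (exp (2 * B) * (2 * \<Lambda>) * t)"
    using z(1) by (intro mult_left_mono) auto
  also have "\<dots> = exp (4 * B) * (2 * \<Lambda>) * t" by (simp add: mult.assoc[symmetric] exp_add[symmetric])
  finally have 1: "exp (2 * B) * \<bar>z\<bar> \<le> exp (4 * B) * (2 * \<Lambda>) * t" .
  have "1 * \<bar>z\<bar> \<le> exp (2 * B) * \<bar>z\<bar>" using B0 by (intro mult_right_mono) auto
  then have "z \<le> exp (2 * B) * \<bar>z\<bar>" by linarith
  then show ?thesis using 1 z(3,5) by (simp add: abs_le_iff)
qed

text \<open>exp(6B) is exp(2B) for 1/(1 + z) times the square of the exp(2B) in the bound on |z|.
  The factor 2 adds the quadratic error to that of z - t H f.\<close>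

lemma V_second_order_abs_le:
  assumes f: "f \<in> C0" and B: "\<And>x. \<bar>f x\<bar> \<le> B" and t: "0 \<le> t"
  shows "\<bar>V t f x - f x - t * H f x\<bar> \<le> 2 * exp (6 * B) * (2 * \<Lambda>)\<^sup>2 * t\<^sup>2"
proof -
  define z where "z = exp (- f x) * (S t (\<lambda>y. exp (f y) - 1) x - (exp (f x) - 1))"
  note z = V_estimate_aux[OF f B t, of x, folded z_def]
  have B0: "0 \<le> B" using B[of x] by linarith
  have "\<bar>z\<bar>\<^sup>2 \<le> (exp (2 * B) * (2 * \<Lambda>) * t)\<^sup>2" using z(1) by (intro power_mono) auto
  then have "exp (2 * B) * z\<^sup>2 \<le> exp (2 * B) * (exp (2 * B) * (2 * \<Lambda>) * t)\<^sup>2"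
    by (intro mult_left_mono) auto
  also have "\<dots> = exp (2 * B) * exp (2 * B) * exp (2 * B) * (2 * \<Lambda>)\<^sup>2 * t\<^sup>2"
    by (simp add: power_mult_distrib power2_eq_square)
  also have "exp (2 * B) * exp (2 * B) * exp (2 * B) = exp (6 * B)" by (simp add: exp_add[symmetric])
  finally have 1: "exp (2 * B) * z\<^sup>2 \<le> exp (6 * B) * (2 * \<Lambda>)\<^sup>2 * t\<^sup>2" .
  have 2: "exp (2 * B) * (2 * \<Lambda>)\<^sup>2 * t\<^sup>2 \<le> exp (6 * B) * (2 * \<Lambda>)\<^sup>2 * t\<^sup>2"
    using B0 by (intro mult_right_mono) auto
  have 3: "0 \<le> exp (6 * B) * (2 * \<Lambda>)\<^sup>2 * t\<^sup>2" by simp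
  have "\<bar>z - t * H f x\<bar> \<le> exp (6 * B) * (2 * \<Lambda>)\<^sup>2 * t\<^sup>2" using z(2) 2 by linarith
  then show ?thesis using z(3,4) 1 3 unfolding abs_le_iff by linarith
qed

section \<open>The Hamiltonian\<close>

lemma H_eq:
  assumes f: "f \<in> bcontfun" shows "H f x = lam x * (\<integral>y. exp (f y - f x) - 1 \<partial>\<mu> x)"
proof -
  have "exp (- f x) * (\<integral>y. (exp (f y) - 1) - (exp (f x) - 1) \<partial>\<mu> x)
      = (\<integral>y. exp (- f x) * ((exp (f y) - 1) - (exp (f x) - 1)) \<partial>\<mu> x)"
    by simp
  also have "\<dots> = (\<integral>y. exp (f y - f x) - 1 \<partial>\<mu> x)"
    by (intro Bochner_Integration.integral_cong) (auto simp: exp_diff exp_minus field_simps)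
  finally show ?thesis unfolding hamiltonian_def jump_generator_def by simp
qed

lemma H_C0: assumes "f \<in> C0" shows "H f \<in> C0"
  unfolding hamiltonian_def[abs_def]
  using uminus_cont[OF C0_bcontfun[OF assms]]
  by (intro C0_mult_bcontfun A_C0 expm1_C0 assms exp_bcontfun)

text \<open>The exponents f y - f x are at most 2B and differ by at most 2e. This serves twice: to
  replace \<open>C0\<close> by a dense sequence in the Lagrangian, and to control test functions
  that move with time.\<close>

lemma H_lipschitz:
  assumes f: "f \<in> bcontfun" "g \<in> bcontfun" and B: "\<And>x. \<bar>f x\<bar> \<le> B" "\<And>x. \<bar>g x\<bar> \<le> B"
    and e: "\<And>x. \<bar>f x - g x\<bar> \<le> e"
  shows "\<bar>H f x - H g x\<bar> \<le> 2 * \<Lambda> * exp (2 * B) * e"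
proof -
  have ib: "(\<lambda>y. exp (f y - f x) - 1) \<in> bcontfun" if "f \<in> bcontfun" for f :: "'a \<Rightarrow> real"
    by (intro minus_cont exp_bcontfun const_bcontfun that)
  have "\<bar>(\<integral>y. exp (f y - f x) - 1 \<partial>\<mu> x) - (\<integral>y. exp (g y - g x) - 1 \<partial>\<mu> x)\<bar> \<le> exp (2 * B) * (2 * e)"
  proof (rule integral_probs_diff_abs_le[OF mu_probs])
    fix y
    have "\<bar>exp (f y - f x) - exp (g y - g x)\<bar> \<le> exp (2 * B) * \<bar>(f y - f x) - (g y - g x)\<bar>"
      using B(1)[of x] B(1)[of y] B(2)[of x] B(2)[of y] by (intro exp_diff_le) (auto simp: abs_le_iff)
    also have "\<dots> \<le> exp (2 * B) * (2 * e)"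
      using e[of x] e[of y] by (intro mult_left_mono) auto
    finally show "\<bar>exp (f y - f x) - 1 - (exp (g y - g x) - 1)\<bar> \<le> exp (2 * B) * (2 * e)" by simp
  qed (auto intro!: integrable_bcontfun mu_probs ib f)
  then have "lam x * \<bar>(\<integral>y. exp (f y - f x) - 1 \<partial>\<mu> x) - (\<integral>y. exp (g y - g x) - 1 \<partial>\<mu> x)\<bar>
      \<le> \<Lambda> * (exp (2 * B) * (2 * e))"
    using lam[of x] Lam0 by (intro mult_mono) auto
  then show ?thesis
    unfolding H_eq[OF f(1)] H_eq[OF f(2)] right_diff_distrib[symmetric] abs_mult
    using lam(1)[of x] by (simp add: algebra_simps)
qed

end

section \<open>Integrals over time\<close>

text \<open>Clamping both ends at 0 reduces bounds for all real a < b to nonnegative times. The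
  point 0, lost from the interval when a < 0 \<le> b, is a null set.\<close>

lemma set_integral_Ioc_max_0:
  fixes g :: "real \<Rightarrow> real"
  assumes int: "\<And>a b. set_integrable lborel {a..b} g" and neg: "\<And>s. s < 0 \<Longrightarrow> g s = 0"
  shows "(LBINT s:{a<..b}. g s) = (LBINT s:{max 0 a<..max 0 b}. g s)"
  unfolding set_lebesgue_integral_def
proof (rule integral_cong_AE)
  show "(\<lambda>s. indicator {a<..b} s *\<^sub>R g s) \<in> borel_measurable lborel"
    "(\<lambda>s. indicator {max 0 a<..max 0 b} s *\<^sub>R g s) \<in> borel_measurable lborel"
    using set_integrable_Ioc[OF int] by (auto simp: set_integrable_def)
  show "AE s in lborel. indicator {a<..b} s *\<^sub>R g s = indicator {max 0 a<..max 0 b} s *\<^sub>R g s"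
    by (rule AE_mp[OF AE_lborel_singleton[of 0]]) (use neg in \<open>auto simp: indicator_def not_less\<close>)
qed

lemma quadratic_le_linear:
  fixes C h \<eta> :: real
  assumes "0 \<le> C" "0 < h" "h \<le> \<eta> / (C + 1)" shows "C * h\<^sup>2 \<le> \<eta> * h"
proof -
  have "C * h \<le> (C + 1) * h" using assms by (intro mult_right_mono) auto
  also have "\<dots> \<le> \<eta>" using assms by (simp add: field_simps)
  finally have "C * h * h \<le> \<eta> * h" using assms by (intro mult_right_mono) auto
  then show ?thesis by (simp add: power2_eq_square mult.assoc)
qed

text \<open>A Lipschitz bound in y, uniform in s, upgrades separate continuity to joint continuity
  on a compact square, whence one \<delta> for all y. The family arises because the test function
  changes along the path.\<close>

lemma uniformly_continuous_family:
  fixes q :: "real \<Rightarrow> real \<Rightarrow> real"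
  assumes M: "\<And>y y' s. y \<in> {a..b} \<Longrightarrow> y' \<in> {a..b} \<Longrightarrow> s \<in> {a..b} \<Longrightarrow> \<bar>q y s - q y' s\<bar> \<le> M * \<bar>y - y'\<bar>"
    and cont: "\<And>y. y \<in> {a..b} \<Longrightarrow> continuous_on {a..b} (q y)" and "0 < e"
  obtains \<delta> where "0 < \<delta>" "\<And>y s s'. y \<in> {a..b} \<Longrightarrow> s \<in> {a..b} \<Longrightarrow> s' \<in> {a..b} \<Longrightarrow> \<bar>s - s'\<bar> < \<delta> \<Longrightarrow> \<bar>q y s - q y s'\<bar> < e"
proof -
  have "continuous_on ({a..b} \<times> {a..b}) (\<lambda>p. q (fst p) (snd p))"
    unfolding continuous_on_iff
  proof (intro ballI allI impI)
    fix p and \<epsilon> :: real assume p: "p \<in> {a..b} \<times> {a..b}" and "0 < \<epsilon>"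
    obtain y s where ys: "p = (y, s)" "y \<in> {a..b}" "s \<in> {a..b}" using p by auto
    obtain d where d: "0 < d" "\<And>s'. s' \<in> {a..b} \<Longrightarrow> dist s' s < d \<Longrightarrow> dist (q y s') (q y s) < \<epsilon> / 2"
      using cont[OF ys(2)] ys(3) \<open>0 < \<epsilon>\<close> unfolding continuous_on_iff by (metis half_gt_zero)
    \<comment> \<open>|M| + 1 is positive whatever the sign of M.\<close>
    define d' where "d' = min d (\<epsilon> / 2 / (\<bar>M\<bar> + 1))"
    have "0 < d'" using d(1) \<open>0 < \<epsilon>\<close> by (simp add: d'_def)
    moreover have "dist (q (fst p') (snd p')) (q (fst p) (snd p)) < \<epsilon>"
      if p': "p' \<in> {a..b} \<times> {a..b}" "dist p' p < d'" for p'
    proof -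
      obtain y' s' where ys': "p' = (y', s')" "y' \<in> {a..b}" "s' \<in> {a..b}" using p' by auto
      have "dist y' y < d'" "dist s' s < d'"
        using p'(2) dist_fst_le[of p' p] dist_snd_le[of p' p] by (auto simp: ys ys')
      then have 1: "\<bar>q y s' - q y s\<bar> < \<epsilon> / 2" and y: "\<bar>y' - y\<bar> \<le> \<epsilon> / 2 / (\<bar>M\<bar> + 1)"
        using d(2)[OF ys'(3)] by (auto simp: d'_def dist_real_def)
      have "\<bar>q y' s' - q y s'\<bar> \<le> M * \<bar>y' - y\<bar>" by (rule M) (use ys ys' in auto)
      also have "\<dots> \<le> (\<bar>M\<bar> + 1) * \<bar>y' - y\<bar>" by (intro mult_right_mono) auto
      also have "\<dots> \<le> \<epsilon> / 2" using y by (simp add: field_simps)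
      finally show ?thesis using 1 unfolding ys ys' dist_real_def fst_conv snd_conv by linarith
    qed
    ultimately show "\<exists>d>0. \<forall>p'\<in>{a..b} \<times> {a..b}. dist p' p < d \<longrightarrow>
        dist (q (fst p') (snd p')) (q (fst p) (snd p)) < \<epsilon>" by blast
  qed
  then have "uniformly_continuous_on ({a..b} \<times> {a..b}) (\<lambda>p. q (fst p) (snd p))"
    by (intro compact_uniformly_continuous compact_Times) auto
  then obtain d where d: "0 < d" "\<And>p p'. p \<in> {a..b} \<times> {a..b} \<Longrightarrow> p' \<in> {a..b} \<times> {a..b} \<Longrightarrow> dist p' p < d \<Longrightarrow>
      dist (q (fst p') (snd p')) (q (fst p) (snd p)) < e"
    using \<open>0 < e\<close> unfolding uniformly_continuous_on_def by metis
  show ?thesis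
  proof (rule that[OF d(1)])
    fix y s s' assume "y \<in> {a..b}" "s \<in> {a..b}" "s' \<in> {a..b}" "\<bar>s - s'\<bar> < d"
    then show "\<bar>q y s - q y s'\<bar> < e"
      using d(2)[of "(y, s')" "(y, s)"] by (simp add: dist_Pair_Pair dist_real_def)
  qed
qed

section \<open>The Lagrangian along a path with a velocity\<close>

locale jump_path = jump_semigroup lam \<mu> P \<Lambda>
  for lam :: "'a::{metric_space, second_countable_topology} \<Rightarrow> real" and \<mu> P \<Lambda> +
  fixes \<nu> :: "real \<Rightarrow> 'a measure"
  assumes nu: "\<nu> \<in> continuous_paths weak_topology"
begin

lemma nu_probs: "0 \<le> t \<Longrightarrow> \<nu> t \<in> probs"
  using continuous_paths_weak_topologyD(1)[OF nu] .

lemma nu_integrable: "0 \<le> t \<Longrightarrow> f \<in> bcontfun \<Longrightarrow> integrable (\<nu> t) (f :: 'a \<Rightarrow> real)"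
  by (intro integrable_bcontfun nu_probs)

lemma nu_cont: "f \<in> C0 \<Longrightarrow> continuous_on {0..} (\<lambda>t. \<integral>x. f x \<partial>\<nu> t)"
  using continuous_paths_weak_topologyD(2)[OF nu C0_bcontfun] .

lemma cond_rate_ge:
  "f \<in> bcontfun \<Longrightarrow> ereal ((\<integral>x. f x \<partial>\<rho>') - (\<integral>x. V t f x \<partial>\<rho>)) \<le> cond_rate P t \<rho>' \<rho>"
  unfolding cond_rate_def by (rule SUP_upper)

lemma cond_rate_nonneg: "0 \<le> t \<Longrightarrow> 0 \<le> cond_rate P t \<rho>' \<rho>"
  using cond_rate_ge[of "\<lambda>_. 0" \<rho>' \<rho> t] by (simp add: V_zero const_bcontfun zero_ereal_def)

text \<open>The expression under the supremum in \<open>lagrangian\<close>, for one f and along the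
  path, continued by 0 to negative times so that it can be compared with measures on the whole
  line.\<close>

definition lagr_at :: "(real \<Rightarrow> ('a \<Rightarrow> real) \<Rightarrow> real) \<Rightarrow> ('a \<Rightarrow> real) \<Rightarrow> real \<Rightarrow> real" where
  "lagr_at u f s = (if 0 \<le> s then u s f - (\<integral>x. H f x \<partial>\<nu> s) else 0)"

lemma nu_integral_measurable:
  assumes "f \<in> C0"
  shows "(\<lambda>s. indicator {0..} s * (\<integral>x. f x \<partial>\<nu> s)) \<in> borel_measurable borel"
  using borel_measurable_continuous_on_indicator[OF _ nu_cont[OF assms]] by simp

lemma nu_integral_integrable:
  assumes "f \<in> C0"
  shows "set_integrable lborel {0..t} (\<lambda>s. \<integral>x. f x \<partial>\<nu> s)"
  by (rule borel_integrable_atLeastAtMost')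
     (rule continuous_on_subset[OF nu_cont[OF assms]], auto)

lemma V_increment_uniform:
  assumes g: "\<And>y. y \<in> {a..b} \<Longrightarrow> g y \<in> C0" "\<And>y x. y \<in> {a..b} \<Longrightarrow> \<bar>g y x\<bar> \<le> B"
    and lip: "\<And>y y' x. y \<in> {a..b} \<Longrightarrow> y' \<in> {a..b} \<Longrightarrow> \<bar>g y x - g y' x\<bar> \<le> M * \<bar>y - y'\<bar>"
    and a: "0 \<le> a" and \<eta>: "0 < \<eta>"
  obtains \<delta> where "0 < \<delta>" "\<And>x y. \<lbrakk>a \<le> x; x < y; y \<le> b; y - x < \<delta>\<rbrakk> \<Longrightarrow>
    \<bar>(\<integral>z. V (y - x) (g y) z \<partial>\<nu> x) - (\<integral>z. g y z \<partial>\<nu> x) - (LBINT s:{x<..y}. \<integral>z. H (g y) z \<partial>\<nu> s)\<bar> \<le> \<eta> * (y - x)"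
proof -
  define K where "K y s = (\<integral>x. H (g y) x \<partial>\<nu> s)" for y s
  have KM: "\<bar>K y s - K y' s\<bar> \<le> 2 * \<Lambda> * exp (2 * B) * M * \<bar>y - y'\<bar>"
    if "y \<in> {a..b}" "y' \<in> {a..b}" "s \<in> {a..b}" for y y' s
    unfolding K_def mult.assoc[of _ M]
    by (intro integral_probs_diff_abs_le[OF nu_probs] nu_integrable C0_bcontfun H_C0 g H_lipschitz lip)
       (use that a in auto)
  have Kc: "continuous_on {a..b} (K y)" if "y \<in> {a..b}" for y
    unfolding K_def[abs_def] by (rule continuous_on_subset[OF nu_cont[OF H_C0[OF g(1)]]]) (use that a in auto)
  obtain \<delta>1 where \<delta>1: "0 < \<delta>1"
    "\<And>y s s'. y \<in> {a..b} \<Longrightarrow> s \<in> {a..b} \<Longrightarrow> s' \<in> {a..b} \<Longrightarrow> \<bar>s - s'\<bar> < \<delta>1 \<Longrightarrow> \<bar>K y s - K y s'\<bar> < \<eta> / 2"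
    using uniformly_continuous_family[OF KM Kc, of "\<eta> / 2"] \<eta> by auto
  define C where "C = 2 * exp (6 * B) * (2 * \<Lambda>)\<^sup>2"
  have C: "0 \<le> C" by (simp add: C_def)
  define \<delta> where "\<delta> = min \<delta>1 (\<eta> / 2 / (C + 1))"
  have \<delta>: "0 < \<delta>" using \<delta>1 \<eta> C by (simp add: \<delta>_def)
  show ?thesis
  proof (rule that[OF \<delta>])
    fix x y assume xy: "a \<le> x" "x < y" "y \<le> b" "y - x < \<delta>"
    define h where "h = y - x"
    have h: "0 < h" "h < \<delta>1" "h \<le> \<eta> / 2 / (C + 1)" using xy by (auto simp: h_def \<delta>_def)
    have x0: "0 \<le> x" and y: "y \<in> {a..b}" using xy a by auto
    have Ch: "C * h\<^sup>2 \<le> \<eta> / 2 * h" by (rule quadratic_le_linear[OF C h(1,3)])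
    note gy = g(1)[OF y]
    have 1: "\<bar>\<integral>z. V h (g y) z - g y z - h * H (g y) z \<partial>\<nu> x\<bar> \<le> C * h\<^sup>2"
      using h V_second_order_abs_le[OF gy g(2)[OF y], of h]
      by (intro integral_probs_abs_le[OF nu_probs[OF x0]] nu_integrable x0 C0_bcontfun C0_diff V_C0 gy C0_cmult H_C0)
         (auto simp: C_def)
    have 2: "(\<integral>z. V h (g y) z - g y z - h * H (g y) z \<partial>\<nu> x)
        = (\<integral>z. V h (g y) z \<partial>\<nu> x) - (\<integral>z. g y z \<partial>\<nu> x) - h * K y x"
      unfolding K_def using h by (simp add: nu_integrable x0 C0_bcontfun V_C0 gy H_C0)
    have int: "set_integrable lborel {x<..y} (K y)"
      unfolding K_def[abs_def]
      by (rule set_integrable_subset[OF nu_integral_integrable[OF H_C0[OF gy], of y]]) (use x0 in auto)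
    have "\<bar>K y s - K y x\<bar> < \<eta> / 2" if "x < s" "s \<le> y" for s
      using that xy h by (intro \<delta>1(2)) (auto simp: h_def)
    then have K: "K y x - \<eta> / 2 \<le> K y s" "K y s \<le> K y x + \<eta> / 2" if "x < s" "s \<le> y" for s
      using that by (smt (verit))+
    have "(K y x - \<eta> / 2) * h \<le> (LBINT s:{x<..y}. K y s)" "(LBINT s:{x<..y}. K y s) \<le> (K y x + \<eta> / 2) * h"
      unfolding h_def using xy K int by (auto intro!: set_integral_Ioc_ge_const set_integral_Ioc_le_const)
    then have "\<bar>(LBINT s:{x<..y}. K y s) - h * K y x\<bar> \<le> \<eta> / 2 * h"
      unfolding left_diff_distrib distrib_right mult.commute[of h] by linarith
    then have "\<bar>(\<integral>z. V h (g y) z \<partial>\<nu> x) - (\<integral>z. g y z \<partial>\<nu> x) - (LBINT s:{x<..y}. K y s)\<bar> \<le> \<eta> / 2 * h + \<eta> / 2 * h"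
      using 1 Ch unfolding 2 by linarith
    then show "\<bar>(\<integral>z. V (y - x) (g y) z \<partial>\<nu> x) - (\<integral>z. g y z \<partial>\<nu> x) - (LBINT s:{x<..y}. \<integral>z. H (g y) z \<partial>\<nu> s)\<bar>
        \<le> \<eta> * (y - x)" by (simp add: h_def K_def)
  qed
qed

context
  fixes u assumes u: "is_velocity \<nu> u"
begin

lemma u_integrable: "f \<in> C0 \<Longrightarrow> 0 \<le> t \<Longrightarrow> set_integrable lborel {0..t} (\<lambda>s. u s f)"
  and u_increment: "f \<in> C0 \<Longrightarrow> 0 \<le> t \<Longrightarrow> (\<integral>x. f x \<partial>\<nu> t) - (\<integral>x. f x \<partial>\<nu> 0) = (LBINT s:{0..t}. u s f)"
  using u by (auto simp: is_velocity_def)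

lemma lagr_at_measurable: "f \<in> C0 \<Longrightarrow> lagr_at u f \<in> borel_measurable borel"
proof -
  assume f: "f \<in> C0"
  have "(\<lambda>s. indicator {0..} s * u s f - indicator {0..} s * (\<integral>x. H f x \<partial>\<nu> s)) \<in> borel_measurable borel"
    using u f nu_integral_measurable[OF H_C0[OF f]]
    by (intro borel_measurable_diff) (auto simp: is_velocity_def set_borel_measurable_def)
  also have "(\<lambda>s. indicator {0..} s * u s f - indicator {0..} s * (\<integral>x. H f x \<partial>\<nu> s)) = lagr_at u f"
    by (auto simp: lagr_at_def)
  finally show ?thesis .
qed

lemma lagr_at_integrable_aux:
  assumes f: "f \<in> C0" and t: "0 \<le> t"
  shows "set_integrable lborel {0..t} (lagr_at u f)"
    and "(LBINT s:{0..t}. lagr_at u f s)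
       = (\<integral>x. f x \<partial>\<nu> t) - (\<integral>x. f x \<partial>\<nu> 0) - (LBINT s:{0..t}. \<integral>x. H f x \<partial>\<nu> s)"
proof -
  have eq: "indicator {0..t} s *\<^sub>R lagr_at u f s = indicator {0..t} s *\<^sub>R (u s f - (\<integral>x. H f x \<partial>\<nu> s))" for s
    by (auto simp: lagr_at_def indicator_def)
  note int = u_integrable[OF f t] nu_integral_integrable[OF H_C0[OF f], of t]
  show "set_integrable lborel {0..t} (lagr_at u f)"
    using set_integral_diff(1)[OF int] unfolding set_integrable_def eq .
  show "(LBINT s:{0..t}. lagr_at u f s)
       = (\<integral>x. f x \<partial>\<nu> t) - (\<integral>x. f x \<partial>\<nu> 0) - (LBINT s:{0..t}. \<integral>x. H f x \<partial>\<nu> s)"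
    using set_integral_diff(2)[OF int] u_increment[OF f t]
    unfolding set_lebesgue_integral_def eq by simp
qed

lemma lagr_at_integrable:
  assumes f: "f \<in> C0" shows "set_integrable lborel {a..b} (lagr_at u f)"
proof -
  have m: "(\<lambda>s. indicator {a..b} s *\<^sub>R lagr_at u f s) \<in> borel_measurable lborel"
    using lagr_at_measurable[OF f] by simp
  have "integrable lborel (\<lambda>s. indicator {0..max 0 b} s *\<^sub>R lagr_at u f s)"
    using lagr_at_integrable_aux(1)[OF f, of "max 0 b"] by (simp add: set_integrable_def)
  then show ?thesis
    unfolding set_integrable_def
    by (rule Bochner_Integration.integrable_bound[OF _ m]) (auto simp: indicator_def lagr_at_def)
qed

lemma lagr_at_neg: "s < 0 \<Longrightarrow> lagr_at u f s = 0"
  by (simp add: lagr_at_def)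

lemma lagr_at_increment:
  assumes f: "f \<in> C0" and ab: "0 \<le> a" "a \<le> b"
  shows "(\<integral>x. f x \<partial>\<nu> b) - (\<integral>x. f x \<partial>\<nu> a)
    = (LBINT s:{a<..b}. lagr_at u f s) + (LBINT s:{a<..b}. \<integral>x. H f x \<partial>\<nu> s)"
proof -
  let ?K = "\<lambda>s. \<integral>x. H f x \<partial>\<nu> s"
  have 1: "(LBINT s:{a<..b}. lagr_at u f s)
      = (LBINT s:{0..b}. lagr_at u f s) - (LBINT s:{0..a}. lagr_at u f s)"
    using ab by (intro indefinite_integral_increment[symmetric] lagr_at_integrable f lagr_at_neg) auto
  have "(LINT s:{0..a} \<union> {a<..b}|lborel. ?K s) = (LBINT s:{0..a}. ?K s) + (LBINT s:{a<..b}. ?K s)"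
    by (intro set_integral_Un nu_integral_integrable H_C0 f
        set_integrable_subset[OF nu_integral_integrable[OF H_C0[OF f], of b]]) (use ab in auto)
  moreover have "{0..a} \<union> {a<..b} = {0..b}" using ab by auto
  ultimately have 2: "(LBINT s:{a<..b}. ?K s) = (LBINT s:{0..b}. ?K s) - (LBINT s:{0..a}. ?K s)"
    by simp
  show ?thesis
    unfolding 1 2 using lagr_at_integrable_aux(2)[OF f, of a] lagr_at_integrable_aux(2)[OF f, of b] ab by simp
qed

text \<open>A single f in the supremum for \<open>cond_rate\<close> gives \<langle>f,
  \<nu>(y)\<rangle> - \<langle>V(y - x)f, \<nu>(x)\<rangle> \<le> m y - m x. Expanding V turns the
  left side into the increment of the primitive of \<open>lagr_at\<close> up to \<eta>(y - x), an
  error that survives summation over short intervals.\<close>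

lemma lagr_at_le_of_cond_rate:
  assumes m: "mono m" "\<And>a b. 0 \<le> a \<Longrightarrow> a < b \<Longrightarrow> cond_rate P (b - a) (\<nu> b) (\<nu> a) \<le> ereal (m b - m a)"
    and f: "f \<in> C0" and ab: "0 \<le> a" "a \<le> b"
  shows "(LBINT s:{a<..b}. lagr_at u f s) \<le> m b - m a"
proof (rule field_le_epsilon)
  fix e :: real assume "0 < e"
  define \<eta> where "\<eta> = e / (b - a + 1)"
  have \<eta>: "0 < \<eta>" "\<eta> * (b - a) \<le> e" using \<open>0 < e\<close> ab by (auto simp: \<eta>_def field_simps)
  obtain B where B: "\<And>x. \<bar>f x\<bar> \<le> B" using bcontfun_bound[OF C0_bcontfun[OF f]] by metis
  let ?K = "\<lambda>s. \<integral>x. H f x \<partial>\<nu> s"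
  let ?\<Phi> = "\<lambda>t. LBINT s:{0..t}. lagr_at u f s"
  obtain \<delta> where \<delta>: "0 < \<delta>" "\<And>x y. \<lbrakk>a \<le> x; x < y; y \<le> b; y - x < \<delta>\<rbrakk> \<Longrightarrow>
    \<bar>(\<integral>z. V (y - x) f z \<partial>\<nu> x) - (\<integral>z. f z \<partial>\<nu> x) - (LBINT s:{x<..y}. ?K s)\<bar> \<le> \<eta> * (y - x)"
    using V_increment_uniform[of a b "\<lambda>_. f" B 0 \<eta>] f B ab(1) \<eta>(1) by auto
  have "(?\<Phi> b - m b) - (?\<Phi> a - m a) \<le> \<eta> * (b - a)"
  proof (rule increment_le_if_locally[OF \<delta>(1) ab(2)])
    fix x y assume xy: "a \<le> x" "x < y" "y \<le> b" "y - x < \<delta>"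
    have x0: "0 \<le> x" using xy ab by simp
    have "ereal ((\<integral>z. f z \<partial>\<nu> y) - (\<integral>z. V (y - x) f z \<partial>\<nu> x)) \<le> ereal (m y - m x)"
      by (rule order_trans[OF cond_rate_ge[OF C0_bcontfun[OF f]] m(2)[OF x0 xy(2)]])
    then have 1: "(\<integral>z. f z \<partial>\<nu> y) - (\<integral>z. V (y - x) f z \<partial>\<nu> x) \<le> m y - m x" by simp
    have "?\<Phi> y - ?\<Phi> x = (LBINT s:{x<..y}. lagr_at u f s)"
      using xy by (intro indefinite_integral_increment lagr_at_integrable f lagr_at_neg) auto
    also have "\<dots> = (\<integral>z. f z \<partial>\<nu> y) - (\<integral>z. f z \<partial>\<nu> x) - (LBINT s:{x<..y}. ?K s)"
      using lagr_at_increment[OF f x0, of y] xy by simp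
    finally show "(?\<Phi> y - m y) - (?\<Phi> x - m x) \<le> \<eta> * (y - x)"
      using 1 \<delta>(2)[OF xy] by linarith
  qed
  moreover have "?\<Phi> b - ?\<Phi> a = (LBINT s:{a<..b}. lagr_at u f s)"
    using ab by (intro indefinite_integral_increment lagr_at_integrable f lagr_at_neg) auto
  ultimately show "(LBINT s:{a<..b}. lagr_at u f s) \<le> m b - m a + e" using \<eta>(2) by linarith
qed

end

end

section \<open>Reduction of the Lagrangian to countably many test functions\<close>

lemma C0_dual_lipschitz:
  fixes u :: "('a::topological_space \<Rightarrow> real) \<Rightarrow> real"
  assumes u: "u \<in> C0_dual"
  obtains K where "0 \<le> K" "\<And>f g \<epsilon>. f \<in> C0 \<Longrightarrow> g \<in> C0 \<Longrightarrow> (\<And>x. \<bar>f x - g x\<bar> \<le> \<epsilon>) \<Longrightarrow> \<bar>u f - u g\<bar> \<le> K * \<epsilon>"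
proof -
  have add: "u (\<lambda>x. f x + g x) = u f + u g" if "f \<in> C0" "g \<in> C0" for f g
    using u that by (simp add: C0_dual_def)
  obtain B where B: "\<And>f. f \<in> C0 \<Longrightarrow> \<bar>u f\<bar> \<le> B * (SUP x. \<bar>f x\<bar>)"
    using u unfolding C0_dual_def by blast
  show ?thesis
  proof (rule that[of "\<bar>B\<bar>"])
    fix f g :: "'a \<Rightarrow> real" and \<epsilon>
    assume f: "f \<in> C0" and g: "g \<in> C0" and \<epsilon>: "\<And>x. \<bar>f x - g x\<bar> \<le> \<epsilon>"
    let ?h = "\<lambda>x. f x - g x"
    have h: "?h \<in> C0" by (rule C0_diff[OF f g])
    have "u f = u (\<lambda>x. g x + ?h x)" by simp
    also have "\<dots> = u g + u ?h" by (rule add[OF g h])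
    finally have "\<bar>u f - u g\<bar> = \<bar>u ?h\<bar>" by simp
    also have "\<dots> \<le> B * (SUP x. \<bar>?h x\<bar>)" by (rule B[OF h])
    also have "\<dots> \<le> \<bar>B\<bar> * (SUP x. \<bar>?h x\<bar>)"
    proof (rule mult_right_mono)
      have "0 \<le> \<bar>?h undefined\<bar>" by simp
      also have "\<dots> \<le> (SUP x. \<bar>?h x\<bar>)" by (rule cSUP_upper) (use \<epsilon> in \<open>auto intro!: bdd_aboveI2\<close>)
      finally show "0 \<le> (SUP x. \<bar>?h x\<bar>)" .
    qed simp
    also have "\<dots> \<le> \<bar>B\<bar> * \<epsilon>" using \<epsilon> by (intro mult_left_mono cSUP_least) auto
    finally show "\<bar>u f - u g\<bar> \<le> \<bar>B\<bar> * \<epsilon>" .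
  qed simp
qed

context jump_semigroup
begin

text \<open>u is Lipschitz in sup norm, and so is H on bounded sets of functions; a dense sequence
  therefore gives the same supremum, which makes the Lagrangian measurable along a path. Truncation
  at 0 by \<open>e2ennreal\<close> loses nothing, since f = 0 contributes 0.\<close>

lemma lagrangian_eq_SUP:
  assumes D: "\<And>n::nat. D n \<in> C0" "\<forall>f\<in>C0. \<forall>\<epsilon>>0. \<exists>n. \<forall>x. \<bar>f x - D n x\<bar> \<le> \<epsilon>"
    and u: "u \<in> C0_dual" and \<rho>: "\<rho> \<in> probs"
  shows "e2ennreal (lagrangian A \<rho> u) = (SUP n. ennreal (u (D n) - (\<integral>x. H (D n) x \<partial>\<rho>)))"
proof (rule antisym)
  let ?X = "SUP n. ennreal (u (D n) - (\<integral>x. H (D n) x \<partial>\<rho>))"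
  show "?X \<le> e2ennreal (lagrangian A \<rho> u)"
  proof (rule SUP_least)
    fix n
    have "ereal (u (D n) - (\<integral>x. H (D n) x \<partial>\<rho>)) \<le> lagrangian A \<rho> u"
      unfolding lagrangian_def by (rule SUP_upper[OF D(1)])
    from e2ennreal_mono[OF this]
    show "ennreal (u (D n) - (\<integral>x. H (D n) x \<partial>\<rho>)) \<le> e2ennreal (lagrangian A \<rho> u)"
      by (simp add: e2ennreal_ereal)
  qed
  have "lagrangian A \<rho> u \<le> enn2ereal ?X"
    unfolding lagrangian_def
  proof (rule SUP_least, rule ereal_le_epsilon2)
    fix f :: "'a \<Rightarrow> real" and e :: real assume f: "f \<in> C0" and "0 < e"
    obtain K where K: "0 \<le> K" "\<And>f g \<epsilon>. f \<in> C0 \<Longrightarrow> g \<in> C0 \<Longrightarrow> (\<And>x. \<bar>f x - g x\<bar> \<le> \<epsilon>) \<Longrightarrow> \<bar>u f - u g\<bar> \<le> K * \<epsilon>"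
      using C0_dual_lipschitz[OF u] by blast
    obtain B where B: "\<And>x. \<bar>f x\<bar> \<le> B" using bcontfun_bound[OF C0_bcontfun[OF f]] by metis
    \<comment> \<open>Taking \<epsilon> \<le> 1 below keeps the approximant \<open>D n\<close>
      within B + 1, where M is a Lipschitz constant of H.\<close>
    define M where "M = 2 * \<Lambda> * exp (2 * (B + 1))"
    have M: "0 \<le> M" using Lam0 by (simp add: M_def)
    define \<epsilon> where "\<epsilon> = min 1 (e / (K + M + 1))"
    have \<epsilon>: "0 < \<epsilon>" "\<epsilon> \<le> 1" "(K + M) * \<epsilon> \<le> e"
    proof -
      show "0 < \<epsilon>" "\<epsilon> \<le> 1" using \<open>0 < e\<close> K M by (auto simp: \<epsilon>_def)
      have "(K + M) * \<epsilon> \<le> (K + M + 1) * \<epsilon>" using \<open>0 < \<epsilon>\<close> by (intro mult_right_mono) auto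
      also have "\<dots> \<le> (K + M + 1) * (e / (K + M + 1))" using K M by (intro mult_left_mono) (auto simp: \<epsilon>_def)
      also have "\<dots> = e" using K M by simp
      finally show "(K + M) * \<epsilon> \<le> e" .
    qed
    obtain n where n: "\<And>x. \<bar>f x - D n x\<bar> \<le> \<epsilon>" using D(2) f \<epsilon>(1) by blast
    have B': "\<bar>f x\<bar> \<le> B + 1" "\<bar>D n x\<bar> \<le> B + 1" for x using B[of x] n[of x] \<epsilon>(2) by auto
    have 1: "\<bar>u f - u (D n)\<bar> \<le> K * \<epsilon>" by (rule K(2)[OF f D(1) n])
    have 2: "\<bar>(\<integral>x. H f x \<partial>\<rho>) - (\<integral>x. H (D n) x \<partial>\<rho>)\<bar> \<le> M * \<epsilon>"
      unfolding M_def
      by (intro integral_probs_diff_abs_le[OF \<rho>] integrable_bcontfun[OF \<rho>] C0_bcontfun H_C0 f D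
          H_lipschitz B' n)
    have "u f - (\<integral>x. H f x \<partial>\<rho>) \<le> (u (D n) - (\<integral>x. H (D n) x \<partial>\<rho>)) + e"
      using 1 2 \<epsilon>(3) by (simp add: algebra_simps abs_le_iff)
    then have "ereal (u f - (\<integral>x. H f x \<partial>\<rho>)) \<le> ereal (u (D n) - (\<integral>x. H (D n) x \<partial>\<rho>)) + ereal e" by simp
    also have "ereal (u (D n) - (\<integral>x. H (D n) x \<partial>\<rho>)) \<le> enn2ereal (ennreal (u (D n) - (\<integral>x. H (D n) x \<partial>\<rho>)))"
      by (cases "0 \<le> u (D n) - (\<integral>x. H (D n) x \<partial>\<rho>)")
         (simp_all add: enn2ereal_ennreal ennreal_neg zero_ennreal.rep_eq)
    also have "\<dots> \<le> enn2ereal ?X"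
      by (subst less_eq_ennreal.rep_eq[symmetric]) (rule SUP_upper, simp)
    finally show "ereal (u f - (\<integral>x. H f x \<partial>\<rho>)) \<le> enn2ereal ?X + ereal e" by (simp add: add_right_mono)
  qed
  from e2ennreal_mono[OF this] show "e2ennreal (lagrangian A \<rho> u) \<le> ?X" by simp
qed

end

section \<open>Comparison of the action with the supremum over partitions\<close>

context jump_path
begin

text \<open>J in the notation of the overview, kept apart from the relative entropy of the initial
  law, which is common to both sides.\<close>

definition partition_rate :: ereal where
  "partition_rate = (SUP (k, t) \<in> {(k::nat, t::nat \<Rightarrow> real). t 0 = 0 \<and> (\<forall>i<k. t i < t (Suc i))}.
              \<Sum>i=1..k. cond_rate P (t i - t (i - 1)) (\<nu> (t i)) (\<nu> (t (i - 1))))"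

lemma path_rate_eq: "path_rate P0 P \<nu> = relative_entropy (\<nu> 0) P0 + partition_rate"
  using nu by (simp add: path_rate_def partition_rate_def)

lemma partition_rate_majorant:
  assumes "partition_rate < \<infinity>"
  obtains m where "mono m" "\<And>x. 0 \<le> m x" "\<And>x. ereal (m x) \<le> partition_rate"
    "\<And>a b. 0 \<le> a \<Longrightarrow> a < b \<Longrightarrow> cond_rate P (b - a) (\<nu> b) (\<nu> a) \<le> ereal (m b - m a)"
proof -
  show thesis
    by (rule partition_sup_majorant[of "\<lambda>a b. cond_rate P (b - a) (\<nu> b) (\<nu> a)", folded partition_rate_def])
       (use assms in \<open>auto intro: cond_rate_nonneg that\<close>)
qed

lemma action_eq_SUP:
  assumes u: "is_velocity \<nu> u"
    and D: "\<And>n::nat. D n \<in> C0" "\<forall>f\<in>C0. \<forall>\<epsilon>>0. \<exists>n. \<forall>x. \<bar>f x - D n x\<bar> \<le> \<epsilon>"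
  shows "action A \<nu> u = enn2ereal (\<integral>\<^sup>+s. (SUP n. ennreal (lagr_at u (D n) s)) \<partial>lborel)"
proof -
  have "e2ennreal (lagrangian A (\<nu> s) (u s)) * indicator {0..} s = (SUP n. ennreal (lagr_at u (D n) s))" for s
  proof (cases "0 \<le> s")
    case True
    then have "u s \<in> C0_dual" using u by (simp add: is_velocity_def)
    from lagrangian_eq_SUP[where D = D, OF D this nu_probs[OF True]] True show ?thesis by (simp add: lagr_at_def)
  next
    case False then show ?thesis by (simp add: lagr_at_def)
  qed
  then show ?thesis by (simp add: action_def)
qed

lemma action_le_partition_rate:
  assumes u: "is_velocity \<nu> u" shows "action A \<nu> u \<le> partition_rate"
proof (cases "partition_rate < \<infinity>")
  case True
  obtain m where m: "mono m" "\<And>x. 0 \<le> m x" "\<And>x. ereal (m x) \<le> partition_rate"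
    "\<And>a b. 0 \<le> a \<Longrightarrow> a < b \<Longrightarrow> cond_rate P (b - a) (\<nu> b) (\<nu> a) \<le> ereal (m b - m a)"
    using partition_rate_majorant[OF True] by metis
  have "0 \<le> partition_rate" using order_trans[OF _ m(3)[of 0]] m(2)[of 0] by simp
  then obtain j where j: "partition_rate = ereal j" "0 \<le> j" using True by (cases partition_rate) auto
  have mj: "m x \<le> j" for x using m(3)[of x] by (simp add: j)
  obtain w where w: "stieltjes w" "\<And>x. 0 \<le> w x" "\<And>x. w x \<le> j"
    and w\<Phi>: "\<And>\<Phi> a b. \<lbrakk>\<And>x. continuous (at_right x) \<Phi>; \<And>a b. a < b \<Longrightarrow> \<Phi> b - \<Phi> a \<le> m b - m a; a < b\<rbrakk>
      \<Longrightarrow> \<Phi> b - \<Phi> a \<le> w b - w a"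
    using right_continuous_version[OF m(1,2) mj] by metis
  obtain D :: "nat \<Rightarrow> 'a \<Rightarrow> real" where D: "\<And>n. D n \<in> C0" "\<forall>f\<in>C0. \<forall>\<epsilon>>0. \<exists>n. \<forall>x. \<bar>f x - D n x\<bar> \<le> \<epsilon>"
    using C0_separable by metis
  have le: "(\<integral>\<^sup>+s\<in>B. ennreal (lagr_at u f s) \<partial>lborel) \<le> emeasure (interval_measure w) B"
    if f: "f \<in> C0" and B: "B \<in> sets borel" for f B
  proof -
    note int = lagr_at_integrable[OF u f] and neg = lagr_at_neg[OF u]
    let ?\<Phi> = "\<lambda>t. LBINT s:{0..t}. lagr_at u f s"
    have rc: "continuous (at_right x) ?\<Phi>" for x
      by (rule indefinite_integral_right_continuous[OF int neg])
    have incr: "?\<Phi> b - ?\<Phi> a = (LBINT s:{a<..b}. lagr_at u f s)" if "a < b" for a b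
      using that by (intro indefinite_integral_increment int neg) auto
    \<comment> \<open>Nothing accumulates before time 0 while m only increases, so clamping the left
      end at 0 preserves the inequality.\<close>
    have lem: "?\<Phi> b - ?\<Phi> a \<le> m b - m a" if "a < b" for a b
    proof -
      have eq: "?\<Phi> b - ?\<Phi> a = (LBINT s:{max 0 a<..max 0 b}. lagr_at u f s)"
        unfolding incr[OF that] by (rule set_integral_Ioc_max_0[OF int neg])
      show ?thesis
      proof (cases "b < 0")
        case True
        then show ?thesis unfolding eq using monoD[OF m(1), of a b] that by (simp add: set_lebesgue_integral_def)
      next
        case False
        have "(LBINT s:{max 0 a<..b}. lagr_at u f s) \<le> m b - m (max 0 a)"
          by (rule lagr_at_le_of_cond_rate[OF u m(1) m(4) f]) (use that False in auto)
        then show ?thesis unfolding eq using False monoD[OF m(1), of a "max 0 a"] by simp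
      qed
    qed
    show ?thesis
    proof (rule nn_integral_le_interval_measure[OF lagr_at_measurable[OF u f] int neg w(1) _ B])
      show "(LBINT s:{a<..b}. lagr_at u f s) \<le> w b - w a" if "a < b" for a b
        using w\<Phi>[OF rc lem that] incr[OF that] by simp
    qed
  qed
  have "(\<integral>\<^sup>+s. (SUP n. ennreal (lagr_at u (D n) s)) \<partial>lborel) \<le> emeasure (interval_measure w) UNIV"
    by (rule nn_integral_SUP_le) (use le D lagr_at_measurable[OF u] in auto)
  also have "\<dots> \<le> ennreal j" by (rule interval_measure_le_of_increments[OF w])
  finally have "enn2ereal (\<integral>\<^sup>+s. (SUP n. ennreal (lagr_at u (D n) s)) \<partial>lborel) \<le> enn2ereal (ennreal j)"
    by (simp add: less_eq_ennreal.rep_eq)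
  then show ?thesis unfolding action_eq_SUP[where D = D, OF u D] j by (simp add: enn2ereal_ennreal j)
qed simp

text \<open>The test function at time y is obtained by flowing f backward from the final time b. The
  semigroup law links two such times, and bounded rates make the flow Lipschitz in time.\<close>

lemma V_flow_bounds:
  assumes f: "f \<in> C0" and B: "\<And>x. \<bar>f x\<bar> \<le> B" and y: "y \<le> y'" "y' \<le> b"
  shows "V (b - y) f = V (y' - y) (V (b - y') f)" "\<bar>V (b - y) f x - V (b - y') f x\<bar> \<le> exp (4 * B) * (2 * \<Lambda>) * (y' - y)"
proof -
  have eq: "V (b - y) f x = V (y' - y) (V (b - y') f) x" for x
    using V_V[OF f, of "y' - y" "b - y'" x] y by simp
  then show "V (b - y) f = V (y' - y) (V (b - y') f)" by auto
  show "\<bar>V (b - y) f x - V (b - y') f x\<bar> \<le> exp (4 * B) * (2 * \<Lambda>) * (y' - y)"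
    unfolding eq
    by (rule V_increment_abs_le) (use y in \<open>auto intro!: V_C0 V_bound f B C0_bcontfun\<close>)
qed

text \<open>On each short interval the test function is frozen at its right-end value g(y). So l has
  to dominate \<open>lagr_at\<close> for one f at a time, and the exceptional null set may depend on
  f.\<close>

lemma integral_increment_le_of_majorant:
  assumes u: "is_velocity \<nu> u"
    and l: "\<And>a b. set_integrable lborel {a..b} l" "\<And>s. s < 0 \<Longrightarrow> l s = 0"
      "\<And>f. f \<in> C0 \<Longrightarrow> AE s in lborel. lagr_at u f s \<le> l s"
    and f: "f \<in> C0" and ab: "0 \<le> a" "a \<le> b"
  shows "(\<integral>x. f x \<partial>\<nu> b) - (\<integral>x. V (b - a) f x \<partial>\<nu> a) \<le> (LBINT s:{a<..b}. l s)"
proof (rule field_le_epsilon)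
  fix e :: real assume "0 < e"
  define \<eta> where "\<eta> = e / (b - a + 1)"
  have \<eta>: "0 < \<eta>" "\<eta> * (b - a) \<le> e" using \<open>0 < e\<close> ab by (auto simp: \<eta>_def field_simps)
  obtain B where B: "\<And>x. \<bar>f x\<bar> \<le> B" using bcontfun_bound[OF C0_bcontfun[OF f]] by metis
  define g where "g y = V (b - y) f" for y
  have g: "g y \<in> C0" if "y \<le> b" for y unfolding g_def using that by (intro V_C0 f) auto
  have gB: "\<bar>g y x\<bar> \<le> B" if "y \<le> b" for y x unfolding g_def using that by (intro V_bound C0_bcontfun f B) auto
  have gg: "g y = V (y' - y) (g y')" if "y \<le> y'" "y' \<le> b" for y y'
    unfolding g_def by (rule V_flow_bounds(1)[OF f B that])
  have lip: "\<bar>g y x - g y' x\<bar> \<le> exp (4 * B) * (2 * \<Lambda>) * \<bar>y - y'\<bar>" if "y \<le> b" "y' \<le> b" for y y' x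
    using V_flow_bounds(2)[OF f B, of y y' b x] V_flow_bounds(2)[OF f B, of y' y b x] that
    unfolding g_def by (cases "y \<le> y'") (auto simp: abs_minus_commute)
  obtain \<delta> where \<delta>: "0 < \<delta>" "\<And>x y. \<lbrakk>a \<le> x; x < y; y \<le> b; y - x < \<delta>\<rbrakk> \<Longrightarrow>
    \<bar>(\<integral>z. V (y - x) (g y) z \<partial>\<nu> x) - (\<integral>z. g y z \<partial>\<nu> x) - (LBINT s:{x<..y}. \<integral>z. H (g y) z \<partial>\<nu> s)\<bar> \<le> \<eta> * (y - x)"
    using V_increment_uniform[of a b g B "exp (4 * B) * (2 * \<Lambda>)" \<eta>] g gB lip ab(1) \<eta>(1) by auto
  let ?\<Psi> = "\<lambda>t. LBINT s:{0..t}. l s"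
  let ?\<Phi> = "\<lambda>t. \<integral>x. g t x \<partial>\<nu> t"
  have "(?\<Phi> b - ?\<Psi> b) - (?\<Phi> a - ?\<Psi> a) \<le> \<eta> * (b - a)"
  proof (rule increment_le_if_locally[OF \<delta>(1) ab(2)])
    fix x y assume xy: "a \<le> x" "x < y" "y \<le> b" "y - x < \<delta>"
    have x0: "0 \<le> x" using xy ab by simp
    have gy: "g y \<in> C0" by (rule g[OF xy(3)])
    \<comment> \<open>The increment of \<open>?\<Phi>\<close> thereby becomes \<langle>g(y),
      \<nu>(y)\<rangle> - \<langle>V(y - x)g(y), \<nu>(x)\<rangle>: a change of measure governed by
      the velocity, and a change of function governed by \<open>V_increment_uniform\<close>.\<close>
    have gx: "g x = V (y - x) (g y)" by (rule gg) (use xy in auto)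
    have 5: "(\<integral>z. g y z \<partial>\<nu> y) - (\<integral>z. g y z \<partial>\<nu> x)
        = (LBINT s:{x<..y}. lagr_at u (g y) s) + (LBINT s:{x<..y}. \<integral>z. H (g y) z \<partial>\<nu> s)"
      using lagr_at_increment[OF u gy x0, of y] xy by simp
    have 6: "(LBINT s:{x<..y}. lagr_at u (g y) s) \<le> (LBINT s:{x<..y}. l s)"
      unfolding set_lebesgue_integral_def
    proof (rule integral_mono_AE)
      show "integrable lborel (\<lambda>s. indicator {x<..y} s *\<^sub>R lagr_at u (g y) s)"
        "integrable lborel (\<lambda>s. indicator {x<..y} s *\<^sub>R l s)"
        using set_integrable_Ioc[OF lagr_at_integrable[OF u gy]] set_integrable_Ioc[OF l(1)]
        by (auto simp: set_integrable_def)
      show "AE s in lborel. indicator {x<..y} s *\<^sub>R lagr_at u (g y) s \<le> indicator {x<..y} s *\<^sub>R l s"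
        using l(3)[OF gy] by eventually_elim (auto simp: indicator_def)
    qed
    have 7: "?\<Psi> y - ?\<Psi> x = (LBINT s:{x<..y}. l s)"
      using xy by (intro indefinite_integral_increment l) auto
    show "(?\<Phi> y - ?\<Psi> y) - (?\<Phi> x - ?\<Psi> x) \<le> \<eta> * (y - x)"
      using 5 6 7 \<delta>(2)[OF xy] unfolding gx by linarith
  qed
  moreover have "?\<Psi> b - ?\<Psi> a = (LBINT s:{a<..b}. l s)"
    using ab by (intro indefinite_integral_increment l) auto
  moreover have "g b = f" by (auto simp: g_def V_0 C0_bcontfun f)
  ultimately show "(\<integral>x. f x \<partial>\<nu> b) - (\<integral>x. V (b - a) f x \<partial>\<nu> a) \<le> (LBINT s:{a<..b}. l s) + e"
    using \<eta>(2) by (simp add: g_def)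
qed

text \<open>f times the cutoffs converges to f pointwise and boundedly. Dominated convergence under
  \<open>P t x\<close> yields pointwise convergence of V, and under \<rho> and \<rho>' convergence
  of both terms.\<close>

lemma cond_rate_le_C0:
  assumes lc: "locally_compact_space (euclidean :: 'a topology)"
    and C0: "\<And>f. f \<in> C0 \<Longrightarrow> (\<integral>x. f x \<partial>\<rho>') - (\<integral>x. V t f x \<partial>\<rho>) \<le> c"
    and \<rho>: "\<rho> \<in> probs" "\<rho>' \<in> probs" and t: "0 \<le> t"
  shows "cond_rate P t \<rho>' \<rho> \<le> ereal c"
  unfolding cond_rate_def
proof (rule SUP_least)
  fix f :: "'a \<Rightarrow> real" assume f: "f \<in> bcontfun"
  obtain B where B: "\<And>x. \<bar>f x\<bar> \<le> B" using bcontfun_bound[OF f] by metis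
  obtain cut :: "nat \<Rightarrow> 'a \<Rightarrow> real" where cut: "\<And>n. cut n \<in> C0" "\<And>n x. 0 \<le> cut n x" "\<And>n x. cut n x \<le> 1"
    "\<And>x. (\<lambda>n. cut n x) \<longlonglongrightarrow> 1" using C0_cutoffs[OF lc] by metis
  define fn where "fn n x = f x * cut n x" for n x
  have fn: "fn n \<in> C0" for n unfolding fn_def[abs_def] by (rule C0_mult_bcontfun[OF cut(1) f])
  have fnB: "\<bar>fn n x\<bar> \<le> B" for n x
  proof -
    have "\<bar>fn n x\<bar> \<le> \<bar>f x\<bar> * 1" unfolding fn_def abs_mult using cut(2,3)[of n x] by (intro mult_left_mono) auto
    then show ?thesis using B[of x] by simp
  qed
  have fn_lim: "(\<lambda>n. fn n x) \<longlonglongrightarrow> f x" for x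
    unfolding fn_def using tendsto_mult[OF tendsto_const cut(4)[of x], of "f x"] by simp
  have meas: "(h :: 'a \<Rightarrow> real) \<in> borel_measurable \<sigma>" if "h \<in> borel_measurable borel" "\<sigma> \<in> probs" for h \<sigma>
    using that(1) measurable_cong_sets[OF probsD(2)[OF that(2)] refl] by blast
  have dom: "(\<lambda>n. \<integral>x. h n x \<partial>\<sigma>) \<longlonglongrightarrow> (\<integral>x. h' x \<partial>\<sigma>)"
    if "\<sigma> \<in> probs" "\<And>n. h n \<in> borel_measurable borel" "h' \<in> borel_measurable borel"
      "\<And>n x. \<bar>h n x\<bar> \<le> b" "\<And>x. (\<lambda>n. h n x) \<longlonglongrightarrow> h' x" for \<sigma> h b and h' :: "'a \<Rightarrow> real"
  proof -
    interpret prob_space \<sigma> using probsD(1)[OF that(1)] .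
    show ?thesis
    proof (rule integral_dominated_convergence[where w = "\<lambda>_. b"])
      show "h' \<in> borel_measurable \<sigma>" by (rule meas[OF that(3,1)])
      show "h n \<in> borel_measurable \<sigma>" for n by (rule meas[OF that(2,1)])
      show "AE x in \<sigma>. (\<lambda>n. h n x) \<longlonglongrightarrow> h' x" using that(5) by simp
      show "AE x in \<sigma>. norm (h n x) \<le> b" for n using that(4) by simp
    qed simp
  qed
  have expB: "\<bar>exp (fn n x)\<bar> \<le> exp B" for n x using fnB[of n x] by simp
  have S_lim: "(\<lambda>n. S t (\<lambda>y. exp (fn n y)) x) \<longlonglongrightarrow> S t (\<lambda>y. exp (f y)) x" for x
    unfolding semigroup_op_def
    by (rule dom[OF P_probs[OF t] _ _ expB])
       (intro bcontfun_measurable exp_bcontfun f C0_bcontfun[OF fn] tendsto_exp fn_lim)+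
  have V_lim: "(\<lambda>n. V t (fn n) x) \<longlonglongrightarrow> V t f x" for x
    unfolding log_semigroup_def
  proof (rule tendsto_ln[OF S_lim])
    have "0 < exp (V t f x)" by simp
    then show "S t (\<lambda>y. exp (f y)) x \<noteq> 0" by (simp add: exp_V[OF f t])
  qed
  have "(\<lambda>n. (\<integral>x. fn n x \<partial>\<rho>') - (\<integral>x. V t (fn n) x \<partial>\<rho>)) \<longlonglongrightarrow> (\<integral>x. f x \<partial>\<rho>') - (\<integral>x. V t f x \<partial>\<rho>)"
  proof (rule tendsto_diff)
    show "(\<lambda>n. \<integral>x. fn n x \<partial>\<rho>') \<longlonglongrightarrow> (\<integral>x. f x \<partial>\<rho>')"
      by (rule dom[OF \<rho>(2) _ _ fnB fn_lim]) (auto intro!: bcontfun_measurable f C0_bcontfun fn)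
    have Vm: "V t f \<in> borel_measurable borel"
      unfolding log_semigroup_def[abs_def]
      by (intro borel_measurable_ln S_measurable t exp_bcontfun f)
    show "(\<lambda>n. \<integral>x. V t (fn n) x \<partial>\<rho>) \<longlonglongrightarrow> (\<integral>x. V t f x \<partial>\<rho>)"
      by (rule dom[OF \<rho>(1) _ Vm V_bound[OF C0_bcontfun[OF fn] fnB t] V_lim])
         (intro bcontfun_measurable C0_bcontfun V_C0 fn t)
  qed
  then have "(\<integral>x. f x \<partial>\<rho>') - (\<integral>x. V t f x \<partial>\<rho>) \<le> c"
    by (rule LIMSEQ_le_const2) (use C0[OF fn] in auto)
  then show "ereal ((\<integral>x. f x \<partial>\<rho>') - (\<integral>x. V t f x \<partial>\<rho>)) \<le> ereal c" by simp
qed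

lemma partition_rate_le_action:
  assumes lc: "locally_compact_space (euclidean :: 'a topology)" and u: "is_velocity \<nu> u"
  shows "partition_rate \<le> action A \<nu> u"
proof -
  obtain D :: "nat \<Rightarrow> 'a \<Rightarrow> real" where D: "\<And>n. D n \<in> C0" "\<forall>f\<in>C0. \<forall>\<epsilon>>0. \<exists>n. \<forall>x. \<bar>f x - D n x\<bar> \<le> \<epsilon>"
    using C0_separable by metis
  define LL where "LL s = (SUP n. ennreal (lagr_at u (D n) s))" for s
  have LLm[measurable]: "LL \<in> borel_measurable borel"
    unfolding LL_def[abs_def] using lagr_at_measurable[OF u D(1)] by measurable
  have act: "action A \<nu> u = enn2ereal (\<integral>\<^sup>+s. LL s \<partial>lborel)"
    unfolding LL_def by (rule action_eq_SUP[where D = D, OF u D])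
  show ?thesis
  proof (cases "(\<integral>\<^sup>+s. LL s \<partial>lborel) = \<infinity>")
    case True then show ?thesis by (simp add: act)
  next
    case False
    \<comment> \<open>Finite action makes \<open>LL\<close> finite almost everywhere. On the
      exceptional null set \<open>enn2real\<close> returns 0, so the domination by l can be claimed
      only almost everywhere.\<close>
    define l where "l s = enn2real (LL s)" for s
    have fin: "AE s in lborel. LL s \<noteq> \<infinity>"
      using False by (intro nn_integral_PInf_AE) auto
    have l_nn: "(\<integral>\<^sup>+s. ennreal (l s) \<partial>lborel) = (\<integral>\<^sup>+s. LL s \<partial>lborel)"
      unfolding l_def using fin by (intro nn_integral_cong_AE) (auto simp: less_top)
    have l0: "0 \<le> l s" for s by (simp add: l_def)
    have lm[measurable]: "l \<in> borel_measurable borel" unfolding l_def[abs_def] by measurable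
    have l_int: "integrable lborel l"
      by (rule integrableI_nonneg) (use l0 l_nn False in \<open>auto simp: less_top\<close>)
    have l_set: "set_integrable lborel {a..b} l" for a b
      unfolding set_integrable_def using l_int by (intro integrable_mult_indicator) auto
    have l_neg: "l s = 0" if "s < 0" for s using that by (simp add: l_def LL_def lagr_at_def)
    have l_ge: "AE s in lborel. lagr_at u f s \<le> l s" if f: "f \<in> C0" for f
      using fin
    proof eventually_elim
      case (elim s)
      have "ennreal (lagr_at u f s) \<le> LL s"
      proof (cases "0 \<le> s")
        case True
        then have us: "u s \<in> C0_dual" using u by (simp add: is_velocity_def)
        have "ereal (u s f - (\<integral>x. H f x \<partial>\<nu> s)) \<le> lagrangian A (\<nu> s) (u s)"
          unfolding lagrangian_def by (rule SUP_upper[OF f])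
        then have "ennreal (u s f - (\<integral>x. H f x \<partial>\<nu> s)) \<le> e2ennreal (lagrangian A (\<nu> s) (u s))"
          by (auto dest: e2ennreal_mono simp: e2ennreal_ereal)
        also have "\<dots> = LL s"
          using lagrangian_eq_SUP[where D = D, OF D us nu_probs[OF True]] True by (simp add: LL_def lagr_at_def)
        finally show ?thesis using True by (simp add: lagr_at_def)
      qed (simp add: lagr_at_def)
      then have "enn2real (ennreal (lagr_at u f s)) \<le> l s"
        unfolding l_def using elim by (intro enn2real_mono) (auto simp: less_top)
      then show ?case using l0[of s] by (cases "0 \<le> lagr_at u f s") auto
    qed
    let ?\<Psi> = "\<lambda>t. LBINT s:{0..t}. l s"
    have cr: "cond_rate P (b - a) (\<nu> b) (\<nu> a) \<le> ereal (?\<Psi> b - ?\<Psi> a)" if "0 \<le> a" "a < b" for a b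
    proof (rule cond_rate_le_C0[OF lc])
      fix f :: "'a \<Rightarrow> real" assume f: "f \<in> C0"
      have "?\<Psi> b - ?\<Psi> a = (LBINT s:{a<..b}. l s)"
        using that by (intro indefinite_integral_increment l_set l_neg) auto
      then show "(\<integral>x. f x \<partial>\<nu> b) - (\<integral>x. V (b - a) f x \<partial>\<nu> a) \<le> ?\<Psi> b - ?\<Psi> a"
        using integral_increment_le_of_majorant[OF u l_set l_neg l_ge f that(1), of b] that by simp
    qed (use that in \<open>auto intro: nu_probs\<close>)
    have \<Psi>0: "0 \<le> ?\<Psi> t" for t
      unfolding set_lebesgue_integral_def using l0 by (intro integral_nonneg_AE) auto
    have \<Psi>le: "?\<Psi> t \<le> integral\<^sup>L lborel l" for t
      unfolding set_lebesgue_integral_def using l0 l_int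
      by (intro integral_mono integrable_mult_indicator) (auto simp: indicator_def)
    have "partition_rate \<le> ereal (integral\<^sup>L lborel l)"
      unfolding partition_rate_def
    proof (rule SUP_least, clarify)
      fix k :: nat and t :: "nat \<Rightarrow> real" assume t: "t 0 = 0" "\<forall>i<k. t i < t (Suc i)"
      have "j \<le> k \<Longrightarrow> 0 \<le> t j \<and> (\<Sum>i=1..j. cond_rate P (t i - t (i - 1)) (\<nu> (t i)) (\<nu> (t (i - 1)))) \<le> ereal (?\<Psi> (t j))" for j
      proof (induction j)
        case 0 then show ?case using t \<Psi>0[of 0] by (simp add: zero_ereal_def)
      next
        case (Suc j)
        then have IH: "0 \<le> t j" "(\<Sum>i=1..j. cond_rate P (t i - t (i - 1)) (\<nu> (t i)) (\<nu> (t (i - 1)))) \<le> ereal (?\<Psi> (t j))"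
          and lt: "t j < t (Suc j)" using t(2) by auto
        have "(\<Sum>i=1..Suc j. cond_rate P (t i - t (i - 1)) (\<nu> (t i)) (\<nu> (t (i - 1))))
            \<le> ereal (?\<Psi> (t j)) + ereal (?\<Psi> (t (Suc j)) - ?\<Psi> (t j))"
          using add_mono[OF IH(2) cr[OF IH(1) lt]] by simp
        then show ?case using IH lt by simp
      qed
      from this[of k] \<Psi>le[of "t k"]
      show "(\<Sum>i=1..k. cond_rate P (t i - t (i - 1)) (\<nu> (t i)) (\<nu> (t (i - 1)))) \<le> ereal (integral\<^sup>L lborel l)"
        by (auto intro: order_trans)
    qed
    also have "ereal (integral\<^sup>L lborel l) = action A \<nu> u"
      unfolding act l_nn[symmetric] nn_integral_eq_integral[OF l_int AE_I2[OF l0]]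
      using l0 by (simp add: enn2ereal_ennreal)
    finally show ?thesis .
  qed
qed

end

section \<open>Existence of a velocity\<close>

text \<open>The density g1 - g2 is compared with the zero measure: nonpositive integrals over all
  intervals leave no mass for its positive part.\<close>

lemma AE_le_of_set_integral_le:
  fixes g1 g2 :: "real \<Rightarrow> real"
  assumes m: "g1 \<in> borel_measurable borel" "g2 \<in> borel_measurable borel"
    and int: "\<And>a b. set_integrable lborel {a..b} g1" "\<And>a b. set_integrable lborel {a..b} g2"
    and neg: "\<And>s. s < 0 \<Longrightarrow> g1 s = 0" "\<And>s. s < 0 \<Longrightarrow> g2 s = 0"
    and le: "\<And>a b. a < b \<Longrightarrow> (LBINT s:{a<..b}. g1 s) \<le> (LBINT s:{a<..b}. g2 s)"
  shows "AE s in lborel. g1 s \<le> g2 s"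
proof -
  let ?g = "\<lambda>s. g1 s - g2 s"
  have gm[measurable]: "?g \<in> borel_measurable borel" using m by measurable
  have gint: "set_integrable lborel {a..b} ?g" for a b by (intro set_integral_diff int)
  have gneg: "?g s = 0" if "s < 0" for s using neg that by simp
  have st0: "stieltjes (\<lambda>_. 0)" by (simp add: stieltjes_def)
  have "(\<integral>\<^sup>+s\<in>UNIV. ennreal (?g s) \<partial>lborel) \<le> emeasure (interval_measure (\<lambda>_. 0)) UNIV"
  proof (rule nn_integral_le_interval_measure[OF gm gint gneg st0])
    fix a b :: real assume ab: "a < b"
    have "(LBINT s:{a<..b}. ?g s) = (LBINT s:{a<..b}. g1 s) - (LBINT s:{a<..b}. g2 s)"
      by (intro set_integral_diff set_integrable_Ioc int)
    then show "(LBINT s:{a<..b}. ?g s) \<le> 0 - 0" using le[OF ab] by simp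
  qed auto
  also have "\<dots> \<le> ennreal 0" by (rule interval_measure_le_of_increments[OF st0]) auto
  finally have "(\<integral>\<^sup>+s. ennreal (?g s) \<partial>lborel) = 0" by simp
  then have "AE s in lborel. ennreal (?g s) = 0" by (subst (asm) nn_integral_0_iff_AE) auto
  then show ?thesis by eventually_elim (simp add: ennreal_eq_0_iff)
qed

text \<open>Lebesgue measure has a density p with respect to its sum Q with the measure of w. It
  gives no mass to Z = {p = 0}, and off Z every Lebesgue null set is null for Q. Hence Z carries the
  singular part, and h0 is the density of the rest.\<close>

lemma lebesgue_decomposition_interval_measure:
  assumes w: "stieltjes w"
  obtains Z h0 where "Z \<in> sets borel" "emeasure lborel Z = 0" "h0 \<in> borel_measurable borel"
    "\<And>B. B \<in> sets borel \<Longrightarrow> emeasure (interval_measure w) (B - Z) = (\<integral>\<^sup>+s\<in>B. h0 s \<partial>lborel)"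
proof -
  let ?N = "interval_measure w"
  define Q where "Q = interval_measure (\<lambda>t. w t + t)"
  have [simp]: "sets Q = sets borel" "space Q = UNIV" by (simp_all add: Q_def)
  have Q: "emeasure Q B = emeasure ?N B + emeasure lborel B" if "B \<in> sets borel" for B
    unfolding Q_def lborel_eq_real by (rule emeasure_stieltjes_add[OF w stieltjes_id that])
  interpret Q: sigma_finite_measure Q
    unfolding Q_def using stieltjes_add[OF w stieltjes_id]
    by (intro sigma_finite_interval_measure) (auto simp: stieltjes_def)
  have "absolutely_continuous Q lborel"
    unfolding absolutely_continuous_def
  proof
    fix B assume "B \<in> null_sets Q"
    then have "B \<in> sets borel" "emeasure Q B = 0" by auto
    then show "B \<in> null_sets lborel" using Q[of B] by (auto simp: null_sets_def)
  qed
  then obtain p where p: "p \<in> borel_measurable Q" "density Q p = lborel"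
    using Q.Radon_Nikodym[of lborel] by auto
  have "borel_measurable Q = (borel_measurable borel :: (real \<Rightarrow> ennreal) set)"
    by (rule measurable_cong_sets) auto
  then have pm[measurable]: "p \<in> borel_measurable borel" using p(1) by simp
  define Z where "Z = {s. p s = 0}"
  have Z[measurable]: "Z \<in> sets borel" unfolding Z_def by measurable
  have lb: "emeasure lborel B = (\<integral>\<^sup>+s\<in>B. p s \<partial>Q)" if "B \<in> sets borel" for B
    using that p(1) by (subst p(2)[symmetric]) (simp add: emeasure_density)
  have Z0: "emeasure lborel Z = 0"
  proof -
    have "emeasure lborel Z = (\<integral>\<^sup>+s. 0 \<partial>Q)"
      unfolding lb[OF Z] by (rule nn_integral_cong) (auto simp: Z_def indicator_def)
    then show ?thesis by simp
  qed
  have null: "emeasure ?N (B - Z) = 0" if "B \<in> sets borel" "emeasure lborel B = 0" for B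
  proof -
    have BZ: "B - Z \<in> sets borel" using that(1) by measurable
    have "emeasure lborel (B - Z) \<le> emeasure lborel B" using that(1) by (intro emeasure_mono) auto
    then have "(\<integral>\<^sup>+s\<in>B - Z. p s \<partial>Q) = 0" using lb[OF BZ] that(2) by simp
    moreover have "(\<lambda>s. p s * indicator (B - Z) s) \<in> borel_measurable Q"
      using p(1) BZ by (intro borel_measurable_times_ennreal borel_measurable_indicator) simp_all
    ultimately have "AE s in Q. p s * indicator (B - Z) s = 0" by (subst (asm) nn_integral_0_iff_AE) auto
    then have "AE s in Q. s \<notin> B - Z" by eventually_elim (auto simp: Z_def indicator_def)
    then have "emeasure Q (B - Z) = 0"
      using BZ AE_iff_null_sets[of "B - Z" Q] by (auto intro: null_setsD1)
    then show ?thesis using Q[OF BZ] by simp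
  qed
  define N' where "N' = density ?N (indicator (- Z))"
  have N': "emeasure N' B = emeasure ?N (B - Z)" if "B \<in> sets borel" for B
  proof -
    have "emeasure N' B = (\<integral>\<^sup>+s. indicator (- Z) s * indicator B s \<partial>?N)"
      unfolding N'_def by (rule emeasure_density) (use that Z in auto)
    also have "\<dots> = (\<integral>\<^sup>+s. indicator (B - Z) s \<partial>?N)"
      by (rule nn_integral_cong) (auto simp: indicator_def)
    also have "\<dots> = emeasure ?N (B - Z)" by (rule nn_integral_indicator) (use that Z in auto)
    finally show ?thesis .
  qed
  have "absolutely_continuous lborel N'"
    unfolding absolutely_continuous_def
  proof
    fix B assume "B \<in> null_sets (lborel :: real measure)"
    then have "B \<in> sets borel" "emeasure lborel B = 0" by auto
    then show "B \<in> null_sets N'" using N'[of B] null[of B] by (auto simp: null_sets_def N'_def)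
  qed
  then obtain h0 where h0: "h0 \<in> borel_measurable lborel" "density lborel h0 = N'"
    using sigma_finite_measure.Radon_Nikodym[OF sigma_finite_lborel, of N'] by (auto simp: N'_def)
  show ?thesis
  proof (rule that[OF Z Z0])
    show "h0 \<in> borel_measurable borel" using h0(1) by simp
    show "emeasure ?N (B - Z) = (\<integral>\<^sup>+s\<in>B. h0 s \<partial>lborel)" if "B \<in> sets borel" for B
      using N'[OF that] h0(1) that unfolding h0(2)[symmetric] by (simp add: emeasure_density)
  qed
qed

text \<open>For every n the measure of w dominates n dG - C n ds. On a null set this leaves dG \<le>
  dw/n for all n; elsewhere n = 1 bounds dG by the absolutely continuous part of dw plus C 1 ds.
  Both the null set and the bound come from w alone, so one h serves all of \<G>.\<close>

lemma superlinear_increments_density: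
  fixes \<G> :: "(real \<Rightarrow> real) set" and m :: "real \<Rightarrow> real" and C :: "nat \<Rightarrow> real"
  assumes m: "mono m" "\<And>x. 0 \<le> m x" "\<And>x. m x \<le> j"
    and C: "\<And>n. 0 \<le> C n"
    and uminus: "\<And>G. G \<in> \<G> \<Longrightarrow> (\<lambda>t. - G t) \<in> \<G>"
    and cont: "\<And>G x. G \<in> \<G> \<Longrightarrow> continuous (at_right x) G"
    and incr: "\<And>G n a b. G \<in> \<G> \<Longrightarrow> a < b \<Longrightarrow> real n * (G b - G a) \<le> m b - m a + C n * (b - a)"
  obtains h where "h \<in> borel_measurable borel" "\<And>s. 0 \<le> h s" "\<And>a b. set_integrable lborel {a..b} h"
    "\<And>G a b. G \<in> \<G> \<Longrightarrow> a < b \<Longrightarrow> G b - G a \<le> (LBINT s:{a<..b}. h s)"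
proof -
  obtain w where sw: "stieltjes w" and w: "\<And>x. 0 \<le> w x" "\<And>x. w x \<le> j"
    and w\<Phi>: "\<And>\<Phi> a b. \<lbrakk>\<And>x. continuous (at_right x) \<Phi>; \<And>a b. a < b \<Longrightarrow> \<Phi> b - \<Phi> a \<le> m b - m a; a < b\<rbrakk>
      \<Longrightarrow> \<Phi> b - \<Phi> a \<le> w b - w a"
    using right_continuous_version[OF m] by metis
  have wincr: "real n * (G b - G a) \<le> w b - w a + C n * (b - a)" if "G \<in> \<G>" "a < b" for G n a b
  proof -
    have "(real n * G b - C n * b) - (real n * G a - C n * a) \<le> w b - w a"
    proof (rule w\<Phi>[OF _ _ that(2)])
      show "continuous (at_right x) (\<lambda>t. real n * G t - C n * t)" for x
        by (intro continuous_intros cont that)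
      show "(real n * G y - C n * y) - (real n * G x - C n * x) \<le> m y - m x" if "x < y" for x y
        using incr[OF \<open>G \<in> \<G>\<close> that, of n] by (simp add: algebra_simps)
    qed
    then show ?thesis by (simp add: algebra_simps)
  qed
  have wc: "continuous (at_right x) w" for x using sw by (simp add: stieltjes_def)
  let ?N = "interval_measure w"
  have N_fin: "emeasure ?N B \<le> ennreal j" for B
  proof -
    have "emeasure ?N B \<le> emeasure ?N (space ?N)" by (rule emeasure_space)
    also have "\<dots> \<le> ennreal j" using interval_measure_le_of_increments[OF sw w] by simp
    finally show ?thesis .
  qed
  obtain Z h0 where Z[measurable]: "Z \<in> sets borel" and Z0: "emeasure lborel Z = 0"
    and h0[measurable]: "h0 \<in> borel_measurable borel"
    and NZ: "\<And>B. B \<in> sets borel \<Longrightarrow> emeasure ?N (B - Z) = (\<integral>\<^sup>+s\<in>B. h0 s \<partial>lborel)"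
    using lebesgue_decomposition_interval_measure[OF sw] by metis
  \<comment> \<open>The absolutely continuous part of w plus the constant of the case n = 1, which
    is the case applied off Z.\<close>
  define h where "h s = enn2real (h0 s) + C 1" for s
  have hm[measurable]: "h \<in> borel_measurable borel" unfolding h_def[abs_def] by measurable
  have h_nonneg: "0 \<le> h s" for s using C by (simp add: h_def)
  have h0_fin: "(\<integral>\<^sup>+s. h0 s \<partial>lborel) < \<infinity>"
    using NZ[of UNIV] N_fin[of "UNIV - Z"] by (auto simp: top_unique less_top[symmetric] intro: le_less_trans)
  have h0_AE: "AE s in lborel. h0 s \<noteq> \<infinity>" by (rule nn_integral_PInf_AE) (use h0_fin in auto)
  have h0_int: "integrable lborel (\<lambda>s. enn2real (h0 s))"
  proof (rule integrableI_nonneg)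
    have "(\<integral>\<^sup>+s. ennreal (enn2real (h0 s)) \<partial>lborel) = (\<integral>\<^sup>+s. h0 s \<partial>lborel)"
      using h0_AE by (intro nn_integral_cong_AE) (auto simp: less_top)
    then show "(\<integral>\<^sup>+s. ennreal (enn2real (h0 s)) \<partial>lborel) < \<infinity>" using h0_fin by simp
  qed auto
  have h0_set: "set_integrable lborel B (\<lambda>s. enn2real (h0 s))" if "B \<in> sets borel" for B
    unfolding set_integrable_def using that h0_int by (intro integrable_mult_indicator) auto
  have h_int: "set_integrable lborel {a..b} h" for a b
    unfolding h_def[abs_def]
    by (intro set_integral_add h0_set borel_integrable_atLeastAtMost' continuous_on_const) auto
  have h_val: "(LBINT s:{a<..b}. h s) = measure ?N ({a<..b} - Z) + C 1 * (b - a)" if "a < b" for a b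
  proof -
    have "(LBINT s:{a<..b}. h s) = (LBINT s:{a<..b}. enn2real (h0 s)) + (LBINT s:{a<..b}. C 1)"
      unfolding h_def
      by (intro set_integral_add h0_set set_integrable_Ioc borel_integrable_atLeastAtMost' continuous_on_const) auto
    also have "(LBINT s:{a<..b}. enn2real (h0 s)) = measure ?N ({a<..b} - Z)"
    proof -
      have "(LBINT s:{a<..b}. enn2real (h0 s)) = enn2real (\<integral>\<^sup>+s. ennreal (indicator {a<..b} s *\<^sub>R enn2real (h0 s)) \<partial>lborel)"
        unfolding set_lebesgue_integral_def by (rule integral_eq_nn_integral) auto
      also have "(\<integral>\<^sup>+s. ennreal (indicator {a<..b} s *\<^sub>R enn2real (h0 s)) \<partial>lborel) = (\<integral>\<^sup>+s\<in>{a<..b}. h0 s \<partial>lborel)"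
        using h0_AE by (intro nn_integral_cong_AE) (auto simp: less_top indicator_def elim!: eventually_mono)
      finally show ?thesis using NZ[of "{a<..b}"] by (simp add: measure_def)
    qed
    finally show ?thesis using set_integral_Ioc_const[of a b "C 1"] that by simp
  qed
  have main: "G b - G a \<le> (LBINT s:{a<..b}. h s)" if G: "G \<in> \<G>" and ab: "a < b" for G a b
  proof -
    let ?W = "\<lambda>n t. w t + C n * t"
    have W: "stieltjes (?W n)" for n
      by (intro stieltjes_add stieltjes_cmult stieltjes_id C sw)
    have WG: "stieltjes (\<lambda>t. ?W n t - real n * G t)" for n
      unfolding stieltjes_def
    proof (intro conjI allI impI)
      show "?W n x - real n * G x \<le> ?W n y - real n * G y" if "x \<le> y" for x y
        using wincr[OF G, of x y n] that by (cases "x = y") (auto simp: algebra_simps)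
    qed (intro continuous_intros cont[OF G] wc)
    \<comment> \<open>Closure of \<G> under negation enters here: -G grows no faster than
      \<open>?W 1\<close>, so adding \<open>?W 1\<close> makes the signed function G
      increasing.\<close>
    have WGp: "stieltjes (\<lambda>t. ?W 1 t + G t)"
      unfolding stieltjes_def
    proof (intro conjI allI impI)
      show "?W 1 x + G x \<le> ?W 1 y + G y" if "x \<le> y" for x y
        using wincr[OF uminus[OF G], of x y 1] that by (cases "x = y") (auto simp: algebra_simps)
    qed (intro continuous_intros cont[OF G] wc)
    let ?P = "interval_measure (\<lambda>t. ?W 1 t + G t)"
    let ?I = "interval_measure (?W 1)"
    let ?R = "\<lambda>n. interval_measure (\<lambda>t. ?W n t - real n * G t)"
    have W_split: "emeasure (interval_measure (?W n)) B = emeasure ?N B + ennreal (C n) * emeasure lborel B"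
      if "B \<in> sets borel" for B n
      unfolding lborel_eq_real emeasure_stieltjes_cmult[OF stieltjes_id C, symmetric]
      by (rule emeasure_stieltjes_add[OF sw stieltjes_cmult[OF stieltjes_id C] that])
    \<comment> \<open>In n (W 1 + G) + (W n - n G) = n W 1 + W n the signed function cancels, and
      all four terms have measures.\<close>
    have PR: "ennreal (real n) * emeasure ?P B + emeasure (?R n) B
        = ennreal (real n) * emeasure ?I B + emeasure (interval_measure (?W n)) B" if B: "B \<in> sets borel" for B n
    proof -
      have eq: "(\<lambda>t. real n * (?W 1 t + G t) + (?W n t - real n * G t)) = (\<lambda>t. real n * ?W 1 t + ?W n t)"
        by (simp add: algebra_simps)
      have "ennreal (real n) * emeasure ?P B + emeasure (?R n) B
          = emeasure (interval_measure (\<lambda>t. real n * (?W 1 t + G t) + (?W n t - real n * G t))) B"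
        by (simp only: emeasure_stieltjes_add[OF stieltjes_cmult[OF WGp of_nat_0_le_iff] WG B]
            emeasure_stieltjes_cmult[OF WGp of_nat_0_le_iff])
      also have "\<dots> = ennreal (real n) * emeasure ?I B + emeasure (interval_measure (?W n)) B"
        by (simp only: eq emeasure_stieltjes_add[OF stieltjes_cmult[OF W of_nat_0_le_iff] W B]
            emeasure_stieltjes_cmult[OF W of_nat_0_le_iff])
      finally show ?thesis .
    qed
    have P_le: "emeasure ?P B \<le> emeasure ?I B + emeasure ?I B" if "B \<in> sets borel" for B
    proof -
      have "emeasure ?P B \<le> ennreal (real 1) * emeasure ?P B + emeasure (?R 1) B" by simp
      also have "\<dots> = emeasure ?I B + emeasure ?I B" unfolding PR[OF that] by simp
      finally show ?thesis .
    qed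
    \<comment> \<open>On a Lebesgue null set the term with \<open>C n\<close> vanishes; divide \<open>PR\<close> by \<open>n\<close> and let \<open>n\<close> tend to infinity.\<close>
    have P_null: "emeasure ?P B \<le> emeasure ?I B" if B: "B \<in> sets borel" "emeasure lborel B = 0" for B
    proof -
      have I: "emeasure ?I B = emeasure ?N B" using W_split[OF B(1), of 1] B(2) by simp
      have N_top: "emeasure ?N B < \<infinity>" using N_fin[of B] by (auto intro: le_less_trans)
      have P_top: "emeasure ?P B < \<infinity>" using P_le[OF B(1)] N_top unfolding I by (auto intro: le_less_trans)
      have n: "ennreal (real n) * emeasure ?P B \<le> emeasure ?N B + ennreal (real n) * emeasure ?N B" for n :: nat
      proof -
        have "ennreal (real n) * emeasure ?P B \<le> ennreal (real n) * emeasure ?P B + emeasure (?R n) B" by simp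
        also have "\<dots> = emeasure ?N B + ennreal (real n) * emeasure ?N B"
          unfolding PR[OF B(1)] I using W_split[OF B(1), of n] B(2) by (simp add: add.commute)
        finally show ?thesis .
      qed
      define pr nr where "pr = enn2real (emeasure ?P B)" and "nr = enn2real (emeasure ?N B)"
      have pn: "emeasure ?P B = ennreal pr" "emeasure ?N B = ennreal nr" "0 \<le> pr" "0 \<le> nr"
        using P_top N_top by (auto simp: pr_def nr_def)
      have n': "real n * pr \<le> nr + real n * nr" for n :: nat
        using n[of n] pn(3,4) unfolding pn(1,2)
        by (simp add: ennreal_mult[symmetric] ennreal_plus[symmetric] del: ennreal_plus)
      have "pr \<le> nr"
      proof (rule ccontr)
        assume "\<not> pr \<le> nr"
        then have pos: "0 < pr - nr" by simp
        obtain n :: nat where "nr / (pr - nr) < real n" using reals_Archimedean2 by blast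
        then have "nr < real n * (pr - nr)" using pos by (simp add: field_simps)
        then show False using n'[of n] by (simp add: algebra_simps)
      qed
      then show ?thesis unfolding I pn(1,2) by (rule ennreal_leI)
    qed
    let ?J = "{a<..b}"
    have Wab: "?W 1 a \<le> ?W 1 b" using W[of 1] ab by (auto simp: stieltjes_def)
    have P_Z: "emeasure ?P (?J \<inter> Z) \<le> emeasure ?I (?J \<inter> Z)"
    proof (rule P_null)
      have "emeasure lborel (?J \<inter> Z) \<le> emeasure lborel Z" by (intro emeasure_mono) auto
      then show "emeasure lborel (?J \<inter> Z) = 0" using Z0 by simp
    qed measurable
    have split: "emeasure R ?J = emeasure R (?J \<inter> Z) + emeasure R (?J - Z)" if "sets R = sets borel" for R
    proof -
      have "emeasure R (?J \<inter> Z) + emeasure R (?J - Z) = emeasure R (?J \<inter> Z \<union> (?J - Z))"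
        by (rule plus_emeasure) (auto simp: that)
      then show ?thesis by (simp only: Int_Diff_Un)
    qed
    have P_split: "emeasure ?P ?J = emeasure ?P (?J \<inter> Z) + emeasure ?P (?J - Z)"
      by (rule split) simp
    have I_split: "emeasure ?I ?J = emeasure ?I (?J \<inter> Z) + emeasure ?I (?J - Z)"
      by (rule split) simp
    \<comment> \<open>The excess of \<open>?P\<close> over \<open>?I\<close> is dG. On Z there is
      none, and off Z it is at most \<open>?I\<close>, because \<open>?P\<close> is at most twice
      \<open>?I\<close>.\<close>
    have "emeasure ?P ?J \<le> emeasure ?I ?J + emeasure ?I (?J - Z)"
    proof -
      have "emeasure ?P ?J \<le> emeasure ?I (?J \<inter> Z) + (emeasure ?I (?J - Z) + emeasure ?I (?J - Z))"
        unfolding P_split by (intro add_mono P_Z P_le) measurable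
      then show ?thesis unfolding I_split by (simp add: add.assoc)
    qed
    also have "emeasure ?I (?J - Z) \<le> ennreal (measure ?N (?J - Z)) + ennreal (C 1 * (b - a))"
    proof -
      have "emeasure lborel (?J - Z) \<le> emeasure lborel ?J" by (intro emeasure_mono) auto
      then have "ennreal (C 1) * emeasure lborel (?J - Z) \<le> ennreal (C 1) * ennreal (b - a)"
        using ab by (intro mult_left_mono) auto
      moreover have "emeasure ?N (?J - Z) = ennreal (measure ?N (?J - Z))"
        using N_fin[of "?J - Z"] by (intro emeasure_eq_ennreal_measure) (auto simp: top_unique)
      ultimately show ?thesis
        using W_split[of "?J - Z" 1] C[of 1] ab by (simp add: ennreal_mult[symmetric] add_left_mono)
    qed
    finally have "ennreal (?W 1 b + G b - (?W 1 a + G a)) \<le> ennreal (?W 1 b - ?W 1 a) + (ennreal (measure ?N (?J - Z)) + ennreal (C 1 * (b - a)))"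
      unfolding emeasure_stieltjes_Ioc[OF WGp ab, symmetric] emeasure_stieltjes_Ioc[OF W ab, symmetric]
      by (simp add: add_left_mono)
    also have "\<dots> = ennreal (?W 1 b - ?W 1 a + (measure ?N (?J - Z) + C 1 * (b - a)))"
    proof -
      have "ennreal p + (ennreal q + ennreal r) = ennreal (p + (q + r))" if "0 \<le> p" "0 \<le> q" "0 \<le> r" for p q r
        using that by simp
      then show ?thesis using Wab ab C[of 1] by simp
    qed
    finally have "?W 1 b + G b - (?W 1 a + G a) \<le> ?W 1 b - ?W 1 a + (measure ?N (?J - Z) + C 1 * (b - a))"
      using Wab ab C[of 1] by (subst (asm) ennreal_le_iff) auto
    then show ?thesis unfolding h_val[OF ab] by simp
  qed
  show ?thesis by (rule that[OF hm h_nonneg h_int main])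
qed

text \<open>Let \<Psi> be the primitive of h. Domination makes \<Psi> + G and \<Psi> - G increasing,
  and their measures add up to 2h ds, so each is absolutely continuous. Subtracting h from the
  density of the first gives a density for G.\<close>

lemma density_of_dominated_increments:
  fixes G h :: "real \<Rightarrow> real"
  assumes [measurable]: "h \<in> borel_measurable borel" and h0: "\<And>s. 0 \<le> h s"
    and hint: "\<And>a b. set_integrable lborel {a..b} h" and hneg: "\<And>s. s < 0 \<Longrightarrow> h s = 0"
    and Gc: "\<And>x. continuous (at_right x) G"
    and le: "\<And>a b. a < b \<Longrightarrow> \<bar>G b - G a\<bar> \<le> (LBINT s:{a<..b}. h s)"
  obtains g where "g \<in> borel_measurable borel" "\<And>a b. set_integrable lborel {a..b} g"
    "\<And>a b. a < b \<Longrightarrow> G b - G a = (LBINT s:{a<..b}. g s)"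
proof -
  let ?\<Psi> = "\<lambda>t. LBINT s:{0..t}. h s"
  have \<Psi>c: "continuous (at_right x) ?\<Psi>" for x by (rule indefinite_integral_right_continuous[OF hint hneg])
  have \<Psi>i: "?\<Psi> b - ?\<Psi> a = (LBINT s:{a<..b}. h s)" if "a \<le> b" for a b
    using that by (intro indefinite_integral_increment hint hneg) auto
  have incr: "\<bar>G b - G a\<bar> \<le> ?\<Psi> b - ?\<Psi> a" if "a \<le> b" for a b
    using le[of a b] \<Psi>i[of a b] that by (cases "a = b") auto
  have T: "stieltjes (\<lambda>t. G t + ?\<Psi> t)" "stieltjes (\<lambda>t. ?\<Psi> t - G t)"
    unfolding stieltjes_def using incr by (force simp: abs_le_iff intro!: continuous_intros Gc \<Psi>c)+
  let ?T = "interval_measure (\<lambda>t. G t + ?\<Psi> t)"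
  let ?T' = "interval_measure (\<lambda>t. ?\<Psi> t - G t)"
  let ?H = "density lborel (\<lambda>s. ennreal (h s))"
  note eT = emeasure_stieltjes_Ioc[OF T(1)]
  note \<Psi> = interval_measure_indefinite_integral(1)[OF assms(1) h0 hint hneg]
  note H = interval_measure_indefinite_integral(2)[OF assms(1) h0 hint hneg]
  have sum: "emeasure ?T B + emeasure ?T' B = emeasure ?H B + emeasure ?H B" if "B \<in> sets borel" for B
  proof -
    have "emeasure (interval_measure (\<lambda>t. (G t + ?\<Psi> t) + (?\<Psi> t - G t))) B
        = emeasure (interval_measure (\<lambda>t. ?\<Psi> t + ?\<Psi> t)) B" by simp
    then show ?thesis
      by (simp only: emeasure_stieltjes_add[OF T that] emeasure_stieltjes_add[OF \<Psi> \<Psi> that] H)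
  qed
  have "absolutely_continuous lborel ?T"
    unfolding absolutely_continuous_def
  proof
    fix B assume "B \<in> null_sets (lborel :: real measure)"
    then have B: "B \<in> sets borel" "B \<in> null_sets lborel" by auto
    have "B \<in> null_sets ?H"
      using B(2) absolutely_continuousI_density[of "\<lambda>s. ennreal (h s)" lborel] unfolding absolutely_continuous_def by auto
    then have "emeasure ?T B + emeasure ?T' B = 0" using sum[OF B(1)] by auto
    then show "B \<in> null_sets ?T" using B(1) by (auto simp: null_sets_def)
  qed
  then obtain q where q: "q \<in> borel_measurable lborel" "density lborel q = ?T"
    using sigma_finite_measure.Radon_Nikodym[OF sigma_finite_lborel, of ?T] by auto
  have qm[measurable]: "q \<in> borel_measurable borel" using q(1) by simp
  have qI: "(\<integral>\<^sup>+s\<in>{a<..b}. q s \<partial>lborel) = ennreal (G b + ?\<Psi> b - (G a + ?\<Psi> a))" if "a < b" for a b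
    using eT[OF that] q unfolding q(2)[symmetric] by (simp add: emeasure_density)
  have q_AE: "AE s in lborel. q s * indicator {a<..b} s \<noteq> \<infinity>" if "a < b" for a b
    by (rule nn_integral_PInf_AE) (use qI[OF that] in auto)
  have q_nn: "(\<integral>\<^sup>+s. ennreal (indicator {a<..b} s *\<^sub>R enn2real (q s)) \<partial>lborel) = ennreal (G b + ?\<Psi> b - (G a + ?\<Psi> a))"
    if "a < b" for a b
    unfolding qI[OF that, symmetric]
    using q_AE[OF that] by (intro nn_integral_cong_AE) (auto simp: less_top indicator_def elim!: eventually_mono split: if_splits)
  have q_int: "set_integrable lborel {a<..b} (\<lambda>s. enn2real (q s))" if "a < b" for a b
    unfolding set_integrable_def by (rule integrableI_nonneg) (use q_nn[OF that] in auto)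
  have q_val: "(LBINT s:{a<..b}. enn2real (q s)) = G b + ?\<Psi> b - (G a + ?\<Psi> a)" if "a < b" for a b
  proof -
    have "(LBINT s:{a<..b}. enn2real (q s))
        = enn2real (\<integral>\<^sup>+s. ennreal (indicator {a<..b} s *\<^sub>R enn2real (q s)) \<partial>lborel)"
      unfolding set_lebesgue_integral_def by (rule integral_eq_nn_integral) auto
    then show ?thesis unfolding q_nn[OF that] using incr[OF less_imp_le[OF that]] by (simp add: enn2real_ennreal abs_le_iff)
  qed
  have gint: "set_integrable lborel {a<..b} (\<lambda>s. enn2real (q s) - h s)" if "a < b" for a b
    by (intro set_integral_diff q_int that set_integrable_Ioc hint)
  show ?thesis
  proof (rule that[of "\<lambda>s. enn2real (q s) - h s"])
    show "set_integrable lborel {a..b} (\<lambda>s. enn2real (q s) - h s)" for a b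
    proof (cases "a \<le> b")
      case True
      \<comment> \<open>Starting at a - 1 includes the left endpoint and covers the case a =
        b.\<close>
      then show ?thesis by (intro set_integrable_subset[OF gint[of "a - 1" b]]) auto
    next
      case False then show ?thesis by (simp add: set_integrable_def)
    qed
    show "G b - G a = (LBINT s:{a<..b}. enn2real (q s) - h s)" if "a < b" for a b
    proof -
      have "(LBINT s:{a<..b}. enn2real (q s) - h s) = (LBINT s:{a<..b}. enn2real (q s)) - (LBINT s:{a<..b}. h s)"
        by (intro set_integral_diff q_int that set_integrable_Ioc hint)
      then show ?thesis using q_val[OF that] \<Psi>i[of a b] that by simp
    qed
  qed measurable
qed

text \<open>Rational linear combinations of a dense sequence: a countable family on which the almost sure
  linearity relations can be imposed simultaneously.\<close>

fun rat_comb :: "(nat \<Rightarrow> 'a \<Rightarrow> real) \<Rightarrow> (rat \<times> nat) list \<Rightarrow> 'a \<Rightarrow> real" where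
  "rat_comb D [] = (\<lambda>_. 0)"
| "rat_comb D ((c, i) # l) = (\<lambda>x. of_rat c * D i x + rat_comb D l x)"

lemma rat_comb_append: "rat_comb D (l @ l') = (\<lambda>x. rat_comb D l x + rat_comb D l' x)"
  by (induction D l rule: rat_comb.induct) auto

lemma rat_comb_scale: "rat_comb D (map (\<lambda>(c, i). (r * c, i)) l) = (\<lambda>x. of_rat r * rat_comb D l x)"
  by (induction D l rule: rat_comb.induct) (auto simp: of_rat_mult algebra_simps)

lemma rat_comb_C0: "(\<And>n. D n \<in> C0) \<Longrightarrow> rat_comb D l \<in> C0"
proof (induction D l rule: rat_comb.induct)
  case (2 D c i l)
  then show ?case unfolding rat_comb.simps by (intro C0_add C0_cmult) auto
qed simp

lemma C0_abs_le_SUP: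
  assumes "f \<in> C0" shows "\<bar>f x\<bar> \<le> (SUP x. \<bar>f x :: real\<bar>)"
proof -
  obtain B where "\<And>x. \<bar>f x\<bar> \<le> B" using bcontfun_bound[OF C0_bcontfun[OF assms]] by metis
  then show ?thesis by (intro cSUP_upper) (auto intro!: bdd_aboveI2)
qed

text \<open>d lives on lists of coefficients, not on functions: \<open>bound\<close> for l followed
  by the negative of l' shows that d depends only on the represented function, in a Lipschitz way.
  Real scalars are reached from rational ones by boundedness. v is an explicit limit, so that it
  stays measurable when d varies with time.\<close>

lemma C0_dual_extension:
  fixes D :: "nat \<Rightarrow> 'a::topological_space \<Rightarrow> real" and d :: "(rat \<times> nat) list \<Rightarrow> real"
  assumes D: "\<And>n. D n \<in> C0" and K: "0 \<le> K"
    and L: "\<And>f n. f \<in> C0 \<Longrightarrow> \<forall>x. \<bar>f x - rat_comb D (L f n) x\<bar> \<le> inverse (real (Suc n))"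
    and add: "\<And>l l'. d (l @ l') = d l + d l'"
    and scale: "\<And>r l. d (map (\<lambda>(c, i). (r * c, i)) l) = of_rat r * d l"
    and bound: "\<And>l. \<bar>d l\<bar> \<le> (SUP x. \<bar>rat_comb D l x\<bar>) * K"
  defines "v \<equiv> \<lambda>f. if f \<in> C0 then lim (\<lambda>n. d (L f n)) else 0"
  shows "v \<in> C0_dual" and "\<And>f. f \<in> C0 \<Longrightarrow> (\<lambda>n. d (L f n)) \<longlonglongrightarrow> v f"
proof -
  have bound': "\<bar>d l\<bar> \<le> q * K" if "\<And>x. \<bar>rat_comb D l x\<bar> \<le> q" for l q
  proof -
    have "(SUP x. \<bar>rat_comb D l x\<bar>) * K \<le> q * K"
      using that K by (intro mult_right_mono cSUP_least) auto
    then show ?thesis using bound[of l] by linarith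
  qed
  have diff: "\<bar>d l - d l'\<bar> \<le> q * K" if "\<And>x. \<bar>rat_comb D l x - rat_comb D l' x\<bar> \<le> q" for l l' q
    using bound'[of "l @ map (\<lambda>(c, i). (- 1 * c, i)) l'" q] that
    unfolding add scale rat_comb_append rat_comb_scale by simp
  have inv0: "(\<lambda>n. inverse (real (Suc n))) \<longlonglongrightarrow> 0" by (rule LIMSEQ_inverse_real_of_nat)
  have close: "\<bar>d (L f n) - d l\<bar> \<le> (inverse (real (Suc n)) + q) * K"
    if f: "f \<in> C0" and q: "\<And>x. \<bar>f x - rat_comb D l x\<bar> \<le> q" for f n l q
  proof (rule diff)
    fix x
    have "\<bar>f x - rat_comb D (L f n) x\<bar> \<le> inverse (real (Suc n))" using L[OF f, of n] by blast
    then show "\<bar>rat_comb D (L f n) x - rat_comb D l x\<bar> \<le> inverse (real (Suc n)) + q"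
      using q[of x] by linarith
  qed
  show lim: "(\<lambda>n. d (L f n)) \<longlonglongrightarrow> v f" if f: "f \<in> C0" for f
  proof -
    have "Cauchy (\<lambda>n. d (L f n))"
    proof (rule metric_CauchyI)
      fix e :: real assume "0 < e"
      then have "0 < e / (2 * (K + 1))" using K by simp
      then obtain M where M: "inverse (real (Suc M)) < e / (2 * (K + 1))" using reals_Archimedean by blast
      have "dist (d (L f m)) (d (L f n)) < e" if "M \<le> m" "M \<le> n" for m n
      proof -
        have "inverse (real (Suc m)) \<le> inverse (real (Suc M))" "inverse (real (Suc n)) \<le> inverse (real (Suc M))"
          using that by (auto intro!: le_imp_inverse_le)
        then have "(inverse (real (Suc m)) + inverse (real (Suc n))) * K \<le> (2 * inverse (real (Suc M))) * K"
          using K by (intro mult_right_mono) linarith+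
        also have "\<dots> \<le> (2 * inverse (real (Suc M))) * (K + 1)" by (intro mult_left_mono) auto
        also have "\<dots> < e" using M K by (simp add: field_simps)
        finally show ?thesis using close[OF f, of "L f n" "inverse (real (Suc n))" m] L[OF f, of n]
          unfolding dist_real_def by auto
      qed
      then show "\<exists>M. \<forall>m\<ge>M. \<forall>n\<ge>M. dist (d (L f m)) (d (L f n)) < e" by blast
    qed
    then have "convergent (\<lambda>n. d (L f n))" by (rule Cauchy_convergent)
    then show ?thesis using f by (simp add: v_def convergent_LIMSEQ_iff)
  qed
  have approx: "\<bar>v f - d l\<bar> \<le> q * K" if f: "f \<in> C0" and q: "\<And>x. \<bar>f x - rat_comb D l x\<bar> \<le> q" for f l q
  proof (rule tendsto_le[OF sequentially_bot])
    show "(\<lambda>n. (inverse (real (Suc n)) + q) * K) \<longlonglongrightarrow> q * K"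
      using tendsto_mult[OF tendsto_add[OF inv0 tendsto_const[of q]] tendsto_const[of K]] by simp
    show "(\<lambda>n. \<bar>d (L f n) - d l\<bar>) \<longlonglongrightarrow> \<bar>v f - d l\<bar>" by (intro tendsto_intros lim f)
    show "\<forall>\<^sub>F n in sequentially. \<bar>d (L f n) - d l\<bar> \<le> (inverse (real (Suc n)) + q) * K"
      using close[OF f q] by simp
  qed
  \<comment> \<open>The empty list represents 0; comparison with it yields the norm bound for
    v.\<close>
  have d_nil: "d [] = 0" using add[of "[]" "[]"] by simp
  have v_le: "\<bar>v f\<bar> \<le> q * K" if "f \<in> C0" "\<And>x. \<bar>f x\<bar> \<le> q" for f q
    using approx[OF that(1), of "[]" q] that(2) by (simp add: d_nil)
  have v_bound: "\<bar>v f\<bar> \<le> K * (SUP x. \<bar>f x\<bar>)" if "f \<in> C0" for f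
    using v_le[OF that C0_abs_le_SUP[OF that]] by (simp add: mult.commute)
  have small: "y = 0" if "\<And>n. \<bar>y\<bar> \<le> c * inverse (real (Suc n))" for y c :: real
  proof -
    have "(\<lambda>n. c * inverse (real (Suc n))) \<longlonglongrightarrow> c * 0" by (intro tendsto_mult inv0 tendsto_const)
    then have "\<bar>y\<bar> \<le> c * 0" by (rule LIMSEQ_le_const) (use that in auto)
    then show ?thesis by simp
  qed
  have v_add: "v (\<lambda>x. f x + g x) = v f + v g" if f: "f \<in> C0" and g: "g \<in> C0" for f g
  proof -
    have "\<bar>v (\<lambda>x. f x + g x) - (v f + v g)\<bar> \<le> (4 * K) * inverse (real (Suc n))" for n
    proof -
      let ?i = "inverse (real (Suc n))"
      have 1: "\<bar>v f - d (L f n)\<bar> \<le> ?i * K" "\<bar>v g - d (L g n)\<bar> \<le> ?i * K"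
        using L[OF f, of n] L[OF g, of n] by (auto intro!: approx f g)
      have "\<bar>v (\<lambda>x. f x + g x) - d (L f n @ L g n)\<bar> \<le> (2 * ?i) * K"
      proof (rule approx[OF C0_add[OF f g]])
        fix x
        have "\<bar>f x - rat_comb D (L f n) x\<bar> \<le> ?i" "\<bar>g x - rat_comb D (L g n) x\<bar> \<le> ?i"
          using L[OF f, of n] L[OF g, of n] by auto
        then show "\<bar>f x + g x - rat_comb D (L f n @ L g n) x\<bar> \<le> 2 * ?i"
          unfolding rat_comb_append by linarith
      qed
      then have "\<bar>v (\<lambda>x. f x + g x) - (v f + v g)\<bar> \<le> 2 * ?i * K + ?i * K + ?i * K"
        using 1 unfolding add by linarith
      then show ?thesis by (simp add: algebra_simps)
    qed
    from small[OF this] show ?thesis by simp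
  qed
  have v_rat: "v (\<lambda>x. of_rat r * f x) = of_rat r * v f" if f: "f \<in> C0" for f r
  proof -
    have "\<bar>v (\<lambda>x. of_rat r * f x) - of_rat r * v f\<bar> \<le> (2 * \<bar>of_rat r\<bar> * K) * inverse (real (Suc n))" for n
    proof -
      let ?i = "inverse (real (Suc n))"
      have "\<bar>of_rat r * (v f - d (L f n))\<bar> \<le> \<bar>of_rat r\<bar> * (?i * K)"
        unfolding abs_mult using L[OF f, of n] by (intro mult_left_mono approx f) auto
      then have 1: "\<bar>of_rat r * v f - of_rat r * d (L f n)\<bar> \<le> \<bar>of_rat r\<bar> * (?i * K)"
        by (simp add: right_diff_distrib)
      have "\<bar>v (\<lambda>x. of_rat r * f x) - d (map (\<lambda>(c, i). (r * c, i)) (L f n))\<bar> \<le> (\<bar>of_rat r\<bar> * ?i) * K"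
      proof (rule approx[OF C0_cmult[OF f]])
        fix x
        have "\<bar>of_rat r * (f x - rat_comb D (L f n) x)\<bar> \<le> \<bar>of_rat r\<bar> * ?i"
          unfolding abs_mult using L[OF f, of n] by (intro mult_left_mono) auto
        then show "\<bar>of_rat r * f x - rat_comb D (map (\<lambda>(c, i). (r * c, i)) (L f n)) x\<bar> \<le> \<bar>of_rat r\<bar> * ?i"
          unfolding rat_comb_scale by (simp add: right_diff_distrib)
      qed
      then have "\<bar>v (\<lambda>x. of_rat r * f x) - of_rat r * v f\<bar> \<le> \<bar>of_rat r\<bar> * ?i * K + \<bar>of_rat r\<bar> * (?i * K)"
        using 1 unfolding scale by linarith
      then show ?thesis by (simp add: algebra_simps)
    qed
    from small[OF this] show ?thesis by simp
  qed
  have v_scale: "v (\<lambda>x. c * f x) = c * v f" if f: "f \<in> C0" for f c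
  proof -
    obtain B where B: "\<And>x. \<bar>f x\<bar> \<le> B" using bcontfun_bound[OF C0_bcontfun[OF f]] by metis
    have "\<bar>v (\<lambda>x. c * f x) - c * v f\<bar> \<le> (2 * B * K) * inverse (real (Suc n))" for n
    proof -
      let ?i = "inverse (real (Suc n))"
      obtain r where r: "c < of_rat r" "of_rat r < c + ?i" using of_rat_dense[of c "c + ?i"] by auto
      let ?r = "of_rat r :: real"
      have cr: "\<bar>c - ?r\<bar> \<le> ?i" using r by auto
      have B0: "0 \<le> B" using B[of undefined] by linarith
      have "v (\<lambda>x. c * f x) = v (\<lambda>x. ?r * f x + (c - ?r) * f x)" by (simp add: algebra_simps)
      also have "\<dots> = ?r * v f + v (\<lambda>x. (c - ?r) * f x)"
        by (simp only: v_add[OF C0_cmult[OF f] C0_cmult[OF f]] v_rat[OF f])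
      finally have "\<bar>v (\<lambda>x. c * f x) - c * v f\<bar> = \<bar>v (\<lambda>x. (c - ?r) * f x) - (c - ?r) * v f\<bar>"
        by (simp add: algebra_simps)
      also have "\<dots> \<le> \<bar>v (\<lambda>x. (c - ?r) * f x)\<bar> + \<bar>(c - ?r) * v f\<bar>" by (rule abs_triangle_ineq4)
      also have "\<dots> \<le> (?i * B) * K + ?i * (B * K)"
      proof (rule add_mono)
        show "\<bar>v (\<lambda>x. (c - ?r) * f x)\<bar> \<le> (?i * B) * K"
        proof (rule v_le[OF C0_cmult[OF f]])
          show "\<bar>(c - ?r) * f x\<bar> \<le> ?i * B" for x
            unfolding abs_mult using cr B[of x] B0 by (intro mult_mono) auto
        qed
        show "\<bar>(c - ?r) * v f\<bar> \<le> ?i * (B * K)"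
          unfolding abs_mult using cr v_le[OF f B] by (intro mult_mono) auto
      qed
      finally show ?thesis by (simp add: algebra_simps)
    qed
    from small[OF this] show ?thesis by simp
  qed
  show "v \<in> C0_dual" unfolding C0_dual_def using v_add v_scale v_bound by blast
qed

text \<open>Each \<open>dens f\<close> is pinned down only up to a null set depending on f. There
  are countably many lists of rational coefficients, so one null set N serves all relations among
  them. Outside N the values extend to \<open>C0\<close>, and the majorant h forces the extension to
  agree with \<open>dens f\<close> almost everywhere.\<close>

lemma C0_dual_version:
  fixes dens :: "('a::second_countable_topology \<Rightarrow> real) \<Rightarrow> real \<Rightarrow> real" and h :: "real \<Rightarrow> real"
  assumes meas: "\<And>f. f \<in> C0 \<Longrightarrow> dens f \<in> borel_measurable borel"
    and h: "\<And>s. 0 \<le> h s"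
    and add: "\<And>f g. f \<in> C0 \<Longrightarrow> g \<in> C0 \<Longrightarrow> AE s in lborel. dens (\<lambda>x. f x + g x) s = dens f s + dens g s"
    and scale: "\<And>f c. f \<in> C0 \<Longrightarrow> AE s in lborel. dens (\<lambda>x. c * f x) s = c * dens f s"
    and bound: "\<And>f \<epsilon>. f \<in> C0 \<Longrightarrow> (\<forall>x. \<bar>f x\<bar> \<le> \<epsilon>) \<Longrightarrow> AE s in lborel. \<bar>dens f s\<bar> \<le> \<epsilon> * h s"
  obtains u where "\<And>s. u s \<in> C0_dual" "\<And>f. f \<in> C0 \<Longrightarrow> (\<lambda>s. u s f) \<in> borel_measurable borel"
    "\<And>f. f \<in> C0 \<Longrightarrow> AE s in lborel. u s f = dens f s"
proof -
  obtain D :: "nat \<Rightarrow> 'a \<Rightarrow> real" where D: "\<And>n. D n \<in> C0" "\<forall>f\<in>C0. \<forall>\<epsilon>>0. \<exists>n. \<forall>x. \<bar>f x - D n x\<bar> \<le> \<epsilon>"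
    using C0_separable by metis
  note e_C0 = rat_comb_C0[of D, OF D(1)]
  have "\<exists>l. f \<in> C0 \<longrightarrow> (\<forall>x. \<bar>f x - rat_comb D l x\<bar> \<le> inverse (real (Suc n)))" for f n
  proof (cases "f \<in> C0")
    case True
    then obtain i where "\<forall>x. \<bar>f x - D i x\<bar> \<le> inverse (real (Suc n))"
      using D(2) by (metis inverse_positive_iff_positive of_nat_0_less_iff zero_less_Suc)
    then show ?thesis by (intro exI[of _ "[(1, i)]"]) simp
  qed simp
  then obtain L where L: "\<And>f n. f \<in> C0 \<Longrightarrow> \<forall>x. \<bar>f x - rat_comb D (L f n) x\<bar> \<le> inverse (real (Suc n))"
    by metis
  let ?d = "\<lambda>s l. dens (rat_comb D l) s"
  have "AE s in lborel. \<forall>l l'. ?d s (l @ l') = ?d s l + ?d s l'"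
    unfolding AE_all_countable rat_comb_append by (intro allI add e_C0)
  moreover have "AE s in lborel. \<forall>r l. ?d s (map (\<lambda>(c, i). (r * c, i)) l) = of_rat r * ?d s l"
    unfolding AE_all_countable rat_comb_scale by (intro allI scale e_C0)
  moreover have "AE s in lborel. \<forall>l. \<bar>?d s l\<bar> \<le> (SUP x. \<bar>rat_comb D l x\<bar>) * h s"
    unfolding AE_all_countable by (intro allI bound e_C0 C0_abs_le_SUP)
  ultimately have "AE s in lborel. (\<forall>l l'. ?d s (l @ l') = ?d s l + ?d s l') \<and>
      (\<forall>r l. ?d s (map (\<lambda>(c, i). (r * c, i)) l) = of_rat r * ?d s l) \<and>
      (\<forall>l. \<bar>?d s l\<bar> \<le> (SUP x. \<bar>rat_comb D l x\<bar>) * h s)"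
    by eventually_elim blast
  then obtain N where "{s \<in> space lborel. \<not> ((\<forall>l l'. ?d s (l @ l') = ?d s l + ?d s l') \<and>
      (\<forall>r l. ?d s (map (\<lambda>(c, i). (r * c, i)) l) = of_rat r * ?d s l) \<and>
      (\<forall>l. \<bar>?d s l\<bar> \<le> (SUP x. \<bar>rat_comb D l x\<bar>) * h s))} \<subseteq> N"
    and N: "emeasure lborel N = 0" "N \<in> sets lborel" by (rule AE_E)
  then have good: "\<And>s. s \<notin> N \<Longrightarrow> (\<forall>l l'. ?d s (l @ l') = ?d s l + ?d s l') \<and>
      (\<forall>r l. ?d s (map (\<lambda>(c, i). (r * c, i)) l) = of_rat r * ?d s l) \<and>
      (\<forall>l. \<bar>?d s l\<bar> \<le> (SUP x. \<bar>rat_comb D l x\<bar>) * h s)"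
    unfolding space_lborel space_borel by blast
  \<comment> \<open>The value 0 on N is a convenient element of the dual that keeps u
    measurable.\<close>
  define u where "u s = (if s \<in> N then (\<lambda>_. 0) else (\<lambda>f. if f \<in> C0 then lim (\<lambda>n. ?d s (L f n)) else 0))" for s
  have ext: "u s \<in> C0_dual" "\<And>f. f \<in> C0 \<Longrightarrow> (\<lambda>n. ?d s (L f n)) \<longlonglongrightarrow> u s f" if "s \<notin> N" for s
    using C0_dual_extension[of D "h s" L "?d s", OF D(1) h L] good[OF that] that by (auto simp: u_def)
  have u_meas: "(\<lambda>s. u s f) \<in> borel_measurable borel" if f: "f \<in> C0" for f
  proof (rule borel_measurable_LIMSEQ_real)
    show "(\<lambda>n. if s \<in> N then 0 else ?d s (L f n)) \<longlonglongrightarrow> u s f" for s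
      using ext(2)[OF _ f, of s] by (cases "s \<in> N") (auto simp: u_def)
    show "(\<lambda>s. if s \<in> N then 0 else ?d s (L f n)) \<in> borel_measurable borel" for n
      using N(2) meas[OF e_C0] by (intro measurable_If_set) auto
  qed
  have not_N: "AE s in lborel. s \<notin> N" using N by (intro AE_not_in) auto
  have u_dens: "AE s in lborel. u s f = dens f s" if f: "f \<in> C0" for f
  proof -
    have "AE s in lborel. \<bar>dens f s - ?d s (L f n)\<bar> \<le> inverse (real (Suc n)) * h s" for n
    proof -
      let ?e = "rat_comb D (L f n)"
      have "AE s in lborel. \<bar>dens (\<lambda>x. f x + - 1 * ?e x) s\<bar> \<le> inverse (real (Suc n)) * h s"
        using L[OF f, of n] by (intro bound C0_add f C0_cmult e_C0) auto
      moreover have "AE s in lborel. dens (\<lambda>x. f x + - 1 * ?e x) s = dens f s + dens (\<lambda>x. - 1 * ?e x) s"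
        by (intro add f C0_cmult e_C0)
      moreover have "AE s in lborel. dens (\<lambda>x. - 1 * ?e x) s = - 1 * dens ?e s"
        by (intro scale e_C0)
      ultimately show ?thesis by eventually_elim simp
    qed
    then have "AE s in lborel. \<forall>n. \<bar>dens f s - ?d s (L f n)\<bar> \<le> inverse (real (Suc n)) * h s"
      by (simp add: AE_all_countable)
    then show ?thesis using not_N
    proof eventually_elim
      case (elim s)
      have "(\<lambda>n. inverse (real (Suc n)) * h s) \<longlonglongrightarrow> 0 * h s"
        by (intro tendsto_mult LIMSEQ_inverse_real_of_nat tendsto_const)
      then have lim0: "(\<lambda>n. inverse (real (Suc n)) * h s) \<longlonglongrightarrow> 0" by (simp only: mult_zero_left)
      have "(\<lambda>n. dens f s - ?d s (L f n)) \<longlonglongrightarrow> 0"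
      proof (rule Lim_null_comparison[OF _ lim0])
        show "\<forall>\<^sub>F n in sequentially. norm (dens f s - ?d s (L f n)) \<le> inverse (real (Suc n)) * h s"
          unfolding real_norm_def using elim(1) by (intro always_eventually) blast
      qed
      then have "(\<lambda>n. dens f s - (dens f s - ?d s (L f n))) \<longlonglongrightarrow> dens f s - 0" by (intro tendsto_diff tendsto_const)
      then have "(\<lambda>n. ?d s (L f n)) \<longlonglongrightarrow> dens f s" by simp
      then show ?case using ext(2)[OF elim(2) f] LIMSEQ_unique by blast
    qed
  qed
  have "u s \<in> C0_dual" for s
  proof (cases "s \<in> N")
    case True
    have "(\<lambda>_. 0) \<in> C0_dual" by (auto simp: C0_dual_def intro!: exI[of _ 0])
    then show ?thesis using True by (simp add: u_def)
  qed (rule ext)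
  then show ?thesis using u_meas u_dens that by blast
qed

section \<open>The velocity of a path of finite rate\<close>

context jump_path
begin

text \<open>\<open>cond_rate\<close> compares f at \<nu>(b) with V(b - a)f at \<nu>(a), and V moves
  f by at most exp(4B) 2\<Lambda> (b - a). With B = n this is the constant C n of the
  overview.\<close>

lemma nu_increment_le:
  assumes m: "mono m" "\<And>a b. 0 \<le> a \<Longrightarrow> a < b \<Longrightarrow> cond_rate P (b - a) (\<nu> b) (\<nu> a) \<le> ereal (m b - m a)"
    and f: "f \<in> C0" "\<And>x. \<bar>f x\<bar> \<le> B" and "a < b"
  shows "(\<integral>x. f x \<partial>\<nu> (max 0 b)) - (\<integral>x. f x \<partial>\<nu> (max 0 a)) \<le> m b - m a + exp (4 * B) * (2 * \<Lambda>) * (b - a)"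
proof -
  have C: "0 \<le> exp (4 * B) * (2 * \<Lambda>)" using Lam0 by simp
  have pos: "(\<integral>x. f x \<partial>\<nu> b) - (\<integral>x. f x \<partial>\<nu> a) \<le> m b - m a + exp (4 * B) * (2 * \<Lambda>) * (b - a)"
    if ab: "0 \<le> a" "a < b" for a b
  proof -
    have "ereal ((\<integral>z. f z \<partial>\<nu> b) - (\<integral>z. V (b - a) f z \<partial>\<nu> a)) \<le> ereal (m b - m a)"
      by (rule order_trans[OF cond_rate_ge[OF C0_bcontfun[OF f(1)]] m(2)[OF ab]])
    moreover have "\<bar>(\<integral>z. V (b - a) f z \<partial>\<nu> a) - (\<integral>z. f z \<partial>\<nu> a)\<bar> \<le> exp (4 * B) * (2 * \<Lambda>) * (b - a)"
      using ab by (intro integral_probs_diff_abs_le[OF nu_probs] nu_integrable C0_bcontfun V_C0 f V_increment_abs_le) auto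
    ultimately show ?thesis by (simp add: abs_le_iff)
  qed
  show ?thesis
  proof (cases "b \<le> 0")
    case True then show ?thesis using monoD[OF m(1), of a b] \<open>a < b\<close> C by simp
  next
    case False
    have "exp (4 * B) * (2 * \<Lambda>) * (b - max 0 a) \<le> exp (4 * B) * (2 * \<Lambda>) * (b - a)"
      using C by (intro mult_left_mono) auto
    moreover have b: "max 0 b = b" and "m a \<le> m (max 0 a)" using False monoD[OF m(1), of a "max 0 a"] by auto
    moreover have "0 \<le> max 0 a" "max 0 a < b" using False \<open>a < b\<close> by auto
    note pos[OF this]
    ultimately show ?thesis unfolding b by linarith
  qed
qed

lemma velocity_exists:
  assumes fin: "partition_rate < \<infinity>"
  shows "\<exists>u. is_velocity \<nu> u"
proof -
  obtain m where m: "mono m" "\<And>x. 0 \<le> m x" "\<And>x. ereal (m x) \<le> partition_rate"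
    "\<And>a b. 0 \<le> a \<Longrightarrow> a < b \<Longrightarrow> cond_rate P (b - a) (\<nu> b) (\<nu> a) \<le> ereal (m b - m a)"
    using partition_rate_majorant[OF fin] by metis
  have "0 \<le> partition_rate" using order_trans[OF _ m(3)[of 0]] m(2)[of 0] by simp
  then obtain j where j: "partition_rate = ereal j" using fin by (cases partition_rate) auto
  have mj: "m x \<le> j" for x using m(3)[of x] by (simp add: j)
  let ?F = "\<lambda>(f :: 'a \<Rightarrow> real) t. \<integral>x. f x \<partial>\<nu> (max 0 t)"
  have F_cont: "continuous (at_right x) (?F f)" if "f \<in> C0" for f x
  proof -
    have "continuous_on UNIV (?F f)"
      by (rule continuous_on_compose2[OF nu_cont[OF that]]) (auto intro!: continuous_intros)
    then show ?thesis by (meson UNIV_I continuous_on_eq_continuous_within continuous_within_subset subset_UNIV)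
  qed
  have F_cmult: "?F (\<lambda>x. c * f x) t = c * ?F f t" for c f t by simp
  have F_add: "?F (\<lambda>x. f x + g x) t = ?F f t + ?F g t" if "f \<in> C0" "g \<in> C0" for f g t
    using that by (intro Bochner_Integration.integral_add nu_integrable C0_bcontfun) auto
  \<comment> \<open>Increments are linear in f, so the unit ball carries all the information:
    testing with n times a member has B = n.\<close>
  define \<G> where "\<G> = {?F f | f. f \<in> C0 \<and> (\<forall>x. \<bar>f x\<bar> \<le> 1)}"
  obtain h where h: "h \<in> borel_measurable borel" "\<And>s. 0 \<le> h s" "\<And>a b. set_integrable lborel {a..b} h"
    and hG: "\<And>G a b. G \<in> \<G> \<Longrightarrow> a < b \<Longrightarrow> G b - G a \<le> (LBINT s:{a<..b}. h s)"
  proof (rule superlinear_increments_density[of m j "\<lambda>n. exp (4 * real n) * (2 * \<Lambda>)" \<G>, OF m(1,2) mj])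
    show "0 \<le> exp (4 * real n) * (2 * \<Lambda>)" for n using Lam0 by simp
    show "(\<lambda>t. - G t) \<in> \<G>" if G: "G \<in> \<G>" for G
    proof -
      obtain f where f: "G = ?F f" "f \<in> C0" "\<forall>x. \<bar>f x\<bar> \<le> 1" using G unfolding \<G>_def by blast
      then have "(\<lambda>t. - G t) = ?F (\<lambda>x. - f x)" by auto
      then show ?thesis unfolding \<G>_def using C0_uminus[OF f(2)] f(3) by (intro CollectI exI[of _ "\<lambda>x. - f x"]) auto
    qed
    show "continuous (at_right x) G" if "G \<in> \<G>" for G x using that F_cont unfolding \<G>_def by auto
    show "real n * (G b - G a) \<le> m b - m a + exp (4 * real n) * (2 * \<Lambda>) * (b - a)"
      if G: "G \<in> \<G>" and ab: "a < b" for G n a b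
    proof -
      obtain f where f: "G = ?F f" "f \<in> C0" "\<forall>x. \<bar>f x\<bar> \<le> 1" using G unfolding \<G>_def by blast
      have "?F (\<lambda>x. real n * f x) b - ?F (\<lambda>x. real n * f x) a \<le> m b - m a + exp (4 * real n) * (2 * \<Lambda>) * (b - a)"
      proof (rule nu_increment_le[OF m(1,4) C0_cmult[OF f(2)] _ ab])
        show "\<bar>real n * f x\<bar> \<le> real n" for x using f(3) by (simp add: abs_mult mult_left_le)
      qed
      then show ?thesis unfolding f(1) F_cmult by (simp add: right_diff_distrib)
    qed
  qed blast
  \<comment> \<open>The continued path is constant before time 0, so a majorant cut off there still
    dominates its increments.\<close>
  define h' where "h' s = (if s < 0 then 0 else h s)" for s
  have h'[measurable]: "h' \<in> borel_measurable borel" unfolding h'_def[abs_def] using h(1) by measurable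
  have h'0: "0 \<le> h' s" for s using h(2) by (simp add: h'_def)
  have h'neg: "h' s = 0" if "s < 0" for s using that by (simp add: h'_def)
  have h'int: "set_integrable lborel {a..b} h'" for a b
    unfolding set_integrable_def
  proof (rule Bochner_Integration.integrable_bound[OF h(3)[of a b, unfolded set_integrable_def]])
    show "(\<lambda>s. indicator {a..b} s *\<^sub>R h' s) \<in> borel_measurable lborel" using h' by simp
    show "AE s in lborel. norm (indicator {a..b} s *\<^sub>R h' s) \<le> norm (indicator {a..b} s *\<^sub>R h s)"
      by (auto simp: h'_def indicator_def)
  qed
  have F_one: "\<bar>?F f b - ?F f a\<bar> \<le> (LBINT s:{a<..b}. h' s)" if f: "f \<in> C0" "\<forall>x. \<bar>f x\<bar> \<le> 1" and ab: "a < b" for f a b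
  proof -
    have nonneg: "0 \<le> (LBINT s:{a<..b}. h' s)" for a b
      unfolding set_lebesgue_integral_def using h'0 by (intro integral_nonneg_AE) auto
    have pos: "\<bar>?F f b - ?F f a\<bar> \<le> (LBINT s:{a<..b}. h' s)" if ab: "0 \<le> a" "a < b" for a b
    proof -
      have eq: "(LBINT s:{a<..b}. h' s) = (LBINT s:{a<..b}. h s)"
        using ab by (intro set_lebesgue_integral_cong) (auto simp: h'_def)
      have "?F f \<in> \<G>" "?F (\<lambda>x. - f x) \<in> \<G>" unfolding \<G>_def using f C0_uminus[OF f(1)] by fastforce+
      from hG[OF this(1) ab(2)] hG[OF this(2) ab(2)] show ?thesis by (simp add: eq abs_le_iff)
    qed
    have eq: "(LBINT s:{a<..b}. h' s) = (LBINT s:{max 0 a<..max 0 b}. h' s)"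
      by (rule set_integral_Ioc_max_0[OF h'int h'neg])
    show ?thesis
    proof (cases "b \<le> 0")
      case True then show ?thesis using nonneg[of a b] ab by simp
    next
      case False
      then show ?thesis
        unfolding eq using pos[of "max 0 a" b] ab by simp
    qed
  qed
  have F_le: "\<bar>?F f b - ?F f a\<bar> \<le> (LBINT s:{a<..b}. \<epsilon> * h' s)"
    if f: "f \<in> C0" "\<forall>x. \<bar>f x\<bar> \<le> \<epsilon>" and ab: "a < b" for f a b \<epsilon>
  proof (cases "\<epsilon> = 0")
    case True then show ?thesis using f(2) by simp
  next
    case False
    then have \<epsilon>: "0 < \<epsilon>" using f(2) abs_ge_zero[of "f undefined"] by (metis order_le_less order_trans)
    have "\<bar>?F (\<lambda>x. inverse \<epsilon> * f x) b - ?F (\<lambda>x. inverse \<epsilon> * f x) a\<bar> \<le> (LBINT s:{a<..b}. h' s)"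
      using f \<epsilon> by (intro F_one C0_cmult ab) (auto simp: abs_mult field_simps)
    then have "inverse \<epsilon> * \<bar>?F f b - ?F f a\<bar> \<le> (LBINT s:{a<..b}. h' s)"
      unfolding F_cmult using \<epsilon> by (simp add: right_diff_distrib[symmetric] abs_mult)
    then have "\<bar>?F f b - ?F f a\<bar> \<le> \<epsilon> * (LBINT s:{a<..b}. h' s)" using \<epsilon> by (simp add: field_simps)
    then show ?thesis by simp
  qed
  have ex_dens: "\<exists>g. f \<in> C0 \<longrightarrow> g \<in> borel_measurable borel \<and> (\<forall>a b. set_integrable lborel {a..b} g) \<and>
      (\<forall>a b. a < b \<longrightarrow> ?F f b - ?F f a = (LBINT s:{a<..b}. g s)) \<and> (\<forall>s<0. g s = 0)" for f
  proof (cases "f \<in> C0")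
    case True
    obtain B where B: "0 \<le> B" "\<And>x. \<bar>f x\<bar> \<le> B" using bcontfun_bound[OF C0_bcontfun[OF True]] by metis
    obtain g where g: "g \<in> borel_measurable borel" "\<And>a b. set_integrable lborel {a..b} g"
      "\<And>a b. a < b \<Longrightarrow> ?F f b - ?F f a = (LBINT s:{a<..b}. g s)"
    proof (rule density_of_dominated_increments[of "\<lambda>s. B * h' s" "?F f"])
      show "\<bar>?F f b - ?F f a\<bar> \<le> (LBINT s:{a<..b}. B * h' s)" if "a < b" for a b
        using F_le[OF True _ that, of B] B(2) by blast
      show "set_integrable lborel {a..b} (\<lambda>s. B * h' s)" for a b using h'int by simp
    qed (use B h'0 h'neg F_cont[OF True] in auto)
    define g' where "g' s = (if s < 0 then 0 else g s)" for s
    have g'm: "g' \<in> borel_measurable borel" unfolding g'_def[abs_def] using g(1) by measurable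
    have g'i: "set_integrable lborel {a..b} g'" for a b
      unfolding set_integrable_def
    proof (rule Bochner_Integration.integrable_bound[OF g(2)[of a b, unfolded set_integrable_def]])
      show "(\<lambda>s. indicator {a..b} s *\<^sub>R g' s) \<in> borel_measurable lborel" using g'm by simp
      show "AE s in lborel. norm (indicator {a..b} s *\<^sub>R g' s) \<le> norm (indicator {a..b} s *\<^sub>R g s)"
        by (auto simp: g'_def indicator_def)
    qed
    have "?F f b - ?F f a = (LBINT s:{a<..b}. g' s)" if ab: "a < b" for a b
    proof -
      have g'neg: "g' s = 0" if "s < 0" for s using that by (simp add: g'_def)
      have eq: "(LBINT s:{a<..b}. g' s) = (LBINT s:{max 0 a<..max 0 b}. g' s)"
        by (rule set_integral_Ioc_max_0[OF g'i g'neg])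
      show ?thesis
      proof (cases "b \<le> 0")
        case True
        then show ?thesis unfolding eq using ab by (simp add: set_lebesgue_integral_def)
      next
        case False
        have "(LBINT s:{a<..b}. g' s) = (LBINT s:{max 0 a<..b}. g s)"
        proof -
          have "max 0 b = b" using False by simp
          then have "(LBINT s:{a<..b}. g' s) = (LBINT s:{max 0 a<..b}. g' s)" using eq by simp
          also have "\<dots> = (LBINT s:{max 0 a<..b}. g s)"
            by (intro set_lebesgue_integral_cong) (auto simp: g'_def)
          finally show ?thesis .
        qed
        then show ?thesis using g(3)[of "max 0 a" b] ab False by simp
      qed
    qed
    then show ?thesis using g'm g'i by (intro exI[of _ g']) (auto simp: g'_def)
  qed simp
  then obtain dens where dens: "\<And>f. f \<in> C0 \<Longrightarrow> dens f \<in> borel_measurable borel"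
    "\<And>f a b. f \<in> C0 \<Longrightarrow> set_integrable lborel {a..b} (dens f)"
    "\<And>f a b. f \<in> C0 \<Longrightarrow> a < b \<Longrightarrow> ?F f b - ?F f a = (LBINT s:{a<..b}. dens f s)"
    "\<And>f s. f \<in> C0 \<Longrightarrow> s < 0 \<Longrightarrow> dens f s = 0" by metis
  have AE_eq: "AE s in lborel. g1 s = g2 s"
    if "g1 \<in> borel_measurable borel" "g2 \<in> borel_measurable borel"
      "\<And>a b. set_integrable lborel {a..b} g1" "\<And>a b. set_integrable lborel {a..b} g2"
      "\<And>s. s < 0 \<Longrightarrow> g1 s = 0" "\<And>s. s < 0 \<Longrightarrow> g2 s = 0"
      "\<And>a b. a < b \<Longrightarrow> (LBINT s:{a<..b}. g1 s) = (LBINT s:{a<..b}. g2 s)" for g1 g2 :: "real \<Rightarrow> real"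
  proof -
    have "AE s in lborel. g1 s \<le> g2 s" by (rule AE_le_of_set_integral_le) (use that in auto)
    moreover have "AE s in lborel. g2 s \<le> g1 s" by (rule AE_le_of_set_integral_le) (use that in auto)
    ultimately show ?thesis by eventually_elim simp
  qed
  have ioc: "set_integrable lborel {a<..b} (dens f)" if "f \<in> C0" for f a b
    by (rule set_integrable_Ioc[OF dens(2)[OF that]])
  obtain u where u: "\<And>s. u s \<in> C0_dual" "\<And>f. f \<in> C0 \<Longrightarrow> (\<lambda>s. u s f) \<in> borel_measurable borel"
    "\<And>f. f \<in> C0 \<Longrightarrow> AE s in lborel. u s f = dens f s"
  proof (rule C0_dual_version[of dens h'])
    \<comment> \<open>\<langle>f, \<nu>\<rangle> is linear in f, so the relation holds after
      integration over every interval, and therefore almost everywhere.\<close>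
    show "AE s in lborel. dens (\<lambda>x. f x + g x) s = dens f s + dens g s" if f: "f \<in> C0" and g: "g \<in> C0" for f g
    proof (rule AE_eq)
      note fg = C0_add[OF f g]
      show "(LBINT s:{a<..b}. dens (\<lambda>x. f x + g x) s) = (LBINT s:{a<..b}. dens f s + dens g s)" if "a < b" for a b
        using dens(3)[OF fg that] dens(3)[OF f that] dens(3)[OF g that] F_add[OF f g]
        by (simp add: set_integral_add(2)[OF ioc[OF f] ioc[OF g]])
      show "set_integrable lborel {a..b} (\<lambda>s. dens f s + dens g s)" for a b
        by (intro set_integral_add dens f g)
      show "dens (\<lambda>x. f x + g x) \<in> borel_measurable borel" "(\<lambda>s. dens f s + dens g s) \<in> borel_measurable borel"
        using dens(1)[OF f] dens(1)[OF g] dens(1)[OF fg] by auto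
    qed (use dens(2,4) f g C0_add[OF f g] in auto)
    show "AE s in lborel. dens (\<lambda>x. c * f x) s = c * dens f s" if f: "f \<in> C0" for f c
    proof (rule AE_eq)
      note cf = C0_cmult[OF f, of c]
      show "(LBINT s:{a<..b}. dens (\<lambda>x. c * f x) s) = (LBINT s:{a<..b}. c * dens f s)" if "a < b" for a b
        using dens(3)[OF cf that] dens(3)[OF f that] by (simp add: right_diff_distrib[symmetric])
      show "dens (\<lambda>x. c * f x) \<in> borel_measurable borel" "(\<lambda>s. c * dens f s) \<in> borel_measurable borel"
        using dens(1)[OF f] dens(1)[OF cf] by auto
      show "set_integrable lborel {a..b} (\<lambda>s. c * dens f s)" for a b
        using dens(2)[OF f] by simp
    qed (use dens(2,4) f C0_cmult[OF f, of c] in auto)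
    show "AE s in lborel. \<bar>dens f s\<bar> \<le> \<epsilon> * h' s" if f: "f \<in> C0" "\<forall>x. \<bar>f x\<bar> \<le> \<epsilon>" for f \<epsilon>
    proof -
      have le: "\<bar>LBINT s:{a<..b}. dens f s\<bar> \<le> (LBINT s:{a<..b}. \<epsilon> * h' s)" if "a < b" for a b
        using F_le[OF f that] dens(3)[OF f(1) that] by simp
      have "AE s in lborel. dens f s \<le> \<epsilon> * h' s"
        by (rule AE_le_of_set_integral_le)
           (use dens(1,2,4)[OF f(1)] h' h'int h'neg le in \<open>auto simp: abs_le_iff\<close>)
      moreover have "AE s in lborel. - dens f s \<le> \<epsilon> * h' s"
      proof (rule AE_le_of_set_integral_le)
        show "(LBINT s:{a<..b}. - dens f s) \<le> (LBINT s:{a<..b}. \<epsilon> * h' s)" if "a < b" for a b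
          using le[OF that] by (simp add: set_integral_uminus ioc f abs_le_iff)
        show "set_integrable lborel {a..b} (\<lambda>s. - dens f s)" for a b
          using dens(2)[OF f(1), of a b] by (simp add: set_integrable_def)
      qed (use dens(1,4)[OF f(1)] h' h'int h'neg in auto)
      ultimately show ?thesis by eventually_elim (simp add: abs_le_iff)
    qed
  qed (use dens(1) h'0 in auto)
  have "is_velocity \<nu> u"
    unfolding is_velocity_def
  proof (intro conjI ballI allI impI)
    show "u s \<in> C0_dual" for s by (rule u)
    fix f :: "'a \<Rightarrow> real" assume f: "f \<in> C0"
    show "set_borel_measurable borel {0..} (\<lambda>s. u s f)"
      unfolding set_borel_measurable_def using u(2)[OF f] by measurable
    fix t :: real assume t: "0 \<le> t"
    have ae: "AE s in lborel. indicator {0..t} s *\<^sub>R u s f = indicator {0..t} s *\<^sub>R dens f s"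
      using u(3)[OF f] by eventually_elim simp
    have m1: "(\<lambda>s. indicator {0..t} s *\<^sub>R u s f) \<in> borel_measurable lborel"
      and m2: "(\<lambda>s. indicator {0..t} s *\<^sub>R dens f s) \<in> borel_measurable lborel"
      using u(2)[OF f] dens(1)[OF f] by auto
    show "set_integrable lborel {0..t} (\<lambda>s. u s f)"
      using dens(2)[OF f, of 0 t] ae m1 m2 unfolding set_integrable_def
      by (subst integrable_cong_AE) auto
    have "(LBINT s:{0..t}. u s f) = (LBINT s:{0..t}. dens f s)"
      unfolding set_lebesgue_integral_def by (rule integral_cong_AE[OF m1 m2 ae])
    \<comment> \<open>The density formula concerns half-open intervals. Starting at -1 includes the
      point 0 and changes nothing else: \<open>dens f\<close> vanishes before 0, and
      \<open>?F f (- 1)\<close> is the value at time 0.\<close>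
    also have "\<dots> = (LBINT s:{- 1<..t}. dens f s)"
      unfolding set_lebesgue_integral_def
      by (intro Bochner_Integration.integral_cong) (auto simp: indicator_def not_le dens(4)[OF f])
    also have "\<dots> = ?F f t - ?F f (- 1)" using dens(3)[OF f, of "- 1" t] t by simp
    finally show "(\<integral>x. f x \<partial>\<nu> t) - (\<integral>x. f x \<partial>\<nu> 0) = (LBINT s:{0..t}. u s f)" using t by simp
  qed
  then show ?thesis by blast
qed

end

theorem proposition5p10:
  fixes lam :: "'a::polish_space \<Rightarrow> real"
    and \<mu> :: "'a \<Rightarrow> 'a measure"
    and P0 :: "'a measure"
    and M :: "'w measure"
    and X :: "real \<Rightarrow> 'w \<Rightarrow> 'a"
    and P :: "real \<Rightarrow> 'a \<Rightarrow> 'a measure"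
    and \<nu> :: "real \<Rightarrow> 'a measure"
  assumes "locally_compact_space (euclidean :: 'a topology)"
    and "\<And>x. 0 \<le> lam x" and "bounded (range lam)"
    and "transition_function \<mu>"
    and "continuous_map euclidean weak_topology \<mu>"
    and "P0 \<in> probs"
    and "markov_process M X P0 P"
    and "feller_transition_functions P"
    and "C0_generator P = {(f, jump_generator lam \<mu> f) | f. f \<in> C0}"
    and "\<nu> \<in> cadlag_paths weak_topology"
  shows "(\<forall>u. \<nu> \<in> AC_paths \<and> is_velocity \<nu> u \<longrightarrow>
            path_rate P0 P \<nu> =
              relative_entropy (\<nu> 0) P0 + action (jump_generator lam \<mu>) \<nu> u)
       \<and> (\<nu> \<notin> AC_paths \<longrightarrow> path_rate P0 P \<nu> = \<infinity>)"
proof (cases "\<nu> \<in> continuous_paths weak_topology")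
  case False
  then show ?thesis by (simp add: AC_paths_def path_rate_def)
next
  case True
  obtain \<Lambda> where \<Lambda>: "\<And>x. lam x \<le> \<Lambda>"
    using \<open>bounded (range lam)\<close> unfolding bounded_real by (auto simp: abs_le_iff)
  interpret jump_path lam \<mu> P \<Lambda> \<nu>
    by unfold_locales (use assms True \<Lambda> in auto)
  show ?thesis
  proof (intro conjI allI impI)
    fix u assume "\<nu> \<in> AC_paths \<and> is_velocity \<nu> u"
    then have "partition_rate = action (jump_generator lam \<mu>) \<nu> u"
      using action_le_partition_rate partition_rate_le_action[OF assms(1)] by (intro antisym) auto
    then show "path_rate P0 P \<nu> = relative_entropy (\<nu> 0) P0 + action (jump_generator lam \<mu>) \<nu> u"
      by (simp add: path_rate_eq)
  next
    assume "\<nu> \<notin> AC_paths"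
    then have "\<not> (\<exists>u. is_velocity \<nu> u)" using True by (simp add: AC_paths_def)
    then have "partition_rate = \<infinity>" using velocity_exists by auto
    then show "path_rate P0 P \<nu> = \<infinity>" by (simp add: path_rate_eq)
  qed
qed

end
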